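(* The space $\mathfrak{M}(M(\mathbb{T}))$ contains uncountably many pairwise disjoint nonempty open subsets. In particular, $\mathfrak{M}(M(\mathbb{T}))$ is not separable (it has no countable dense subset).
   Context: $\mathbb{T}$ is the circle group (identified with $\mathbb{R}/2\pi\mathbb{Z}$). $M(\mathbb{T})$ is the commutative unital Banach algebra of complex regular Borel measures on $\mathbb{T}$, with convolution as multiplication, the total variation norm, and unit $\delta_0$. $\mathfrak{M}(M(\mathbb{T}))$ is its Gelfand (maximal ideal) space: the set of all nonzero multiplicative linear functionals on $M(\mathbb{T})$ with the weak$^*$ topology, which is a compact Hausdorff space. *)

theory Defs
  imports "HOL-Analysis.Analysis"
begin

section \<open>Complex measures\<close>

text \<open>
  A complex (or real signed) measure on the measurable space underlying \<open>M\<close> is a set function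
  with values in \<open>complex\<close> (or \<open>real\<close>); only \<open>space M\<close> and \<open>sets M\<close> matter below.
\<close>

definition complex_measure :: "'a measure \<Rightarrow> ('a set \<Rightarrow> complex) \<Rightarrow> bool" where
  "complex_measure M \<mu> \<longleftrightarrow>
     (\<forall>A :: nat \<Rightarrow> 'a set. range A \<subseteq> sets M \<longrightarrow> disjoint_family A \<longrightarrow>
        (\<lambda>i. \<mu> (A i)) sums \<mu> (\<Union>i. A i))"

definition total_variation ::
    "'a measure \<Rightarrow> ('a set \<Rightarrow> 'b::real_normed_vector) \<Rightarrow> 'a set \<Rightarrow> ennreal" where
  "total_variation M \<mu> E =
     (SUP A \<in> {A :: nat \<Rightarrow> 'a set. range A \<subseteq> sets M \<and> disjoint_family A \<and> (\<Union>i. A i) = E}.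
        \<Sum>i. ennreal (norm (\<mu> (A i))))"

text \<open>
  The positive part \<open>(\<bar>\<sigma>\<bar> + \<sigma>) / 2\<close> of the Jordan decomposition of a finite signed measure \<open>\<sigma>\<close>;
  the negative part of \<open>\<sigma>\<close> is the positive part of \<open>- \<sigma>\<close>.
\<close>

definition jordan_pos :: "'a measure \<Rightarrow> ('a set \<Rightarrow> real) \<Rightarrow> 'a measure" where
  "jordan_pos M \<sigma> = measure_of (space M) (sets M)
     (\<lambda>E. ennreal ((enn2real (total_variation M \<sigma> E) + \<sigma> E) / 2))"

definition signed_integral :: "'a measure \<Rightarrow> ('a set \<Rightarrow> real) \<Rightarrow> ('a \<Rightarrow> complex) \<Rightarrow> complex" where
  "signed_integral M \<sigma> f =
     integral\<^sup>L (jordan_pos M \<sigma>) f - integral\<^sup>L (jordan_pos M (\<lambda>E. - \<sigma> E)) f"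

definition cmeasure_integral ::
    "'a measure \<Rightarrow> ('a set \<Rightarrow> complex) \<Rightarrow> ('a \<Rightarrow> complex) \<Rightarrow> complex" where
  "cmeasure_integral M \<mu> f =
     signed_integral M (\<lambda>E. Re (\<mu> E)) f + \<i> * signed_integral M (\<lambda>E. Im (\<mu> E)) f"


section \<open>The measure algebra of the circle group\<close>

text \<open>
  The circle group is realised multiplicatively, as the complex numbers of modulus one; the
  isomorphism with the reals modulo \<open>2 * pi\<close> is \<open>t \<mapsto> cis t\<close>.
\<close>

definition circle :: "complex set" where
  "circle = sphere 0 1"

definition circle_borel :: "complex measure" where
  "circle_borel = restrict_space borel circle"

definition regular_on_circle :: "(complex set \<Rightarrow> complex) \<Rightarrow> bool" where
  "regular_on_circle \<mu> \<longleftrightarrow>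
     (\<forall>E \<in> sets circle_borel.
        total_variation circle_borel \<mu> E =
          (INF V \<in> {V. openin (top_of_set circle) V \<and> E \<subseteq> V}. total_variation circle_borel \<mu> V) \<and>
        total_variation circle_borel \<mu> E =
          (SUP K \<in> {K. compact K \<and> K \<subseteq> E}. total_variation circle_borel \<mu> K))"

text \<open>
  Set functions are normalised to vanish outside the Borel sets, so that equality in HOL is
  equality of measures.
\<close>

definition circle_measures :: "(complex set \<Rightarrow> complex) set" where
  "circle_measures =
     {\<mu>. complex_measure circle_borel \<mu> \<and> regular_on_circle \<mu> \<and>
          (\<forall>E. E \<notin> sets circle_borel \<longrightarrow> \<mu> E = 0)}"

text \<open>
  \<open>(\<mu> * \<nu>)(E)\<close> is the integral of \<open>\<mu> (E y\<^sup>-\<^sup>1)\<close> with respect to \<open>d\<nu>(y)\<close>, where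
  \<open>E y\<^sup>-\<^sup>1 = {x \<in> circle. x * y \<in> E}\<close>.
\<close>

definition circle_convolution ::
    "(complex set \<Rightarrow> complex) \<Rightarrow> (complex set \<Rightarrow> complex) \<Rightarrow> complex set \<Rightarrow> complex" where
  "circle_convolution \<mu> \<nu> =
     (\<lambda>E. if E \<in> sets circle_borel
          then cmeasure_integral circle_borel \<nu> (\<lambda>y. \<mu> {x \<in> circle. x * y \<in> E})
          else 0)"


section \<open>The Gelfand space\<close>

text \<open>
  Functionals on the measure algebra are represented by functions that are \<open>undefined\<close> outside
  \<^term>\<open>circle_measures\<close>. Continuity is not required: multiplicative linear functionals on a
  Banach algebra are automatically bounded.
\<close>

definition gelfand_characters :: "((complex set \<Rightarrow> complex) \<Rightarrow> complex) set" where
  "gelfand_characters =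
     {\<phi> \<in> extensional circle_measures.
        (\<forall>\<mu>\<in>circle_measures. \<forall>\<nu>\<in>circle_measures. \<phi> (\<lambda>E. \<mu> E + \<nu> E) = \<phi> \<mu> + \<phi> \<nu>) \<and>
        (\<forall>c. \<forall>\<mu>\<in>circle_measures. \<phi> (\<lambda>E. c * \<mu> E) = c * \<phi> \<mu>) \<and>
        (\<forall>\<mu>\<in>circle_measures. \<forall>\<nu>\<in>circle_measures. \<phi> (circle_convolution \<mu> \<nu>) = \<phi> \<mu> * \<phi> \<nu>) \<and>
        (\<exists>\<mu>\<in>circle_measures. \<phi> \<mu> \<noteq> 0)}"

text \<open>
  The weak* topology is the topology of pointwise convergence on \<^term>\<open>circle_measures\<close>, that is,
  the subspace topology inherited from the product of copies of the complex plane.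
\<close>

definition gelfand_space :: "((complex set \<Rightarrow> complex) \<Rightarrow> complex) topology" where
  "gelfand_space =
     subtopology (product_topology (\<lambda>\<mu>. euclidean) circle_measures) gelfand_characters"

end

theory Submission
  imports Defs "HOL-Probability.Probability"
begin

text \<open>
  For infinite \<open>A\<close>, let \<open>R\<^sub>A\<close> be the Riesz product \<open>\<Prod>\<^bsub>k\<in>A\<^esub> (1 + cos (3\<^sup>k t))\<close>. Its Fourier
  coefficients are at most \<open>1/2\<close> away from \<open>0\<close>, and they multiply so that the spectrum of
  \<open>R\<^sub>A * R\<^sub>B\<close> only involves \<open>A \<inter> B\<close>. Put
  \<open>V\<^sub>A = {\<phi>. \<bar>\<phi>(R\<^sub>A)\<bar> > 1/2, \<bar>\<phi>(\<lambda>)\<bar> < 1/2}\<close> with \<open>\<lambda>\<close> the Haar measure. If \<open>A \<inter> B\<close> is finite then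
  \<open>R\<^sub>A * R\<^sub>B\<close> is a trigonometric polynomial, on which a character vanishes unless it is evaluation of
  the transform at an integer; hence \<open>V\<^sub>A \<inter> V\<^sub>B = {}\<close>. There are uncountably many infinite sets of
  naturals with pairwise finite intersections.

  A point of \<open>V\<^sub>A\<close> is obtained as follows. Let \<open>k\<close> tend to infinity in \<open>A\<close> along an ultrafilter.
  On each \<open>L\<^sup>1(|\<mu>|)\<close> the functions \<open>z\<^bsup>3^k\<^esup>\<close> have a weak limit \<open>\<chi>\<^sub>\<mu>\<close> of modulus at most one, and
  \<open>\<mu> \<mapsto> \<mu> {\<chi>\<^sub>\<mu> \<noteq> 0}\<close> is multiplicative. It maps \<open>R\<^sub>A\<close> to \<open>1\<close>, since there \<open>\<chi> = 1/2\<close>, and \<open>\<lambda>\<close> to \<open>0\<close>.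
  The moments of \<open>\<bar>\<chi>\<^sub>\<mu>\<bar>\<^sup>2\<close> are iterated limits of the transform of \<open>\<mu>\<close>, so the functional can be
  written in terms of the transform alone.
\<close>

section \<open>Total variation and the Jordan decomposition\<close>

text \<open>Evaluation of the transform at \<open>0\<close> gives the Haar measure the value 1, and
  evaluation at \<open>n \<noteq> 0\<close> gives \<open>R\<^sub>A\<close> at most 1/2. The two
  conditions defining \<open>V\<^sub>A\<close> are open and exclude every evaluation, so the points
  of \<open>V\<^sub>A\<close> lie outside the closure of the integers. In particular the plain weak
  limit, the functional that integrates \<open>\<chi>\<^sub>\<mu>\<close>, does not serve: it takes
  \<open>R\<^sub>A\<close> to 1/2 only. Replacing \<open>\<chi>\<^sub>\<mu>\<close> by the indicator
  of its support raises this value to 1.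

  Multiplicativity rests on the fact that \<open>\<chi>\<close> for \<open>\<mu> * \<nu>\<close>,
  taken at \<open>x y\<close>, is \<open>\<chi>\<^sub>\<mu>\<close> at \<open>x\<close> times
  \<open>\<chi>\<^sub>\<nu>\<close> at \<open>y\<close>, almost everywhere. On the side of the
  transforms this only says that a limit of products is the product of the limits.

  The frequencies \<open>3^k\<close> make the representation of an integer as a signed sum of
  distinct frequencies unique (balanced ternary). The coefficient 1 of the cosine is the largest for
  which all factors stay nonnegative.\<close>

definition vector_measure :: "'a measure \<Rightarrow> ('a set \<Rightarrow> 'b::real_normed_vector) \<Rightarrow> bool" where
  "vector_measure M \<mu> \<longleftrightarrow>
     (\<forall>A :: nat \<Rightarrow> 'a set. range A \<subseteq> sets M \<longrightarrow> disjoint_family A \<longrightarrow>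
        (\<lambda>i. \<mu> (A i)) sums \<mu> (\<Union>i. A i))"

text \<open>Real and complex values are treated together, because the total variation is needed both
  for a complex measure and for its real and imaginary parts.\<close>

lemma complex_measure_iff: "complex_measure M \<mu> \<longleftrightarrow> vector_measure M \<mu>"
  by (simp add: complex_measure_def vector_measure_def)

lemma vector_measureD:
  "vector_measure M \<mu> \<Longrightarrow> range A \<subseteq> sets M \<Longrightarrow> disjoint_family A \<Longrightarrow> (\<lambda>i::nat. \<mu> (A i)) sums \<mu> (\<Union>i. A i)"
  by (simp add: vector_measure_def)

text \<open>The constant sequence of empty sets is a disjoint family, and a constant series
  converges only if its term is 0.\<close>

lemma vector_measure_empty:
  assumes "vector_measure M \<mu>" shows "\<mu> {} = 0"
proof -
  have "(\<lambda>i::nat. \<mu> {}) sums \<mu> {}"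
    using vector_measureD[OF assms, of "\<lambda>_. {}"] by (simp add: disjoint_family_on_def)
  then show ?thesis by (metis sums_summable summable_const_iff)
qed

lemma vector_measure_Un:
  assumes \<mu>: "vector_measure M \<mu>" and "A \<in> sets M" "B \<in> sets M" "A \<inter> B = {}"
  shows "\<mu> (A \<union> B) = \<mu> A + \<mu> B"
proof -
  have "(\<lambda>i. \<mu> (binaryset A B i)) sums \<mu> (\<Union>i. binaryset A B i)"
    using assms by (intro vector_measureD[OF \<mu>])
      (auto simp: binaryset_def disjoint_family_on_def range_binaryset_eq)
  moreover have "(\<lambda>i. \<mu> (binaryset A B i)) sums (\<mu> A + \<mu> B)"
    by (rule binaryset_sums) (rule vector_measure_empty[OF \<mu>])
  ultimately show ?thesis
    by (simp add: UN_binaryset_eq sums_unique2)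
qed

lemma vector_measure_Diff:
  assumes \<mu>: "vector_measure M \<mu>" and "A \<in> sets M" "B \<in> sets M" "B \<subseteq> A"
  shows "\<mu> (A - B) = \<mu> A - \<mu> B"
  using vector_measure_Un[OF \<mu>, of B "A - B"] assms by (auto simp: Un_absorb1)

lemma vector_measure_UN_finite:
  assumes \<mu>: "vector_measure M \<mu>" and "finite I" "\<And>i. i \<in> I \<Longrightarrow> A i \<in> sets M" "disjoint_family_on A I"
  shows "\<mu> (\<Union>i\<in>I. A i) = (\<Sum>i\<in>I. \<mu> (A i))"
  using assms(2-)
proof (induction I)
  case empty then show ?case by (simp add: vector_measure_empty[OF \<mu>])
next
  case (insert i I)
  have "\<mu> (A i \<union> (\<Union>i\<in>I. A i)) = \<mu> (A i) + \<mu> (\<Union>i\<in>I. A i)"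
    using insert by (intro vector_measure_Un[OF \<mu>]) (auto simp: disjoint_family_on_def)
  then show ?case using insert by (auto simp: disjoint_family_on_def)
qed

lemma vector_measure_bounded_linear:
  assumes "vector_measure M \<mu>" "bounded_linear f"
  shows "vector_measure M (\<lambda>E. f (\<mu> E))"
  using assms bounded_linear.sums unfolding vector_measure_def by blast

lemma vector_measure_add:
  assumes "vector_measure M \<mu>" "vector_measure M \<nu>"
  shows "vector_measure M (\<lambda>E. \<mu> E + \<nu> E)"
  using assms sums_add unfolding vector_measure_def by blast

section \<open>Additivity and finiteness of the total variation\<close>

lemma total_variation_upper:
  assumes "range A \<subseteq> sets M" "disjoint_family A" "(\<Union>i. A i) = E"
  shows "(\<Sum>i. ennreal (norm (\<mu> (A i)))) \<le> total_variation M \<mu> E"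
  unfolding total_variation_def by (rule SUP_upper) (use assms in auto)

lemma norm_le_total_variation:
  assumes \<mu>: "vector_measure M \<mu>" and E: "E \<in> sets M"
  shows "ennreal (norm (\<mu> E)) \<le> total_variation M \<mu> E"
proof -
  have "(\<Sum>i. ennreal (norm (\<mu> (binaryset E {} i)))) \<le> total_variation M \<mu> E"
    using E by (intro total_variation_upper)
      (auto simp: binaryset_def disjoint_family_on_def UN_binaryset_eq)
  moreover have "(\<lambda>i. ennreal (norm (\<mu> (binaryset E {} i)))) sums (ennreal (norm (\<mu> E)) + ennreal (norm (\<mu> {})))"
    by (rule binaryset_sums) (simp add: vector_measure_empty[OF \<mu>])
  ultimately show ?thesis
    by (simp add: sums_iff vector_measure_empty[OF \<mu>])
qed

lemma total_variation_empty:
  assumes \<mu>: "vector_measure M \<mu>" shows "total_variation M \<mu> {} = 0"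
proof -
  have "total_variation M \<mu> {} \<le> 0"
    unfolding total_variation_def
  proof (rule SUP_least)
    fix A :: "nat \<Rightarrow> 'a set"
    assume "A \<in> {A. range A \<subseteq> sets M \<and> disjoint_family A \<and> (\<Union>i. A i) = {}}"
    then have "A i = {}" for i by auto
    then show "(\<Sum>i. ennreal (norm (\<mu> (A i)))) \<le> 0" by (simp add: vector_measure_empty[OF \<mu>])
  qed
  then show ?thesis by simp
qed

text \<open>A partition of \<open>E\<close> and one of \<open>F\<close> interleave to a partition of
  \<open>E \<union> F\<close>; the two suprema are then taken one after the other.\<close>

lemma total_variation_superadditive:
  assumes E: "E \<in> sets M" and F: "F \<in> sets M" and EF: "E \<inter> F = {}"
  shows "total_variation M \<mu> E + total_variation M \<mu> F \<le> total_variation M \<mu> (E \<union> F)"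
proof -
  let ?P = "\<lambda>E. {A :: nat \<Rightarrow> 'a set. range A \<subseteq> sets M \<and> disjoint_family A \<and> (\<Union>i. A i) = E}"
  let ?s = "\<lambda>A :: nat \<Rightarrow> 'a set. \<Sum>i. ennreal (norm (\<mu> (A i)))"
  have ne: "?P E \<noteq> {}" if "E \<in> sets M" for E
  proof -
    have "(\<lambda>i::nat. if i = 0 then E else {}) \<in> ?P E"
      using that by (auto simp: disjoint_family_on_def split: if_splits)
    then show ?thesis by blast
  qed
  have key: "?s A + ?s B \<le> total_variation M \<mu> (E \<union> F)" if A: "A \<in> ?P E" and B: "B \<in> ?P F" for A B
  proof -
    define C where "C n = (if even n then A (n div 2) else B (n div 2))" for n
    have disjA: "A i \<inter> A j = {}" "B i \<inter> B j = {}" if "i \<noteq> j" for i j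
      using A B that by (auto simp: disjoint_family_on_def)
    have disjAB: "A i \<inter> B j = {}" "B j \<inter> A i = {}" for i j
      using A B EF by auto
    have UC: "(\<Union>i. C i) = E \<union> F"
    proof -
      have "A i \<subseteq> (\<Union>i. C i)" for i
        by (rule order_trans[OF _ UN_upper[of "2*i"]]) (auto simp: C_def)
      moreover have "B i \<subseteq> (\<Union>i. C i)" for i
        by (rule order_trans[OF _ UN_upper[of "2*i+1"]]) (auto simp: C_def)
      moreover have "C i \<subseteq> E \<union> F" for i using A B by (auto simp: C_def)
      moreover have "E = (\<Union>i. A i)" "F = (\<Union>i. B i)" using A B by auto
      ultimately show ?thesis by (intro equalityI UN_least Un_least) (simp_all add: UN_least)
    qed
    have disj: "disjoint_family C"
    proof (unfold disjoint_family_on_def, intro ballI impI)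
      fix m n :: nat assume "m \<noteq> n"
      show "C m \<inter> C n = {}"
      proof (cases "even m = even n")
        case True
        then have "m div 2 \<noteq> n div 2" using \<open>m \<noteq> n\<close>
          by (metis even_two_times_div_two odd_two_times_div_two_succ)
        then show ?thesis using True disjA by (simp add: C_def)
      next
        case False then show ?thesis using disjAB by (auto simp: C_def)
      qed
    qed
    let ?f = "\<lambda>A i. ennreal (norm (\<mu> (A i)))"
    have fin: "(\<Sum>i<N. ?f A i) + (\<Sum>i<N. ?f B i) = (\<Sum>i<2*N. ?f C i)" for N
    proof (induction N)
      case (Suc N)
      have "{..<2 * Suc N} = insert (2*N+1) (insert (2*N) {..<2*N})" by auto
      then show ?case using Suc by (simp add: C_def ac_simps del: sum_ennreal)
    qed simp
    have "(\<lambda>N. (\<Sum>i<N. ?f A i) + (\<Sum>i<N. ?f B i)) \<longlonglongrightarrow> ?s A + ?s B"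
      by (intro tendsto_add summable_LIMSEQ) auto
    moreover have "(\<Sum>i<N. ?f A i) + (\<Sum>i<N. ?f B i) \<le> ?s C" for N
      unfolding fin by (rule sum_le_suminf) auto
    ultimately have "?s A + ?s B \<le> ?s C" by (intro LIMSEQ_le_const2) auto
    also have "\<dots> \<le> total_variation M \<mu> (E \<union> F)"
      using A B by (intro total_variation_upper UC disj) (auto simp: C_def)
    finally show ?thesis .
  qed
  have 1: "?s A + total_variation M \<mu> F \<le> total_variation M \<mu> (E \<union> F)" if A: "A \<in> ?P E" for A
  proof -
    have "?s A + (SUP B\<in>?P F. ?s B) = (SUP B\<in>?P F. ?s A + ?s B)"
      by (rule ennreal_SUP_add_right) (rule ne[OF F])
    also have "\<dots> \<le> total_variation M \<mu> (E \<union> F)"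
      by (rule SUP_least) (rule key[OF A])
    finally show ?thesis by (simp only: total_variation_def[of _ _ F])
  qed
  have "(SUP A\<in>?P E. ?s A) + total_variation M \<mu> F = (SUP A\<in>?P E. ?s A + total_variation M \<mu> F)"
    by (rule ennreal_SUP_add_left[symmetric]) (rule ne[OF E])
  also have "\<dots> \<le> total_variation M \<mu> (E \<union> F)"
    by (rule SUP_least) (rule 1)
  finally show ?thesis by (simp only: total_variation_def[of _ _ E])
qed

lemma total_variation_mono:
  assumes "E \<in> sets M" "F \<in> sets M" "E \<subseteq> F"
  shows "total_variation M \<mu> E \<le> total_variation M \<mu> F"
proof -
  have "total_variation M \<mu> E + total_variation M \<mu> (F - E) \<le> total_variation M \<mu> (E \<union> (F - E))"
    using assms by (intro total_variation_superadditive) auto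
  moreover have "E \<union> (F - E) = F" using assms by auto
  moreover have "total_variation M \<mu> E \<le> total_variation M \<mu> E + total_variation M \<mu> (F - E)"
    by simp
  ultimately show ?thesis by (metis order_trans)
qed

text \<open>One inequality is superadditivity on finite unions. For the other, a partition
  \<open>B\<close> of the union is refined by the sets \<open>A i\<close>: refining can only
  increase the sum, and the refined sum splits over \<open>i\<close>.\<close>

lemma total_variation_suminf:
  assumes \<mu>: "vector_measure M \<mu>" and A: "range A \<subseteq> sets M" "disjoint_family A"
  shows "(\<Sum>i::nat. total_variation M \<mu> (A i)) = total_variation M \<mu> (\<Union>i. A i)"
proof (rule antisym)
  have "(\<Sum>i<n. total_variation M \<mu> (A i)) \<le> total_variation M \<mu> (\<Union>i<n. A i)" for n
  proof (induction n)
    case (Suc n)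
    have "(\<Sum>i<Suc n. total_variation M \<mu> (A i)) \<le> total_variation M \<mu> (\<Union>i<n. A i) + total_variation M \<mu> (A n)"
      using Suc by (simp add: add_right_mono)
    also have "\<dots> \<le> total_variation M \<mu> ((\<Union>i<n. A i) \<union> A n)"
    proof (intro total_variation_superadditive)
      show "(\<Union>i<n. A i) \<in> sets M" "A n \<in> sets M" using A by auto
      have "A i \<inter> A n = {}" if "i < n" for i
        using A(2) that unfolding disjoint_family_on_def by (metis UNIV_I less_irrefl)
      then show "(\<Union>i<n. A i) \<inter> A n = {}" by blast
    qed
    finally show ?case by (simp add: lessThan_Suc Un_commute)
  qed (simp add: total_variation_empty[OF \<mu>])
  also have "total_variation M \<mu> (\<Union>i<n. A i) \<le> total_variation M \<mu> (\<Union>i. A i)" for n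
    using A by (intro total_variation_mono) auto
  finally have "(\<Sum>i<n. total_variation M \<mu> (A i)) \<le> total_variation M \<mu> (\<Union>i. A i)" for n .
  then show "(\<Sum>i::nat. total_variation M \<mu> (A i)) \<le> total_variation M \<mu> (\<Union>i. A i)"
    by (simp add: suminf_eq_SUP SUP_least)
next
  show "total_variation M \<mu> (\<Union>i. A i) \<le> (\<Sum>i::nat. total_variation M \<mu> (A i))"
    unfolding total_variation_def[of _ _ "\<Union>i. A i"]
  proof (rule SUP_least)
    fix B :: "nat \<Rightarrow> 'a set"
    assume "B \<in> {B. range B \<subseteq> sets M \<and> disjoint_family B \<and> (\<Union>i. B i) = (\<Union>i. A i)}"
    then have B: "range B \<subseteq> sets M" "disjoint_family B" "(\<Union>i. B i) = (\<Union>i. A i)" by auto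
    have Bj: "ennreal (norm (\<mu> (B j))) \<le> (\<Sum>i. ennreal (norm (\<mu> (B j \<inter> A i))))" for j
    proof -
      have "(\<lambda>i. \<mu> (B j \<inter> A i)) sums \<mu> (\<Union>i. B j \<inter> A i)"
        using A B(1) by (intro vector_measureD[OF \<mu>] disjoint_family_on_bisimulation[OF A(2)]) auto
      also have "(\<Union>i. B j \<inter> A i) = B j" using B by auto
      finally have s: "(\<lambda>i. \<mu> (B j \<inter> A i)) sums \<mu> (B j)" .
      have "(\<lambda>n. ennreal (norm (\<Sum>i<n. \<mu> (B j \<inter> A i)))) \<longlonglongrightarrow> ennreal (norm (\<mu> (B j)))"
        using s unfolding sums_def by (intro tendsto_ennrealI tendsto_norm)
      moreover have "ennreal (norm (\<Sum>i<n. \<mu> (B j \<inter> A i))) \<le> (\<Sum>i. ennreal (norm (\<mu> (B j \<inter> A i))))" for n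
      proof -
        have "ennreal (norm (\<Sum>i<n. \<mu> (B j \<inter> A i))) \<le> ennreal (\<Sum>i<n. norm (\<mu> (B j \<inter> A i)))"
          by (intro ennreal_leI norm_sum)
        also have "\<dots> = (\<Sum>i<n. ennreal (norm (\<mu> (B j \<inter> A i))))" by (simp add: sum_ennreal)
        also have "\<dots> \<le> (\<Sum>i. ennreal (norm (\<mu> (B j \<inter> A i))))" by (rule sum_le_suminf) auto
        finally show ?thesis .
      qed
      ultimately show ?thesis using LIMSEQ_le_const2 by blast
    qed
    have "(\<Sum>j. ennreal (norm (\<mu> (B j)))) \<le> (\<Sum>j. \<Sum>i. ennreal (norm (\<mu> (B j \<inter> A i))))"
      by (intro suminf_le Bj) auto
    also have "\<dots> = (\<Sum>i. \<Sum>j. ennreal (norm (\<mu> (B j \<inter> A i))))"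
    proof -
      \<comment> \<open>Two series of nonnegative terms are interchanged by monotone convergence for
        the counting measure.\<close>
      have "(\<Sum>i. \<integral>\<^sup>+ j. ennreal (norm (\<mu> (B j \<inter> A i))) \<partial>count_space UNIV) =
         (\<integral>\<^sup>+ j. (\<Sum>i. ennreal (norm (\<mu> (B j \<inter> A i)))) \<partial>count_space UNIV)"
        by (rule nn_integral_suminf[symmetric]) auto
      then show ?thesis by (simp add: nn_integral_count_space_nat)
    qed
    also have "\<dots> \<le> (\<Sum>i. total_variation M \<mu> (A i))"
    proof (intro suminf_le)
      fix i
      show "(\<Sum>j. ennreal (norm (\<mu> (B j \<inter> A i)))) \<le> total_variation M \<mu> (A i)"
        using A(1) B by (intro total_variation_upper disjoint_family_on_bisimulation[OF B(2)]) auto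
    qed auto
    finally show "(\<Sum>j. ennreal (norm (\<mu> (B j)))) \<le> (\<Sum>i. total_variation M \<mu> (A i))" .
  qed
qed

lemma total_variation_Un:
  assumes \<mu>: "vector_measure M \<mu>" and "A \<in> sets M" "B \<in> sets M" "A \<inter> B = {}"
  shows "total_variation M \<mu> (A \<union> B) = total_variation M \<mu> A + total_variation M \<mu> B"
proof -
  have "(\<Sum>i. total_variation M \<mu> (binaryset A B i)) = total_variation M \<mu> (\<Union>i. binaryset A B i)"
    using assms by (intro total_variation_suminf[OF \<mu>])
      (auto simp: binaryset_def disjoint_family_on_def range_binaryset_eq)
  then show ?thesis
    by (simp add: UN_binaryset_eq suminf_binaryset_eq total_variation_empty[OF \<mu>])
qed

lemma total_variation_uminus: "total_variation M (\<lambda>E. - \<mu> E) E = total_variation M \<mu> E"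
  by (simp add: total_variation_def)

text \<open>Some \<open>C \<subseteq> E\<close> has a value so large that both \<open>C\<close> and
  \<open>E - C\<close> have values of modulus at least 1. One of the two has infinite variation and
  is kept; the other is split off.\<close>

lemma total_variation_infinite_split:
  fixes \<sigma> :: "'a set \<Rightarrow> real"
  assumes \<sigma>: "vector_measure M \<sigma>" and E: "E \<in> sets M" and inf: "total_variation M \<sigma> E = \<infinity>"
  shows "\<exists>F\<in>sets M. F \<subseteq> E \<and> total_variation M \<sigma> F = \<infinity> \<and> 1 \<le> \<bar>\<sigma> (E - F)\<bar>"
proof -
  \<comment> \<open>The factor 2 pays for passing to the sets of a single sign; the summand
    \<open>\<bar>\<sigma> E\<bar>\<close> is what may be lost in passing from \<open>C\<close> to
    its complement in \<open>E\<close>.\<close>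
  define t where "t = 2 * (1 + \<bar>\<sigma> E\<bar>)"
  have "ennreal t < total_variation M \<sigma> E" by (simp add: inf)
  then obtain A where A: "range A \<subseteq> sets M" "disjoint_family A" "(\<Union>i. A i) = E"
    and tA: "ennreal t < (\<Sum>i::nat. ennreal (norm (\<sigma> (A i))))"
    unfolding total_variation_def less_SUP_iff by auto
  obtain n where "ennreal t < (\<Sum>i<n. ennreal (norm (\<sigma> (A i))))"
    using tA unfolding suminf_eq_SUP less_SUP_iff by auto
  then have n: "t < (\<Sum>i<n. \<bar>\<sigma> (A i)\<bar>)"
    by (subst (asm) sum_ennreal) (auto simp: ennreal_less_iff t_def simp del: ennreal_plus)
  define P N where "P = {i. i < n \<and> \<sigma> (A i) \<ge> 0}" and "N = {i. i < n \<and> \<sigma> (A i) < 0}"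
  have fin: "finite P" "finite N" "P \<inter> N = {}" "{..<n} = P \<union> N" by (auto simp: P_def N_def)
  have U: "\<sigma> (\<Union>i\<in>I. A i) = (\<Sum>i\<in>I. \<sigma> (A i))" if "finite I" for I
    using A that by (intro vector_measure_UN_finite[OF \<sigma>]) (auto intro: disjoint_family_on_mono[of _ UNIV])
  have "(\<Sum>i<n. \<bar>\<sigma> (A i)\<bar>) = (\<Sum>i\<in>P. \<bar>\<sigma> (A i)\<bar>) + (\<Sum>i\<in>N. \<bar>\<sigma> (A i)\<bar>)"
    unfolding fin(4) using fin by (intro sum.union_disjoint) auto
  also have "(\<Sum>i\<in>P. \<bar>\<sigma> (A i)\<bar>) = \<sigma> (\<Union>i\<in>P. A i)"
    unfolding U[OF fin(1)] by (intro sum.cong) (auto simp: P_def)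
  also have "(\<Sum>i\<in>N. \<bar>\<sigma> (A i)\<bar>) = - \<sigma> (\<Union>i\<in>N. A i)"
    unfolding U[OF fin(2)] sum_negf[symmetric] by (intro sum.cong) (auto simp: N_def)
  finally have "t < \<bar>\<sigma> (\<Union>i\<in>P. A i)\<bar> + \<bar>\<sigma> (\<Union>i\<in>N. A i)\<bar>" using n by linarith
  then have "t / 2 < \<bar>\<sigma> (\<Union>i\<in>P. A i)\<bar> \<or> t / 2 < \<bar>\<sigma> (\<Union>i\<in>N. A i)\<bar>" by linarith
  then obtain I where I: "I = P \<or> I = N" and tI: "t / 2 < \<bar>\<sigma> (\<Union>i\<in>I. A i)\<bar>" by blast
  define C where "C = (\<Union>i\<in>I. A i)"
  have C: "C \<in> sets M" "C \<subseteq> E" using A I fin by (auto simp: C_def)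
  have tC: "1 + \<bar>\<sigma> E\<bar> < \<bar>\<sigma> C\<bar>" using tI by (simp add: C_def t_def)
  then have c1: "1 \<le> \<bar>\<sigma> C\<bar>" by linarith
  have c2: "1 \<le> \<bar>\<sigma> (E - C)\<bar>"
    using tC unfolding vector_measure_Diff[OF \<sigma> E C] by linarith
  have "total_variation M \<sigma> E = total_variation M \<sigma> C + total_variation M \<sigma> (E - C)"
    using total_variation_Un[OF \<sigma> C(1), of "E - C"] C E by (simp add: Un_absorb1)
  then consider "total_variation M \<sigma> C = \<infinity>" | "total_variation M \<sigma> (E - C) = \<infinity>"
    unfolding inf infinity_ennreal_def by (metis ennreal_add_eq_top)
  then show ?thesis
  proof cases
    case 1 then show ?thesis using C c2 by blast
  next
    case 2
    have "E - (E - C) = C" using C by auto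
    then show ?thesis using 2 C E c1 by (intro bexI[of _ "E - C"]) auto
  qed
qed

text \<open>Otherwise repeated splitting produces disjoint sets with values of modulus at least 1,
  and their series cannot converge.\<close>

lemma total_variation_finite_real:
  fixes \<sigma> :: "'a set \<Rightarrow> real"
  assumes \<sigma>: "vector_measure M \<sigma>" and E: "E \<in> sets M"
  shows "total_variation M \<sigma> E \<noteq> \<infinity>"
proof
  assume inf: "total_variation M \<sigma> E = \<infinity>"
  let ?P = "\<lambda>F. F \<in> sets M \<and> total_variation M \<sigma> F = \<infinity>"
  have "\<exists>X. \<forall>n::nat. ?P (X n) \<and> (X (Suc n) \<subseteq> X n \<and> 1 \<le> \<bar>\<sigma> (X n - X (Suc n))\<bar>)"
    by (rule dependent_nat_choice)
      (use E inf total_variation_infinite_split[OF \<sigma>] in \<open>blast+\<close>)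
  then obtain X where X: "\<And>n. ?P (X n)" "\<And>n. X (Suc n) \<subseteq> X n" "\<And>n::nat. 1 \<le> \<bar>\<sigma> (X n - X (Suc n))\<bar>"
    by blast
  have dec: "decseq X" using X(2) by (simp add: decseq_Suc_iff)
  have disj: "disjoint_family (\<lambda>n. X n - X (Suc n))"
  proof (unfold disjoint_family_on_def, intro ballI impI)
    fix m n :: nat assume "m \<noteq> n"
    then consider "Suc m \<le> n" | "Suc n \<le> m" by linarith
    then show "(X m - X (Suc m)) \<inter> (X n - X (Suc n)) = {}"
      by cases (use decseqD[OF dec] in blast)+
  qed
  have "(\<lambda>n. \<sigma> (X n - X (Suc n))) sums \<sigma> (\<Union>n. X n - X (Suc n))"
    by (intro vector_measureD[OF \<sigma>] disj) (use X(1) in auto)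
  then have "(\<lambda>n. \<sigma> (X n - X (Suc n))) \<longlonglongrightarrow> 0"
    using sums_summable summable_LIMSEQ_zero by blast
  then have "\<forall>\<^sub>F n in sequentially. \<bar>\<sigma> (X n - X (Suc n))\<bar> < 1"
    using order_tendstoD(2)[OF tendsto_rabs_zero, of _ _ 1] by auto
  then show False using X(3) by (auto simp: eventually_sequentially not_less[symmetric])
qed

lemma total_variation_finite_complex:
  fixes \<mu> :: "'a set \<Rightarrow> complex"
  assumes \<mu>: "vector_measure M \<mu>" and E: "E \<in> sets M"
  shows "total_variation M \<mu> E \<noteq> \<infinity>"
proof -
  let ?R = "total_variation M (\<lambda>E. Re (\<mu> E)) E" and ?I = "total_variation M (\<lambda>E. Im (\<mu> E)) E"
  have "total_variation M \<mu> E \<le> ?R + ?I"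
    unfolding total_variation_def[of _ \<mu>]
  proof (rule SUP_least)
    fix A :: "nat \<Rightarrow> 'a set"
    assume "A \<in> {A. range A \<subseteq> sets M \<and> disjoint_family A \<and> (\<Union>i. A i) = E}"
    then have A: "range A \<subseteq> sets M" "disjoint_family A" "(\<Union>i. A i) = E" by auto
    have "(\<Sum>i. ennreal (norm (\<mu> (A i)))) \<le>
      (\<Sum>i. ennreal (norm (Re (\<mu> (A i)))) + ennreal (norm (Im (\<mu> (A i)))))"
      by (intro suminf_le) (auto simp flip: ennreal_plus intro!: ennreal_leI cmod_le)
    also have "\<dots> = (\<Sum>i. ennreal (norm (Re (\<mu> (A i))))) + (\<Sum>i. ennreal (norm (Im (\<mu> (A i)))))"
      by (intro suminf_add[symmetric]) auto
    also have "\<dots> \<le> ?R + ?I"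
      using A by (intro add_mono total_variation_upper)
    finally show "(\<Sum>i. ennreal (norm (\<mu> (A i)))) \<le> ?R + ?I" .
  qed
  moreover have "?R \<noteq> \<infinity>" "?I \<noteq> \<infinity>"
    using total_variation_finite_real[OF vector_measure_bounded_linear[OF \<mu> bounded_linear_Re] E]
      total_variation_finite_real[OF vector_measure_bounded_linear[OF \<mu> bounded_linear_Im] E] by blast+
  ultimately show ?thesis
    by (metis ennreal_add_eq_top infinity_ennreal_def top.extremum_uniqueI)
qed

section \<open>Positive measures from the total variation and the Jordan decomposition\<close>

definition variation_measure :: "'a measure \<Rightarrow> ('a set \<Rightarrow> 'b::real_normed_vector) \<Rightarrow> 'a measure" where
  "variation_measure M \<mu> = measure_of (space M) (sets M) (total_variation M \<mu>)"

lemma sets_variation_measure [simp]: "sets (variation_measure M \<mu>) = sets M"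
  by (simp add: variation_measure_def sets.sigma_sets_eq)

lemma space_variation_measure [simp]: "space (variation_measure M \<mu>) = space M"
  by (simp add: variation_measure_def)

lemma emeasure_variation_measure:
  assumes \<mu>: "vector_measure M \<mu>" and E: "E \<in> sets M"
  shows "emeasure (variation_measure M \<mu>) E = total_variation M \<mu> E"
proof (rule emeasure_measure_of[OF variation_measure_def])
  show "countably_additive (sets (variation_measure M \<mu>)) (total_variation M \<mu>)"
    using total_variation_suminf[OF \<mu>] by (auto simp: countably_additive_def)
qed (use E total_variation_empty[OF \<mu>] sets.sets_into_space in \<open>auto simp: positive_def\<close>)

lemma sets_jordan_pos [simp]: "sets (jordan_pos M \<sigma>) = sets M"
  by (simp add: jordan_pos_def sets.sigma_sets_eq)

lemma space_jordan_pos [simp]: "space (jordan_pos M \<sigma>) = space M"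
  by (simp add: jordan_pos_def)

lemma measurable_jordan_pos [simp]: "measurable (jordan_pos M \<sigma>) = measurable M"
  by (intro ext measurable_cong_sets) auto

lemma total_variation_sums:
  assumes \<sigma>: "vector_measure M \<mu>" and fin: "\<And>E. E \<in> sets M \<Longrightarrow> total_variation M \<mu> E \<noteq> \<infinity>"
    and A: "range A \<subseteq> sets M" "disjoint_family A"
  shows "(\<lambda>i::nat. enn2real (total_variation M \<mu> (A i))) sums enn2real (total_variation M \<mu> (\<Union>i. A i))"
proof -
  let ?N = "variation_measure M \<mu>"
  have eq: "measure ?N E = enn2real (total_variation M \<mu> E)" if "E \<in> sets M" for E
    using that by (simp add: measure_def emeasure_variation_measure[OF \<sigma>])
  have UA: "(\<Union>i. A i) \<in> sets M" using A by auto
  have "(\<lambda>i. measure ?N (A i)) sums measure ?N (\<Union>i. A i)"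
    by (rule measure_UNION)
      (use A UA fin[OF UA] in \<open>simp_all add: emeasure_variation_measure[OF \<sigma>]\<close>)
  then show ?thesis using A UA by (simp add: eq image_subset_iff)
qed

lemma abs_le_total_variation:
  fixes \<sigma> :: "'a set \<Rightarrow> real"
  assumes \<sigma>: "vector_measure M \<sigma>" and E: "E \<in> sets M"
  shows "\<bar>\<sigma> E\<bar> \<le> enn2real (total_variation M \<sigma> E)"
proof -
  have "enn2real (ennreal (norm (\<sigma> E))) \<le> enn2real (total_variation M \<sigma> E)"
    using norm_le_total_variation[OF assms] total_variation_finite_real[OF assms]
    by (intro enn2real_mono) (auto simp: less_top)
  then show ?thesis by simp
qed

text \<open>The set function is nonnegative because the total variation dominates
  \<open>\<bar>\<sigma> E\<bar>\<close>, and countably additive because the variation is finite, so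
  that \<open>enn2real\<close> loses nothing.\<close>

lemma emeasure_jordan_pos:
  assumes \<sigma>: "vector_measure M \<sigma>" and E: "E \<in> sets M"
  shows "emeasure (jordan_pos M \<sigma>) E = ennreal ((enn2real (total_variation M \<sigma> E) + \<sigma> E) / 2)"
proof (rule emeasure_measure_of[OF jordan_pos_def])
  let ?f = "\<lambda>E. (enn2real (total_variation M \<sigma> E) + \<sigma> E) / 2"
  have nn: "0 \<le> ?f E" if "E \<in> sets M" for E
    using abs_le_total_variation[OF \<sigma> that] by simp
  show "countably_additive (sets (jordan_pos M \<sigma>)) (\<lambda>E. ennreal (?f E))"
  proof (unfold countably_additive_def, intro allI impI)
    fix A :: "nat \<Rightarrow> 'a set"
    assume A: "range A \<subseteq> sets (jordan_pos M \<sigma>)" "disjoint_family A"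
      "(\<Union>i. A i) \<in> sets (jordan_pos M \<sigma>)"
    have "(\<lambda>i. ?f (A i)) sums ?f (\<Union>i. A i)"
      using A by (intro sums_divide sums_add vector_measureD[OF \<sigma>]
          total_variation_sums[OF \<sigma> total_variation_finite_real[OF \<sigma>]]) auto
    then show "(\<Sum>i. ennreal (?f (A i))) = ennreal (?f (\<Union>i. A i))"
      using A nn by (intro suminf_ennreal_eq) auto
  qed
qed (use E total_variation_empty[OF \<sigma>] vector_measure_empty[OF \<sigma>] sets.sets_into_space in \<open>auto simp: positive_def\<close>)

lemma measure_jordan_pos:
  assumes \<sigma>: "vector_measure M \<sigma>" and E: "E \<in> sets M"
  shows "measure (jordan_pos M \<sigma>) E = (enn2real (total_variation M \<sigma> E) + \<sigma> E) / 2"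
  using abs_le_total_variation[OF \<sigma> E] by (simp add: measure_def emeasure_jordan_pos[OF assms])

lemma finite_measure_jordan_pos: "vector_measure M \<sigma> \<Longrightarrow> finite_measure (jordan_pos M \<sigma>)"
  by (rule finite_measureI) (simp add: emeasure_jordan_pos)

lemma vector_measure_uminus: "vector_measure M \<mu> \<Longrightarrow> vector_measure M (\<lambda>E. - \<mu> E)"
  using vector_measure_bounded_linear bounded_linear_minus[OF bounded_linear_ident] by blast

lemma jordan_decomposition:
  assumes \<sigma>: "vector_measure M \<sigma>" and E: "E \<in> sets M"
  shows "measure (jordan_pos M \<sigma>) E - measure (jordan_pos M (\<lambda>E. - \<sigma> E)) E = \<sigma> E"
  by (simp add: measure_jordan_pos[OF \<sigma> E] measure_jordan_pos[OF vector_measure_uminus[OF \<sigma>] E]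
      total_variation_uminus field_simps)

section \<open>Integration against complex measures\<close>

text \<open>Such functions are integrable against every finite measure, so that one condition covers
  all four Jordan parts of a complex measure.\<close>

definition bounded_measurable :: "'a measure \<Rightarrow> ('a \<Rightarrow> complex) \<Rightarrow> bool" where
  "bounded_measurable M f \<longleftrightarrow> f \<in> borel_measurable M \<and> (\<exists>B. \<forall>x\<in>space M. norm (f x) \<le> B)"

lemma bounded_measurableI:
  "f \<in> borel_measurable M \<Longrightarrow> (\<And>x. x \<in> space M \<Longrightarrow> norm (f x) \<le> B) \<Longrightarrow> bounded_measurable M f"
  by (auto simp: bounded_measurable_def)

lemma bounded_measurable_measurable: "bounded_measurable M f \<Longrightarrow> f \<in> borel_measurable M"
  by (simp add: bounded_measurable_def)

lemma bounded_measurable_indicator: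
  "E \<in> sets M \<Longrightarrow> bounded_measurable M (indicator E)"
  by (rule bounded_measurableI[where B=1]) (auto simp: indicator_def)

lemma bounded_measurable_const [simp]: "bounded_measurable M (\<lambda>x. c)"
  by (rule bounded_measurableI[where B="norm c"]) auto

lemma bounded_measurable_add:
  assumes "bounded_measurable M f" "bounded_measurable M g"
  shows "bounded_measurable M (\<lambda>x. f x + g x)"
proof -
  obtain B C where "\<forall>x\<in>space M. norm (f x) \<le> B" "\<forall>x\<in>space M. norm (g x) \<le> C"
    using assms by (auto simp: bounded_measurable_def)
  then show ?thesis using assms
    by (intro bounded_measurableI[where B="B + C"])
      (auto simp: bounded_measurable_def intro!: norm_triangle_mono)
qed

lemma bounded_measurable_mult:
  assumes "bounded_measurable M f" "bounded_measurable M g"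
  shows "bounded_measurable M (\<lambda>x. f x * g x)"
proof -
  obtain B C where "\<forall>x\<in>space M. norm (f x) \<le> B" "\<forall>x\<in>space M. norm (g x) \<le> C"
    using assms by (auto simp: bounded_measurable_def)
  then show ?thesis using assms
    by (intro bounded_measurableI[where B="B * C"])
      (auto simp: bounded_measurable_def norm_mult intro!: mult_mono intro: order_trans[OF norm_ge_zero])
qed

lemma bounded_measurable_cnj:
  "bounded_measurable M f \<Longrightarrow> bounded_measurable M (\<lambda>x. cnj (f x))"
  by (auto simp: bounded_measurable_def borel_measurable_complex_iff)

lemma bounded_measurable_power:
  "bounded_measurable M f \<Longrightarrow> bounded_measurable M (\<lambda>x. f x ^ n)"
  by (induction n) (auto intro: bounded_measurable_mult)

lemma bounded_measurable_sum:
  "(\<And>i. i \<in> I \<Longrightarrow> bounded_measurable M (f i)) \<Longrightarrow> bounded_measurable M (\<lambda>x. \<Sum>i\<in>I. f i x)"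
  by (induction I rule: infinite_finite_induct) (auto intro: bounded_measurable_add)

lemma bounded_measurable_lim:
  assumes "\<And>i::nat. bounded_measurable M (F i)" "\<And>i x. x \<in> space M \<Longrightarrow> norm (F i x) \<le> B"
    and "\<And>x. x \<in> space M \<Longrightarrow> (\<lambda>i. F i x) \<longlonglongrightarrow> g x"
  shows "bounded_measurable M g"
proof (rule bounded_measurableI)
  show "g \<in> borel_measurable M"
    by (rule borel_measurable_LIMSEQ_metric[where f=F])
      (use assms bounded_measurable_measurable in blast)+
  show "norm (g x) \<le> B" if "x \<in> space M" for x
    by (rule LIMSEQ_le_const2[OF tendsto_norm[OF assms(3)[OF that]]]) (use assms(2) that in auto)
qed

lemma integrable_bounded_measurable:
  assumes "finite_measure N" "sets N = sets M" "bounded_measurable M f"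
  shows "integrable N f"
proof -
  interpret finite_measure N by fact
  obtain B where "\<forall>x\<in>space M. norm (f x) \<le> B" using assms(3) by (auto simp: bounded_measurable_def)
  then show ?thesis
    using assms sets_eq_imp_space_eq[OF assms(2)] measurable_cong_sets[OF assms(2) refl]
    by (intro integrable_const_bound[where B=B]) (auto simp: bounded_measurable_def)
qed

text \<open>The limit clause supplies a uniform bound, so it can be discharged by dominated
  convergence with a constant. Identities between integrals are checked on indicators below and
  extended by this rule.\<close>

lemma bounded_measurable_induct [consumes 1, case_names indicator add scale lim]:
  assumes f: "bounded_measurable M f"
    and ind: "\<And>E. E \<in> sets M \<Longrightarrow> P (indicator E)"
    and add: "\<And>f g. bounded_measurable M f \<Longrightarrow> bounded_measurable M g \<Longrightarrow> P f \<Longrightarrow> P g \<Longrightarrow> P (\<lambda>x. f x + g x)"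
    and scale: "\<And>c f. bounded_measurable M f \<Longrightarrow> P f \<Longrightarrow> P (\<lambda>x. c * f x)"
    and lim: "\<And>F g B. (\<And>i. bounded_measurable M (F i)) \<Longrightarrow> (\<And>i::nat. P (F i)) \<Longrightarrow>
        (\<And>i x. x \<in> space M \<Longrightarrow> norm (F i x) \<le> B) \<Longrightarrow>
        (\<And>x. x \<in> space M \<Longrightarrow> (\<lambda>i. F i x) \<longlonglongrightarrow> g x) \<Longrightarrow> P g"
  shows "P f"
proof -
  have zero: "P (\<lambda>x. 0)"
    using scale[OF bounded_measurable_indicator ind, of "{}" 0] by simp
  have simple: "P s" if s: "simple_function M s" for s
  proof -
    have fin: "finite (s ` space M)" using s by (rule simple_functionD)
    have E: "s -` {y} \<inter> space M \<in> sets M" for y using s by (rule simple_functionD)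
    define h where "h x = (\<Sum>y\<in>s ` space M. y * indicator (s -` {y} \<inter> space M) x)" for x
    have "bounded_measurable M (\<lambda>x. \<Sum>y\<in>Y. y * indicator (s -` {y} \<inter> space M) x) \<and>
        P (\<lambda>x. \<Sum>y\<in>Y. y * indicator (s -` {y} \<inter> space M) x)" if "finite Y" for Y
      using that
    proof (induction Y)
      case empty then show ?case using zero by simp
    next
      case (insert y Y)
      have b: "bounded_measurable M (\<lambda>x. y * indicator (s -` {y} \<inter> space M) x)"
        by (intro bounded_measurable_mult bounded_measurable_const bounded_measurable_indicator E)
      have "P (\<lambda>x. y * indicator (s -` {y} \<inter> space M) x)"
        by (intro scale bounded_measurable_indicator E ind)
      then show ?case
        unfolding sum.insert[OF insert.hyps] using insert.IH b
        by (intro conjI add bounded_measurable_add) auto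
    qed
    from this[OF fin] have h: "bounded_measurable M h" "P h" unfolding h_def by auto
    have hs: "h x = s x" if "x \<in> space M" for x
    proof -
      have "h x = (\<Sum>y\<in>s ` space M. if y = s x then y else 0)"
        unfolding h_def by (intro sum.cong) (auto simp: indicator_def that)
      then show ?thesis using fin that by simp
    qed
    obtain B where B: "\<And>x. x \<in> space M \<Longrightarrow> norm (h x) \<le> B"
      using h(1) by (auto simp: bounded_measurable_def)
    \<comment> \<open>\<open>h\<close> and \<open>s\<close> agree only on \<open>space M\<close>;
      with a constant sequence the limit clause acts as a congruence rule.\<close>
    show ?thesis by (rule lim[of "\<lambda>_. h" B s]) (use h B hs in auto)
  qed
  obtain B where B: "\<And>x. x \<in> space M \<Longrightarrow> norm (f x) \<le> B"
    using f by (auto simp: bounded_measurable_def)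
  obtain s where s: "\<And>i::nat. simple_function M (s i)" "\<And>x. x \<in> space M \<Longrightarrow> (\<lambda>i. s i x) \<longlonglongrightarrow> f x"
    "\<And>i x. x \<in> space M \<Longrightarrow> norm (s i x) \<le> 2 * norm (f x)"
    using borel_measurable_implies_sequence_metric[OF bounded_measurable_measurable[OF f], of 0]
    by simp metis
  have sB: "norm (s i x) \<le> 2 * B" if "x \<in> space M" for i x
    using s(3)[OF that, of i] B[OF that] by linarith
  show ?thesis
    by (rule lim[of s "2 * B" f])
      (use s(2) sB simple[OF s(1)] borel_measurable_simple_function[OF s(1)] in
        \<open>auto intro!: bounded_measurableI[where B="2 * B"]\<close>)
qed

lemma integral_bounded_lim:
  assumes N: "finite_measure N" "sets N = sets M"
    and "\<And>i::nat. bounded_measurable M (F i)" "\<And>i x. x \<in> space M \<Longrightarrow> norm (F i x) \<le> B"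
    and "\<And>x. x \<in> space M \<Longrightarrow> (\<lambda>i. F i x) \<longlonglongrightarrow> g x"
  shows "(\<lambda>i. integral\<^sup>L N (F i)) \<longlonglongrightarrow> integral\<^sup>L N g"
proof -
  interpret finite_measure N by fact
  have "borel_measurable N = (borel_measurable M :: ('a \<Rightarrow> complex) set)"
    by (rule measurable_cong_sets[OF N(2) refl])
  then show ?thesis
    using assms(3-) bounded_measurable_lim[OF assms(3-)] sets_eq_imp_space_eq[OF N(2)]
    by (intro integral_dominated_convergence[where w="\<lambda>_. B"])
      (auto simp: bounded_measurable_def)
qed

lemma integral_complex_indicator:
  assumes "E \<in> sets N" shows "(\<integral>x. indicator E x \<partial>N) = complex_of_real (measure N E)"
proof -
  have "(\<integral>x. indicator E x \<partial>N) = (\<integral>x. complex_of_real (indicator E x) \<partial>N)"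
    by (intro Bochner_Integration.integral_cong) (auto simp: indicator_def)
  also have "\<dots> = complex_of_real (\<integral>x. indicator E x \<partial>N)" by (rule integral_complex_of_real)
  finally show ?thesis using assms sets.sets_into_space[OF assms] by (simp add: Int_absorb2)
qed

section \<open>Linearity and bounded convergence for signed and complex measures\<close>

context
  fixes M :: "'a measure" and \<sigma> :: "'a set \<Rightarrow> real"
  assumes \<sigma>: "vector_measure M \<sigma>"
begin

private lemma int [simp]:
  assumes "bounded_measurable M f"
  shows "integrable (jordan_pos M \<sigma>) f" "integrable (jordan_pos M (\<lambda>E. - \<sigma> E)) f"
  using assms
  by (auto intro!: integrable_bounded_measurable[where M=M] finite_measure_jordan_pos \<sigma> vector_measure_uminus)

lemma signed_integral_indicator:
  assumes "E \<in> sets M" shows "signed_integral M \<sigma> (indicator E) = \<sigma> E"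
  using assms jordan_decomposition[OF \<sigma> assms]
  by (simp add: signed_integral_def integral_complex_indicator flip: of_real_diff)

lemma signed_integral_add:
  assumes "bounded_measurable M f" "bounded_measurable M g"
  shows "signed_integral M \<sigma> (\<lambda>x. f x + g x) = signed_integral M \<sigma> f + signed_integral M \<sigma> g"
  using assms by (simp add: signed_integral_def)

lemma signed_integral_scale: "signed_integral M \<sigma> (\<lambda>x. c * f x) = c * signed_integral M \<sigma> f"
  by (simp add: signed_integral_def algebra_simps)

lemma signed_integral_lim:
  assumes "\<And>i::nat. bounded_measurable M (F i)" "\<And>i x. x \<in> space M \<Longrightarrow> norm (F i x) \<le> B"
    and "\<And>x. x \<in> space M \<Longrightarrow> (\<lambda>i. F i x) \<longlonglongrightarrow> g x"
  shows "(\<lambda>i. signed_integral M \<sigma> (F i)) \<longlonglongrightarrow> signed_integral M \<sigma> g"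
  unfolding signed_integral_def
  by (intro tendsto_diff integral_bounded_lim[where M=M and B=B] assms finite_measure_jordan_pos
      vector_measure_uminus \<sigma>) auto

end

lemma signed_integral_cong:
  assumes "\<And>x. x \<in> space M \<Longrightarrow> f x = g x"
  shows "signed_integral M \<sigma> f = signed_integral M \<sigma> g"
  unfolding signed_integral_def using assms by (intro arg_cong2[where f="(-)"] Bochner_Integration.integral_cong) auto

lemma cmeasure_integral_cong:
  assumes "\<And>x. x \<in> space M \<Longrightarrow> f x = g x"
  shows "cmeasure_integral M \<mu> f = cmeasure_integral M \<mu> g"
  unfolding cmeasure_integral_def by (simp add: signed_integral_cong[OF assms])

context
  fixes M :: "'a measure" and \<mu> :: "'a set \<Rightarrow> complex"
  assumes \<mu>: "vector_measure M \<mu>"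
begin

private lemma re: "vector_measure M (\<lambda>E. Re (\<mu> E))" and im: "vector_measure M (\<lambda>E. Im (\<mu> E))"
  using vector_measure_bounded_linear[OF \<mu>] bounded_linear_Re bounded_linear_Im by auto

lemma cmeasure_integral_indicator:
  assumes "E \<in> sets M" shows "cmeasure_integral M \<mu> (indicator E) = \<mu> E"
  using signed_integral_indicator[OF re assms] signed_integral_indicator[OF im assms]
  by (simp add: cmeasure_integral_def complex_eq flip: complex_eq)

lemma cmeasure_integral_add:
  assumes "bounded_measurable M f" "bounded_measurable M g"
  shows "cmeasure_integral M \<mu> (\<lambda>x. f x + g x) = cmeasure_integral M \<mu> f + cmeasure_integral M \<mu> g"
  using signed_integral_add[OF re assms] signed_integral_add[OF im assms]
  by (simp add: cmeasure_integral_def algebra_simps)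

lemma cmeasure_integral_scale: "cmeasure_integral M \<mu> (\<lambda>x. c * f x) = c * cmeasure_integral M \<mu> f"
  using signed_integral_scale[OF re] signed_integral_scale[OF im]
  by (simp add: cmeasure_integral_def algebra_simps)

lemma cmeasure_integral_lim:
  assumes "\<And>i::nat. bounded_measurable M (F i)" "\<And>i x. x \<in> space M \<Longrightarrow> norm (F i x) \<le> B"
    and "\<And>x. x \<in> space M \<Longrightarrow> (\<lambda>i. F i x) \<longlonglongrightarrow> g x"
  shows "(\<lambda>i. cmeasure_integral M \<mu> (F i)) \<longlonglongrightarrow> cmeasure_integral M \<mu> g"
  unfolding cmeasure_integral_def
  by (intro tendsto_add tendsto_mult tendsto_const signed_integral_lim[where B=B] re im assms)

lemma cmeasure_integral_sum:
  assumes "\<And>i. i \<in> I \<Longrightarrow> bounded_measurable M (f i)"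
  shows "cmeasure_integral M \<mu> (\<lambda>x. \<Sum>i\<in>I. f i x) = (\<Sum>i\<in>I. cmeasure_integral M \<mu> (f i))"
  using assms
proof (induction I rule: infinite_finite_induct)
  case (insert i I)
  then show ?case by (simp add: cmeasure_integral_add bounded_measurable_sum)
qed (use cmeasure_integral_scale[of 0] in simp_all)

text \<open>The constant is the sum of the masses of the four Jordan parts. It gives the uniform
  bounds under which a limit passes through an inner integral that depends on a parameter.\<close>

lemma cmeasure_integral_bounded:
  "\<exists>C\<ge>0. \<forall>f B. bounded_measurable M f \<longrightarrow> (\<forall>x\<in>space M. norm (f x) \<le> B) \<longrightarrow> norm (cmeasure_integral M \<mu> f) \<le> C * B"
proof -
  have *: "\<exists>C\<ge>0. \<forall>f B. bounded_measurable M f \<longrightarrow> (\<forall>x\<in>space M. norm (f x) \<le> B) \<longrightarrow> norm (signed_integral M \<sigma> f) \<le> C * B"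
    if \<sigma>: "vector_measure M \<sigma>" for \<sigma>
  proof (intro exI[of _ "measure (jordan_pos M \<sigma>) (space M) + measure (jordan_pos M (\<lambda>E. - \<sigma> E)) (space M)"] conjI allI impI)
    fix f B assume f: "bounded_measurable M f" "\<forall>x\<in>space M. norm (f x) \<le> B"
    have "norm (integral\<^sup>L (jordan_pos M s) f) \<le> measure (jordan_pos M s) (space M) * B" if s: "vector_measure M s" for s
    proof -
      interpret finite_measure "jordan_pos M s" by (rule finite_measure_jordan_pos[OF s])
      have "norm (integral\<^sup>L (jordan_pos M s) f) \<le> (\<integral>x. norm (f x) \<partial>jordan_pos M s)"
        by (rule integral_norm_bound)
      also have "\<dots> \<le> (\<integral>x. B \<partial>jordan_pos M s)"
        using f integrable_bounded_measurable[OF finite_measure_jordan_pos[OF s] sets_jordan_pos f(1)]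
        by (intro integral_mono) auto
      finally show ?thesis by simp
    qed
    from this[OF \<sigma>] this[OF vector_measure_uminus[OF \<sigma>]]
    show "norm (signed_integral M \<sigma> f) \<le>
      (measure (jordan_pos M \<sigma>) (space M) + measure (jordan_pos M (\<lambda>E. - \<sigma> E)) (space M)) * B"
      unfolding signed_integral_def distrib_right by (rule norm_triangle_le_diff[OF add_mono])
  qed simp
  obtain C D where C: "C \<ge> 0" "\<And>f B. bounded_measurable M f \<Longrightarrow> (\<forall>x\<in>space M. norm (f x) \<le> B) \<Longrightarrow> norm (signed_integral M (\<lambda>E. Re (\<mu> E)) f) \<le> C * B"
   and D: "D \<ge> 0" "\<And>f B. bounded_measurable M f \<Longrightarrow> (\<forall>x\<in>space M. norm (f x) \<le> B) \<Longrightarrow> norm (signed_integral M (\<lambda>E. Im (\<mu> E)) f) \<le> D * B"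
    using *[OF re] *[OF im] by metis
  show ?thesis
  proof (intro exI[of _ "C + D"] conjI allI impI)
    fix f B assume f: "bounded_measurable M f" "\<forall>x\<in>space M. norm (f x) \<le> B"
    show "norm (cmeasure_integral M \<mu> f) \<le> (C + D) * B"
      unfolding cmeasure_integral_def distrib_right
      by (rule norm_triangle_mono) (use C(2)[OF f] D(2)[OF f] in \<open>auto simp: norm_mult\<close>)
  qed (use C D in auto)
qed

end

text \<open>Linearity in the measure is not visible from the definition, since Jordan decompositions
  do not add up. It holds on indicators by assumption and spreads from there.\<close>

lemma cmeasure_integral_linear:
  assumes \<mu>: "vector_measure M \<mu>" and \<nu>: "vector_measure M \<nu>" and \<rho>: "vector_measure M \<rho>"
    and eq: "\<And>E. E \<in> sets M \<Longrightarrow> \<rho> E = a * \<mu> E + b * \<nu> E" and f: "bounded_measurable M f"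
  shows "cmeasure_integral M \<rho> f = a * cmeasure_integral M \<mu> f + b * cmeasure_integral M \<nu> f"
  using f
proof (induction rule: bounded_measurable_induct)
  case (indicator E)
  then show ?case by (simp add: cmeasure_integral_indicator \<mu> \<nu> \<rho> eq)
next
  case (add f g)
  then show ?case by (simp add: cmeasure_integral_add \<mu> \<nu> \<rho> algebra_simps)
next
  case (scale c f)
  then show ?case by (simp add: cmeasure_integral_scale \<mu> \<nu> \<rho> algebra_simps)
next
  case (lim F g B)
  have "(\<lambda>i. cmeasure_integral M \<rho> (F i)) \<longlonglongrightarrow> a * cmeasure_integral M \<mu> g + b * cmeasure_integral M \<nu> g"
    unfolding lim.IH by (intro tendsto_intros cmeasure_integral_lim[where B=B] \<mu> \<nu> lim.hyps)
  then show ?case using cmeasure_integral_lim[OF \<rho> lim.hyps] LIMSEQ_unique by blast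
qed

section \<open>Measures with a bounded density\<close>

lemma vector_measure_density:
  assumes N: "finite_measure N" "sets N = sets M" and h: "bounded_measurable M h"
  shows "vector_measure M (\<lambda>E. \<integral>x. indicator E x * h x \<partial>N)"
  unfolding vector_measure_def
proof (intro allI impI)
  fix A :: "nat \<Rightarrow> 'a set" assume A: "range A \<subseteq> sets M" "disjoint_family A"
  obtain B where B: "\<And>x. x \<in> space M \<Longrightarrow> norm (h x) \<le> B"
    using h by (auto simp: bounded_measurable_def)
  have sum_ind: "(\<Sum>i<n. indicator (A i) x) = (indicator (\<Union>i<n. A i) x :: complex)" for x n
    using A(2) by (intro indicator_UN_disjoint[symmetric]) (auto simp: disjoint_family_on_def)
  have bm: "bounded_measurable M (\<lambda>x. indicator E x * h x)" if "E \<in> sets M" for E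
    by (intro bounded_measurable_mult bounded_measurable_indicator that h)
  have "(\<lambda>n. \<integral>x. indicator (\<Union>i<n. A i) x * h x \<partial>N) \<longlonglongrightarrow> (\<integral>x. indicator (\<Union>i. A i) x * h x \<partial>N)"
  proof (rule integral_bounded_lim[OF N, where B=B])
    show "norm (indicator (\<Union>i<n. A i) x * h x) \<le> B" if "x \<in> space M" for n x
      using B[OF that] by (auto simp: indicator_def intro: order_trans[OF norm_ge_zero])
    show "(\<lambda>n. indicator (\<Union>i<n. A i) x * h x) \<longlonglongrightarrow> indicator (\<Union>i. A i) x * h x" for x
      by (intro tendsto_intros LIMSEQ_indicator_UN)
  qed (use A bm in auto)
  moreover have "(\<integral>x. indicator (\<Union>i<n. A i) x * h x \<partial>N) = (\<Sum>i<n. \<integral>x. indicator (A i) x * h x \<partial>N)" for n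
    unfolding sum_ind[symmetric] sum_distrib_right
    using A by (intro Bochner_Integration.integral_sum integrable_bounded_measurable[OF N] bm) auto
  ultimately show "(\<lambda>i. \<integral>x. indicator (A i) x * h x \<partial>N) sums (\<integral>x. indicator (\<Union>i. A i) x * h x \<partial>N)"
    by (simp add: sums_def)
qed

lemma cmeasure_integral_density:
  assumes N: "finite_measure N" "sets N = sets M" and h: "bounded_measurable M h" and \<mu>: "vector_measure M \<mu>"
    and eq: "\<And>E. E \<in> sets M \<Longrightarrow> \<mu> E = (\<integral>x. indicator E x * h x \<partial>N)"
    and f: "bounded_measurable M f"
  shows "cmeasure_integral M \<mu> f = (\<integral>x. f x * h x \<partial>N)"
  using f
proof (induction rule: bounded_measurable_induct)
  case (indicator E)
  then show ?case by (simp add: cmeasure_integral_indicator[OF \<mu>] eq)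
next
  case (add f g)
  then have "integrable N (\<lambda>x. f x * h x)" "integrable N (\<lambda>x. g x * h x)"
    using h by (auto intro!: integrable_bounded_measurable[OF N] bounded_measurable_mult)
  then show ?case using add by (simp add: cmeasure_integral_add[OF \<mu>] algebra_simps)
next
  case (scale c f)
  then show ?case by (simp add: cmeasure_integral_scale[OF \<mu>] mult.assoc)
next
  case (lim F g B)
  obtain C where C: "\<And>x. x \<in> space M \<Longrightarrow> norm (h x) \<le> C"
    using h by (auto simp: bounded_measurable_def)
  have "(\<lambda>i. cmeasure_integral M \<mu> (F i)) \<longlonglongrightarrow> (\<integral>x. g x * h x \<partial>N)"
    unfolding lim.IH
  proof (rule integral_bounded_lim[OF N, where B="B * C"])
    show "norm (F i x * h x) \<le> B * C" if "x \<in> space M" for i x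
      using mult_mono[OF lim.hyps(2)[OF that] C[OF that]] order_trans[OF norm_ge_zero lim.hyps(2)[OF that]]
      by (simp add: norm_mult)
  qed (use lim.hyps h in \<open>auto intro!: bounded_measurable_mult tendsto_intros\<close>)
  then show ?case using cmeasure_integral_lim[OF \<mu> lim.hyps] LIMSEQ_unique by blast
qed

section \<open>Measures and convolution on the circle\<close>

lemma space_circle_borel [simp]: "space circle_borel = circle"
  by (simp add: circle_borel_def space_restrict_space)

lemma circle_borel_set [measurable, simp]: "circle \<in> sets borel"
  by (simp add: circle_def)

lemma sets_circle_borel: "E \<in> sets circle_borel \<longleftrightarrow> E \<in> sets borel \<and> E \<subseteq> circle"
  by (auto simp: circle_borel_def sets_restrict_space_iff)

lemma circle_mult: "x \<in> circle \<Longrightarrow> y \<in> circle \<Longrightarrow> x * y \<in> circle"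
  by (simp add: circle_def norm_mult)

text \<open>Pushed forward to the plane, the variation becomes a finite Borel measure on a complete
  separable metric space, hence regular. Open sets of the plane are then intersected with the
  circle.\<close>

lemma regular_on_circle:
  assumes \<mu>: "vector_measure circle_borel \<mu>" shows "regular_on_circle \<mu>"
proof -
  let ?tv = "total_variation circle_borel \<mu>"
  define N where "N = distr (variation_measure circle_borel \<mu>) borel (\<lambda>x. x)"
  have id: "(\<lambda>x. x) \<in> variation_measure circle_borel \<mu> \<rightarrow>\<^sub>M borel"
    by (rule measurableI) (auto simp: sets_circle_borel)
  have N: "emeasure N X = ?tv (X \<inter> circle)" if "X \<in> sets borel" for X
    unfolding N_def using that
    by (subst emeasure_distr[OF id])
       (auto simp: emeasure_variation_measure[OF \<mu>] sets_circle_borel)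
  have sN: "sets N = sets borel" by (simp add: N_def)
  have fN: "emeasure N (space N) \<noteq> \<infinity>"
    using N[of UNIV] total_variation_finite_complex[OF \<mu>, of circle]
    by (simp add: N_def sets_circle_borel)
  have "?tv E = (INF V \<in> {V. openin (top_of_set circle) V \<and> E \<subseteq> V}. ?tv V)"
    "?tv E = (SUP K \<in> {K. compact K \<and> K \<subseteq> E}. ?tv K)" if E: "E \<in> sets circle_borel" for E
  proof -
    have E': "E \<in> sets borel" "E \<subseteq> circle" using E by (auto simp: sets_circle_borel)
    have tvE: "?tv E = emeasure N E" using N[OF E'(1)] E'(2) by (simp add: Int_absorb2)
    show "?tv E = (INF V \<in> {V. openin (top_of_set circle) V \<and> E \<subseteq> V}. ?tv V)"
    proof (rule antisym)
      show "?tv E \<le> (INF V \<in> {V. openin (top_of_set circle) V \<and> E \<subseteq> V}. ?tv V)"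
        using E by (auto intro!: INF_greatest total_variation_mono simp: openin_open sets_circle_borel)
      have "(INF V \<in> {V. openin (top_of_set circle) V \<and> E \<subseteq> V}. ?tv V) \<le> emeasure N U"
        if "open U" "E \<subseteq> U" for U
        using that E' by (subst N) (auto intro!: INF_lower simp: openin_open)
      then show "(INF V \<in> {V. openin (top_of_set circle) V \<and> E \<subseteq> V}. ?tv V) \<le> ?tv E"
        unfolding tvE outer_regular[OF sN fN E'(1)] by (auto intro!: INF_greatest)
    qed
    show "?tv E = (SUP K \<in> {K. compact K \<and> K \<subseteq> E}. ?tv K)"
      unfolding tvE inner_regular[OF sN fN E'(1)]
    proof (intro SUP_cong)
      show "{K. K \<subseteq> E \<and> compact K} = {K. compact K \<and> K \<subseteq> E}" by auto
      show "emeasure N K = ?tv K" if "K \<in> {K. compact K \<and> K \<subseteq> E}" for K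
        using that E' N[of K] by (auto simp: Int_absorb2 compact_imp_closed)
    qed
  qed
  then show ?thesis unfolding regular_on_circle_def by blast
qed

lemma circle_measures_iff:
  "\<mu> \<in> circle_measures \<longleftrightarrow> vector_measure circle_borel \<mu> \<and> (\<forall>E. E \<notin> sets circle_borel \<longrightarrow> \<mu> E = 0)"
  using regular_on_circle by (auto simp: circle_measures_def complex_measure_iff)

lemma circle_measures_vector: "\<mu> \<in> circle_measures \<Longrightarrow> vector_measure circle_borel \<mu>"
  by (simp add: circle_measures_iff)

lemma circle_measures_eqI:
  assumes "\<mu> \<in> circle_measures" "\<nu> \<in> circle_measures" "\<And>E. E \<in> sets circle_borel \<Longrightarrow> \<mu> E = \<nu> E"
  shows "\<mu> = \<nu>"
proof
  show "\<mu> E = \<nu> E" for E using assms by (cases "E \<in> sets circle_borel") (auto simp: circle_measures_iff)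
qed

lemma circle_measures_add:
  "\<mu> \<in> circle_measures \<Longrightarrow> \<nu> \<in> circle_measures \<Longrightarrow> (\<lambda>E. \<mu> E + \<nu> E) \<in> circle_measures"
  by (auto simp: circle_measures_iff intro: vector_measure_add)

lemma circle_measures_scale: "\<mu> \<in> circle_measures \<Longrightarrow> (\<lambda>E. c * \<mu> E) \<in> circle_measures"
  by (auto simp: circle_measures_iff intro: vector_measure_bounded_linear bounded_linear_mult_right)

lemma measurable_powi [measurable]: "(\<lambda>z. z powi n) \<in> borel_measurable circle_borel"
  unfolding circle_borel_def
  by (intro borel_measurable_continuous_on_restrict continuous_intros) (auto simp: circle_def)

lemma norm_powi_circle: "z \<in> circle \<Longrightarrow> norm (z powi n) = 1"
  by (simp add: circle_def norm_power_int)

lemma bounded_measurable_powi: "bounded_measurable circle_borel (\<lambda>z. z powi n)"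
  by (rule bounded_measurableI[where B=1]) (auto simp: norm_powi_circle)

lemma circle_nonzero: "z \<in> circle \<Longrightarrow> z \<noteq> 0"
  by (auto simp: circle_def)

section \<open>Translation and convolution on the circle\<close>

lemma measurable_circle_mult [measurable]:
  "(\<lambda>(x, y). x * y) \<in> circle_borel \<Otimes>\<^sub>M circle_borel \<rightarrow>\<^sub>M circle_borel"
proof -
  have "(\<lambda>x. x) \<in> circle_borel \<rightarrow>\<^sub>M borel" by (simp add: circle_borel_def measurable_restrict_space1)
  then have "(\<lambda>(x, y). x * y) \<in> circle_borel \<Otimes>\<^sub>M circle_borel \<rightarrow>\<^sub>M borel" by measurable
  then show ?thesis
    unfolding circle_borel_def
    by (intro measurable_restrict_space2) (auto simp: circle_borel_def[symmetric] space_pair_measure circle_mult)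
qed

lemma measurable_circle_translate:
  "y \<in> circle \<Longrightarrow> (\<lambda>x. x * y) \<in> circle_borel \<rightarrow>\<^sub>M circle_borel"
  using measurable_compose[OF measurable_Pair2'[of y circle_borel circle_borel] measurable_circle_mult]
  by (simp add: mult.commute)

lemma bounded_measurable_translate:
  assumes f: "bounded_measurable circle_borel f" and y: "y \<in> circle"
  shows "bounded_measurable circle_borel (\<lambda>x. f (x * y))"
proof -
  obtain B where "\<And>x. x \<in> circle \<Longrightarrow> norm (f x) \<le> B" using f by (auto simp: bounded_measurable_def)
  then show ?thesis
    using measurable_compose[OF measurable_circle_translate[OF y] bounded_measurable_measurable[OF f]]
    by (intro bounded_measurableI[where B=B]) (auto intro: circle_mult y)
qed

text \<open>Measurability in \<open>y\<close> is the measurability part of Fubini's theorem for each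
  Jordan part; the bound is uniform because translation preserves the circle.\<close>

lemma bounded_measurable_fiber_integral:
  assumes \<mu>: "vector_measure circle_borel \<mu>" and f: "bounded_measurable circle_borel f"
  shows "bounded_measurable circle_borel (\<lambda>y. cmeasure_integral circle_borel \<mu> (\<lambda>x. f (x * y)))"
proof -
  have m: "(\<lambda>y. \<integral>x. f (x * y) \<partial>jordan_pos circle_borel \<sigma>) \<in> borel_measurable circle_borel"
    if \<sigma>: "vector_measure circle_borel \<sigma>" for \<sigma>
  proof -
    interpret finite_measure "jordan_pos circle_borel \<sigma>" by (rule finite_measure_jordan_pos[OF \<sigma>])
    have "(\<lambda>(y, x). f (x * y)) \<in> borel_measurable (circle_borel \<Otimes>\<^sub>M circle_borel)"
      using measurable_compose[OF measurable_circle_mult bounded_measurable_measurable[OF f]]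
      by (simp add: case_prod_beta' mult.commute)
    then have "(\<lambda>(y, x). f (x * y)) \<in> borel_measurable (circle_borel \<Otimes>\<^sub>M jordan_pos circle_borel \<sigma>)"
      by (simp add: measurable_cong_sets[OF sets_pair_measure_cong[OF refl sets_jordan_pos] refl])
    then show ?thesis by (rule borel_measurable_lebesgue_integral)
  qed
  have re: "vector_measure circle_borel (\<lambda>E. Re (\<mu> E))" and im: "vector_measure circle_borel (\<lambda>E. Im (\<mu> E))"
    using vector_measure_bounded_linear[OF \<mu>] bounded_linear_Re bounded_linear_Im by auto
  obtain B where B: "\<And>x. x \<in> circle \<Longrightarrow> norm (f x) \<le> B" using f by (auto simp: bounded_measurable_def)
  obtain C where C: "\<And>f B. bounded_measurable circle_borel f \<Longrightarrow> \<forall>x\<in>circle. norm (f x) \<le> B \<Longrightarrow>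
      norm (cmeasure_integral circle_borel \<mu> f) \<le> C * B"
    using cmeasure_integral_bounded[OF \<mu>] by auto
  show ?thesis
  proof (rule bounded_measurableI)
    show "(\<lambda>y. cmeasure_integral circle_borel \<mu> (\<lambda>x. f (x * y))) \<in> borel_measurable circle_borel"
      unfolding cmeasure_integral_def signed_integral_def
      using m[OF re] m[OF im] m[OF vector_measure_uminus[OF re]] m[OF vector_measure_uminus[OF im]]
      by measurable
    show "norm (cmeasure_integral circle_borel \<mu> (\<lambda>x. f (x * y))) \<le> C * B" if "y \<in> space circle_borel" for y
      using that by (intro C bounded_measurable_translate f) (auto intro: B circle_mult)
  qed
qed

lemma sets_circle_translate:
  assumes "E \<in> sets circle_borel" "y \<in> circle"
  shows "{x \<in> circle. x * y \<in> E} \<in> sets circle_borel"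
  using measurable_sets[OF measurable_circle_translate[OF assms(2)] assms(1)]
  by (simp add: vimage_def Int_def conj_commute)

lemma cmeasure_integral_translate_indicator:
  assumes "vector_measure circle_borel \<mu>" "E \<in> sets circle_borel" "y \<in> circle"
  shows "cmeasure_integral circle_borel \<mu> (\<lambda>x. indicator E (x * y)) = \<mu> {x \<in> circle. x * y \<in> E}"
  using cmeasure_integral_indicator[OF assms(1) sets_circle_translate[OF assms(2,3)]]
  by (subst cmeasure_integral_cong[where g="indicator {x \<in> circle. x * y \<in> E}"]) (auto simp: indicator_def)

lemma circle_convolution_eq:
  assumes "vector_measure circle_borel \<mu>" "E \<in> sets circle_borel"
  shows "circle_convolution \<mu> \<nu> E =
    cmeasure_integral circle_borel \<nu> (\<lambda>y. cmeasure_integral circle_borel \<mu> (\<lambda>x. indicator E (x * y)))"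
  using assms by (auto simp: circle_convolution_def cmeasure_integral_translate_indicator
      intro!: cmeasure_integral_cong)

text \<open>For countable additivity, the indicators of the partial unions converge boundedly, and
  this limit passes first through the inner and then through the outer integral.\<close>

lemma circle_convolution_measure:
  assumes \<mu>: "\<mu> \<in> circle_measures" and \<nu>: "\<nu> \<in> circle_measures"
  shows "circle_convolution \<mu> \<nu> \<in> circle_measures"
proof -
  note \<mu>' = circle_measures_vector[OF \<mu>] and \<nu>' = circle_measures_vector[OF \<nu>]
  let ?T = "\<lambda>f y. cmeasure_integral circle_borel \<mu> (\<lambda>x. f (x * y))"
  obtain C where C: "\<And>f B. bounded_measurable circle_borel f \<Longrightarrow> \<forall>x\<in>circle. norm (f x) \<le> B \<Longrightarrow>
      norm (cmeasure_integral circle_borel \<mu> f) \<le> C * B"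
    using cmeasure_integral_bounded[OF \<mu>'] by auto
  have "vector_measure circle_borel (circle_convolution \<mu> \<nu>)"
    unfolding vector_measure_def
  proof (intro allI impI)
    fix A :: "nat \<Rightarrow> complex set" assume A: "range A \<subseteq> sets circle_borel" "disjoint_family A"
    have sum_ind: "(\<Sum>i<n. indicator (A i) x) = (indicator (\<Union>i<n. A i) x :: complex)" for x n
      using A(2) by (intro indicator_UN_disjoint[symmetric]) (auto simp: disjoint_family_on_def)
    have bm: "bounded_measurable circle_borel (indicator (A i))"
      "bounded_measurable circle_borel (indicator (\<Union>i<n. A i))" for i n
      using A by (auto intro!: bounded_measurable_indicator)
    have "(\<lambda>n. cmeasure_integral circle_borel \<nu> (?T (indicator (\<Union>i<n. A i))))
        \<longlonglongrightarrow> cmeasure_integral circle_borel \<nu> (?T (indicator (\<Union>i. A i)))"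
    proof (rule cmeasure_integral_lim[OF \<nu>', where B="C * 1"])
      show "bounded_measurable circle_borel (?T (indicator (\<Union>i<n. A i)))" for n
        by (intro bounded_measurable_fiber_integral \<mu>' bm)
      fix y assume "y \<in> space circle_borel"
      then have y: "y \<in> circle" by simp
      show "norm (?T (indicator (\<Union>i<n. A i)) y) \<le> C * 1" for n
        by (intro C bounded_measurable_translate bm y) (auto simp: indicator_def)
      show "(\<lambda>n. ?T (indicator (\<Union>i<n. A i)) y) \<longlonglongrightarrow> ?T (indicator (\<Union>i. A i)) y"
        by (rule cmeasure_integral_lim[OF \<mu>', where B=1])
          (auto intro: bounded_measurable_translate bm y simp: LIMSEQ_indicator_UN, simp add: indicator_def)
    qed
    moreover have "cmeasure_integral circle_borel \<nu> (?T (indicator (\<Union>i<n. A i))) =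
        (\<Sum>i<n. circle_convolution \<mu> \<nu> (A i))" for n
    proof -
      have "cmeasure_integral circle_borel \<nu> (?T (indicator (\<Union>i<n. A i))) =
        cmeasure_integral circle_borel \<nu> (\<lambda>y. \<Sum>i<n. ?T (indicator (A i)) y)"
        unfolding sum_ind[symmetric]
        by (intro cmeasure_integral_cong cmeasure_integral_sum \<mu>' bounded_measurable_translate bm) auto
      also have "\<dots> = (\<Sum>i<n. circle_convolution \<mu> \<nu> (A i))"
        using A by (subst cmeasure_integral_sum[OF \<nu>'])
          (auto intro!: bounded_measurable_fiber_integral \<mu>' bm sum.cong circle_convolution_eq[symmetric])
      finally show ?thesis .
    qed
    moreover have "circle_convolution \<mu> \<nu> (\<Union>i. A i) = cmeasure_integral circle_borel \<nu> (?T (indicator (\<Union>i. A i)))"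
      using A by (intro circle_convolution_eq \<mu>') auto
    ultimately show "(\<lambda>i. circle_convolution \<mu> \<nu> (A i)) sums circle_convolution \<mu> \<nu> (\<Union>i. A i)"
      by (simp add: sums_def)
  qed
  then show ?thesis by (simp add: circle_measures_iff circle_convolution_def)
qed

text \<open>For indicators this is the definition of convolution; bounded limits pass through both
  integrals.\<close>

lemma cmeasure_integral_convolution:
  assumes \<mu>: "\<mu> \<in> circle_measures" and \<nu>: "\<nu> \<in> circle_measures" and f: "bounded_measurable circle_borel f"
  shows "cmeasure_integral circle_borel (circle_convolution \<mu> \<nu>) f =
    cmeasure_integral circle_borel \<nu> (\<lambda>y. cmeasure_integral circle_borel \<mu> (\<lambda>x. f (x * y)))"
proof -
  note \<mu>' = circle_measures_vector[OF \<mu>] and \<nu>' = circle_measures_vector[OF \<nu>]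
    and c' = circle_measures_vector[OF circle_convolution_measure[OF \<mu> \<nu>]]
  note bm = bounded_measurable_fiber_integral[OF \<mu>'] bounded_measurable_translate
  show ?thesis
    using f
  proof (induction rule: bounded_measurable_induct)
    case (indicator E)
    then show ?case
      by (simp add: cmeasure_integral_indicator c' circle_convolution_eq \<mu>')
  next
    case (add f g)
    have "cmeasure_integral circle_borel \<nu> (\<lambda>y. cmeasure_integral circle_borel \<mu> (\<lambda>x. f (x * y) + g (x * y))) =
      cmeasure_integral circle_borel \<nu> (\<lambda>y. cmeasure_integral circle_borel \<mu> (\<lambda>x. f (x * y)) +
         cmeasure_integral circle_borel \<mu> (\<lambda>x. g (x * y)))"
      using add by (intro cmeasure_integral_cong cmeasure_integral_add \<mu>' bm) auto
    then show ?case using add by (simp add: cmeasure_integral_add c' \<nu>' bm)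
  next
    case (scale c f)
    then show ?case by (simp add: cmeasure_integral_scale c' \<nu>' \<mu>')
  next
    case (lim F g B)
    obtain C where C: "\<And>f B. bounded_measurable circle_borel f \<Longrightarrow> \<forall>x\<in>circle. norm (f x) \<le> B \<Longrightarrow>
        norm (cmeasure_integral circle_borel \<mu> f) \<le> C * B"
      using cmeasure_integral_bounded[OF \<mu>'] by auto
    have "(\<lambda>i. cmeasure_integral circle_borel (circle_convolution \<mu> \<nu>) (F i)) \<longlonglongrightarrow>
        cmeasure_integral circle_borel \<nu> (\<lambda>y. cmeasure_integral circle_borel \<mu> (\<lambda>x. g (x * y)))"
      unfolding lim.IH
    proof (rule cmeasure_integral_lim[OF \<nu>', where B="C * B"])
      fix y assume "y \<in> space circle_borel"
      then have y: "y \<in> circle" by simp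
      show "norm (cmeasure_integral circle_borel \<mu> (\<lambda>x. F i (x * y))) \<le> C * B" for i
        using lim.hyps y by (intro C bm) (auto intro: circle_mult)
      show "(\<lambda>i. cmeasure_integral circle_borel \<mu> (\<lambda>x. F i (x * y))) \<longlonglongrightarrow> cmeasure_integral circle_borel \<mu> (\<lambda>x. g (x * y))"
        using lim.hyps y by (intro cmeasure_integral_lim[OF \<mu>', where B=B] bm) (auto simp: circle_mult)
    qed (use lim.hyps bm in auto)
    then show ?case using cmeasure_integral_lim[OF c' lim.hyps] LIMSEQ_unique by blast
  qed
qed

section \<open>Fourier-Stieltjes transforms\<close>

text \<open>With this sign the value at \<open>n\<close> is the classical Fourier-Stieltjes
  coefficient at \<open>-n\<close>.\<close>

definition fourier :: "(complex set \<Rightarrow> complex) \<Rightarrow> int \<Rightarrow> complex" where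
  "fourier \<mu> n = cmeasure_integral circle_borel \<mu> (\<lambda>z. z powi n)"

lemma fourier_add:
  assumes "\<mu> \<in> circle_measures" "\<nu> \<in> circle_measures"
  shows "fourier (\<lambda>E. \<mu> E + \<nu> E) n = fourier \<mu> n + fourier \<nu> n"
proof -
  have "fourier (\<lambda>E. \<mu> E + \<nu> E) n = 1 * fourier \<mu> n + 1 * fourier \<nu> n"
    unfolding fourier_def
    by (rule cmeasure_integral_linear)
      (simp_all add: circle_measures_vector assms circle_measures_add bounded_measurable_powi)
  then show ?thesis by simp
qed

lemma fourier_scale:
  assumes "\<mu> \<in> circle_measures"
  shows "fourier (\<lambda>E. c * \<mu> E) n = c * fourier \<mu> n"
proof -
  have "fourier (\<lambda>E. c * \<mu> E) n = c * fourier \<mu> n + 0 * fourier \<mu> n"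
    unfolding fourier_def
    by (rule cmeasure_integral_linear)
      (simp_all add: circle_measures_vector assms circle_measures_scale bounded_measurable_powi)
  then show ?thesis by simp
qed
lemma fourier_convolution:
  assumes \<mu>: "\<mu> \<in> circle_measures" and \<nu>: "\<nu> \<in> circle_measures"
  shows "fourier (circle_convolution \<mu> \<nu>) n = fourier \<mu> n * fourier \<nu> n"
proof -
  have "fourier (circle_convolution \<mu> \<nu>) n =
    cmeasure_integral circle_borel \<nu> (\<lambda>y. cmeasure_integral circle_borel \<mu> (\<lambda>x. (x * y) powi n))"
    unfolding fourier_def by (rule cmeasure_integral_convolution[OF \<mu> \<nu> bounded_measurable_powi])
  also have "\<dots> = cmeasure_integral circle_borel \<nu> (\<lambda>y. fourier \<mu> n * y powi n)"
  proof (rule cmeasure_integral_cong)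
    fix y :: complex
    have "(\<lambda>x::complex. (x * y) powi n) = (\<lambda>x. y powi n * x powi n)"
      unfolding power_int_mult_distrib by (intro ext mult.commute)
    then show "cmeasure_integral circle_borel \<mu> (\<lambda>x. (x * y) powi n) = fourier \<mu> n * y powi n"
      unfolding fourier_def
      by (simp only: cmeasure_integral_scale[OF circle_measures_vector[OF \<mu>]]) (rule mult.commute)
  qed
  also have "\<dots> = fourier \<mu> n * fourier \<nu> n"
    unfolding fourier_def by (rule cmeasure_integral_scale[OF circle_measures_vector[OF \<nu>]])
  finally show ?thesis .
qed

section \<open>Uniqueness of the Fourier-Stieltjes transform\<close>

inductive trig_poly :: "(complex \<Rightarrow> complex) \<Rightarrow> bool" where
  monom: "trig_poly (\<lambda>z. c * z powi n)"
| add: "trig_poly f \<Longrightarrow> trig_poly g \<Longrightarrow> trig_poly (\<lambda>z. f z + g z)"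
| cong: "trig_poly f \<Longrightarrow> (\<And>z. z \<in> circle \<Longrightarrow> f z = g z) \<Longrightarrow> trig_poly g"

lemma trig_poly_mult:
  assumes "trig_poly f" "trig_poly g" shows "trig_poly (\<lambda>z. f z * g z)"
  using assms(1)
proof induction
  case (monom c n)
  show ?case using assms(2)
  proof induction
    case (monom d m)
    show ?case
      by (rule trig_poly.cong[OF trig_poly.monom[of "c * d" "n + m"]])
        (auto simp: power_int_add circle_nonzero)
  next
    case (add f g)
    show ?case using trig_poly.add[OF add.IH] by (simp add: distrib_left)
  next
    case (cong f g)
    show ?case by (rule trig_poly.cong[OF cong(3)]) (simp add: cong(2))
  qed
next
  case (add f g)
  show ?case using trig_poly.add[OF add.IH] by (simp add: distrib_right)
next
  case (cong f g)
  show ?case by (rule trig_poly.cong[OF cong(3)]) (simp add: cong(2))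
qed

text \<open>On the circle \<open>Re z = (z + 1/z) / 2\<close> and
  \<open>Im z = (z - 1/z) / (2 * \<i>)\<close>. Thus the Stone-Weierstrass theorem for real
  polynomials in the plane yields density of the trigonometric polynomials.\<close>

lemma trig_poly_real_polynomial:
  assumes "real_polynomial_function p" shows "trig_poly (\<lambda>z. complex_of_real (p z))"
  using assms
proof induction
  case (linear f)
  then interpret bounded_linear f .
  have f: "f z = Re z * f 1 + Im z * f \<i>" for z
  proof -
    have "f z = f (Re z *\<^sub>R 1 + Im z *\<^sub>R \<i>)"
      by (rule arg_cong[where f=f]) (auto simp: complex_eq_iff)
    then show ?thesis by (simp only: add scaleR) simp
  qed
  let ?a = "complex_of_real (f 1) / 2" and ?b = "- \<i> * complex_of_real (f \<i>) / 2"
  \<comment> \<open>This needs \<open>inverse z = cnj z\<close>, which holds on the circle only;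
    hence the rule \<open>cong\<close> of \<open>trig_poly\<close>.\<close>
  have eq: "complex_of_real (f z) = (?a + ?b) * z powi 1 + (?a - ?b) * z powi (-1)" if "z \<in> circle" for z
  proof -
    have inv: "inverse z = cnj z"
      using that complex_norm_square[of z] by (intro inverse_unique) (simp add: circle_def)
    show ?thesis
      unfolding f[of z] by (simp add: power_int_minus inv complex_eq_iff algebra_simps)
  qed
  show ?case
    by (rule trig_poly.cong[OF trig_poly.add[OF trig_poly.monom[of "?a + ?b" 1] trig_poly.monom[of "?a - ?b" "-1"]]])
      (rule eq[symmetric])
next
  case (const c)
  show ?case using trig_poly.monom[of c 0] by simp
next
  case (add f g)
  then show ?case using trig_poly.add[OF add.IH] by simp
next
  case (mult f g)
  then show ?case using trig_poly_mult[OF mult.IH] by simp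
qed

text \<open>Equality of integrals spreads from trigonometric polynomials to continuous functions by
  Stone-Weierstrass, to indicators of closed sets by bounded convergence, and to Borel sets by the
  pi-lambda theorem.\<close>

lemma fourier_inject:
  assumes \<mu>: "\<mu> \<in> circle_measures" and \<nu>: "\<nu> \<in> circle_measures" and eq: "\<And>n. fourier \<mu> n = fourier \<nu> n"
  shows "\<mu> = \<nu>"
proof -
  let ?I = "cmeasure_integral circle_borel"
  note \<mu>' = circle_measures_vector[OF \<mu>] and \<nu>' = circle_measures_vector[OF \<nu>]
  have trig: "bounded_measurable circle_borel f \<and> ?I \<mu> f = ?I \<nu> f" if "trig_poly f" for f
    using that
  proof induction
    case (monom c n)
    then show ?case using eq[of n]
      by (auto simp: cmeasure_integral_scale \<mu>' \<nu>' fourier_def intro!: bounded_measurable_mult bounded_measurable_powi)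
  next
    case (add f g)
    then show ?case by (simp add: cmeasure_integral_add \<mu>' \<nu>' bounded_measurable_add)
  next
    case (cong f g)
    \<comment> \<open>On the circle \<open>g\<close> is the limit of the constant sequence
      \<open>f\<close>.\<close>
    have "bounded_measurable circle_borel g"
      using cong bounded_measurable_lim[of circle_borel "\<lambda>_. f" _ g]
      by (auto simp: bounded_measurable_def)
    then show ?case
      using cong cmeasure_integral_cong[of circle_borel f g] by simp
  qed
  have cont: "?I \<mu> (\<lambda>z. complex_of_real (f z)) = ?I \<nu> (\<lambda>z. complex_of_real (f z))"
    if f: "continuous_on circle f" "\<And>z. z \<in> circle \<Longrightarrow> \<bar>f z\<bar> \<le> 1" for f
  proof -
    have "\<exists>p. real_polynomial_function p \<and> (\<forall>z\<in>circle. \<bar>f z - p z\<bar> < inverse (Suc k))" for k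
      by (rule Stone_Weierstrass_real_polynomial_function[of circle f "inverse (Suc k)"])
        (use f in \<open>auto simp: circle_def\<close>)
    then obtain p where p: "\<And>k. real_polynomial_function (p k)"
      "\<And>k z. z \<in> circle \<Longrightarrow> \<bar>f z - p k z\<bar> < inverse (Suc k)" by metis
    have lim: "(\<lambda>k. complex_of_real (p k z)) \<longlonglongrightarrow> complex_of_real (f z)" if z: "z \<in> circle" for z
    proof (intro tendsto_of_real)
      have "(\<lambda>k. f z - p k z) \<longlonglongrightarrow> 0"
        by (rule Lim_null_comparison[OF _ LIMSEQ_inverse_real_of_nat])
          (use p(2)[OF z] in \<open>auto intro!: always_eventually less_imp_le\<close>)
      from tendsto_diff[OF tendsto_const[of "f z"] this] show "(\<lambda>k. p k z) \<longlonglongrightarrow> f z" by simp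
    qed
    have bd: "norm (complex_of_real (p k z)) \<le> 2" if z: "z \<in> circle" for k z
    proof -
      have "inverse (real (Suc k)) \<le> 1" by (simp add: field_simps)
      then show ?thesis using p(2)[OF z, of k] f(2)[OF z] by simp
    qed
    note tp = trig[OF trig_poly_real_polynomial[OF p(1)], THEN conjunct1]
      and eq = trig[OF trig_poly_real_polynomial[OF p(1)], THEN conjunct2]
    have "(\<lambda>k. ?I \<mu> (\<lambda>z. complex_of_real (p k z))) \<longlonglongrightarrow> ?I \<mu> (\<lambda>z. complex_of_real (f z))"
      "(\<lambda>k. ?I \<nu> (\<lambda>z. complex_of_real (p k z))) \<longlonglongrightarrow> ?I \<nu> (\<lambda>z. complex_of_real (f z))"
      using tp lim bd by (auto intro!: cmeasure_integral_lim[where B=2] \<mu>' \<nu>')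
    then show ?thesis using LIMSEQ_unique unfolding eq by blast
  qed
  have closed: "\<mu> (E \<inter> circle) = \<nu> (E \<inter> circle)" if E: "closed E" for E
  \<comment> \<open>The distance \<open>infdist z {}\<close> is 0 by convention, so the empty set
    needs a case of its own.\<close>
  proof (cases "E \<inter> circle = {}")
    case True then show ?thesis using vector_measure_empty[OF \<mu>'] vector_measure_empty[OF \<nu>'] by simp
  next
    case False
    define K where "K = E \<inter> circle"
    have K: "closed K" "K \<noteq> {}" "K \<subseteq> circle" "K \<in> sets circle_borel"
      using E False by (auto simp: K_def circle_def sets_circle_borel)
    \<comment> \<open>Continuous functions with values between 0 and 1 that decrease to the
      indicator of the closed set \<open>K\<close>.\<close>
    define f where "f n z = max 0 (1 - real n * infdist z K)" for n z
    have fc: "continuous_on circle (f n)" for n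
      unfolding f_def by (intro continuous_intros)
    have f1: "\<bar>f n z\<bar> \<le> 1" for n z
      by (auto simp: f_def infdist_nonneg)
    have lim: "(\<lambda>n. complex_of_real (f n z)) \<longlonglongrightarrow> indicator K z" for z
    proof (cases "z \<in> K")
      case True then show ?thesis by (simp add: f_def)
    next
      case False
      then have pos: "infdist z K > 0"
        using K in_closed_iff_infdist_zero[of K z] infdist_nonneg[of z K] by fastforce
      then obtain N where N: "1 < real N * infdist z K" using reals_Archimedean3 by blast
      have "f n z = 0" if "n \<ge> N" for n
      proof -
        have "real N * infdist z K \<le> real n * infdist z K"
          using that pos by (intro mult_right_mono) auto
        then show ?thesis using N by (simp add: f_def)
      qed
      then have "\<forall>\<^sub>F n in sequentially. complex_of_real (f n z) = indicator K z"
        using False by (auto simp: eventually_sequentially)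
      then show ?thesis by (rule tendsto_eventually)
    qed
    have bm: "bounded_measurable circle_borel (\<lambda>z. complex_of_real (f n z))" for n
    proof (rule bounded_measurableI[where B=1])
      show "(\<lambda>z. complex_of_real (f n z)) \<in> borel_measurable circle_borel"
        unfolding circle_borel_def
        by (intro borel_measurable_continuous_on_restrict continuous_on_of_real fc)
    qed (use f1 in simp)
    have "(\<lambda>n. ?I \<mu> (\<lambda>z. complex_of_real (f n z))) \<longlonglongrightarrow> ?I \<mu> (indicator K)"
      "(\<lambda>n. ?I \<nu> (\<lambda>z. complex_of_real (f n z))) \<longlonglongrightarrow> ?I \<nu> (indicator K)"
      by (rule cmeasure_integral_lim[where B=1], rule \<mu>' \<nu>', rule bm, use f1 lim in simp_all)+
    then have "?I \<mu> (indicator K) = ?I \<nu> (indicator K)"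
      unfolding cont[OF fc f1] using LIMSEQ_unique by blast
    then show ?thesis
      using K by (simp add: cmeasure_integral_indicator \<mu>' \<nu>' K_def)
  qed
  have circ: "\<mu> circle = \<nu> circle" using closed[of UNIV] by simp
  have sb: "sigma_sets UNIV (Collect closed) = (sets borel :: complex set set)"
    by (simp add: borel_eq_closed)
  have all: "\<mu> (E \<inter> circle) = \<nu> (E \<inter> circle)" if "E \<in> sets borel" for E
  proof -
    have "Int_stable (Collect closed :: complex set set)" "Collect closed \<subseteq> Pow (UNIV :: complex set)"
      "E \<in> sigma_sets UNIV (Collect closed)"
      using that by (auto simp: sb Int_stable_def)
    then show ?thesis
    proof (induction rule: sigma_sets_induct_disjoint)
      case (compl A)
      then have A: "A \<inter> circle \<in> sets circle_borel" by (simp add: sb sets_circle_borel)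
      have "(UNIV - A) \<inter> circle = circle - A \<inter> circle" by auto
      then show ?case
        using compl A circ vector_measure_Diff[OF \<mu>' _ A] vector_measure_Diff[OF \<nu>' _ A]
        by (simp add: sets_circle_borel)
    next
      case (union A)
      have A: "range (\<lambda>i. A i \<inter> circle) \<subseteq> sets circle_borel" "disjoint_family (\<lambda>i. A i \<inter> circle)"
        using union by (auto simp: sets_circle_borel disjoint_family_on_def sb)
      have "(\<Union>i. A i) \<inter> circle = (\<Union>i. A i \<inter> circle)" by auto
      then show ?case
        using vector_measureD[OF \<mu>' A] vector_measureD[OF \<nu>' A] union.IH sums_unique2 by simp
    qed (auto simp: closed vector_measure_empty[OF \<mu>'] vector_measure_empty[OF \<nu>'])
  qed
  show ?thesis
    by (rule circle_measures_eqI[OF \<mu> \<nu>]) (use all in \<open>metis sets_circle_borel Int_absorb2\<close>)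
qed

section \<open>Haar measure and the measures with a single nonzero Fourier coefficient\<close>

definition density_measure :: "complex measure \<Rightarrow> (complex \<Rightarrow> complex) \<Rightarrow> complex set \<Rightarrow> complex" where
  "density_measure N h E = (if E \<in> sets circle_borel then \<integral>z. indicator E z * h z \<partial>N else 0)"

lemma density_measure_circle:
  assumes N: "finite_measure N" "sets N = sets circle_borel" and h: "bounded_measurable circle_borel h"
  shows "density_measure N h \<in> circle_measures"
proof -
  have eq: "(\<lambda>i::nat. density_measure N h (A i)) = (\<lambda>i. \<integral>z. indicator (A i) z * h z \<partial>N)"
    if "range A \<subseteq> sets circle_borel" for A
    using that by (auto simp: density_measure_def)
  have "vector_measure circle_borel (density_measure N h)"
    unfolding vector_measure_def
  proof (intro allI impI)
    fix A :: "nat \<Rightarrow> complex set" assume A: "range A \<subseteq> sets circle_borel" "disjoint_family A"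
    then have "(\<Union>i. A i) \<in> sets circle_borel" by auto
    then show "(\<lambda>i. density_measure N h (A i)) sums density_measure N h (\<Union>i. A i)"
      using vector_measureD[OF vector_measure_density[OF N h] A]
      unfolding eq[OF A(1)] by (simp add: density_measure_def)
  qed
  then show ?thesis by (simp add: circle_measures_iff density_measure_def)
qed

lemma fourier_density_measure:
  assumes N: "finite_measure N" "sets N = sets circle_borel" and h: "bounded_measurable circle_borel h"
  shows "fourier (density_measure N h) n = (\<integral>z. z powi n * h z \<partial>N)"
  unfolding fourier_def
proof (rule cmeasure_integral_density[OF N h])
  show "vector_measure circle_borel (density_measure N h)"
    by (rule circle_measures_vector[OF density_measure_circle[OF assms]])
qed (simp_all add: density_measure_def bounded_measurable_powi)

definition uniform_angle :: "real measure" where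
  "uniform_angle = density lborel (\<lambda>x. indicator {-pi..pi} x / (2 * pi))"

lemma sets_uniform_angle [simp, measurable_cong]: "sets uniform_angle = sets borel"
  by (simp add: uniform_angle_def)

lemma space_uniform_angle [simp]: "space uniform_angle = UNIV"
  by (simp add: uniform_angle_def)

lemma integral_uniform_angle_cis:
  "(\<integral>x. cis (of_int n * x) \<partial>uniform_angle) = (if n = 0 then 1 else 0)"
proof -
  have [measurable]: "(\<lambda>x. cis (of_int n * x)) \<in> borel_measurable borel"
    by (intro borel_measurable_continuous_onI continuous_intros)
  have "(\<integral>x. cis (of_int n * x) \<partial>uniform_angle) =
      (\<integral>x. (indicator {-pi..pi} x / (2 * pi)) *\<^sub>R cis (of_int n * x) \<partial>lborel)"
    unfolding uniform_angle_def
    by (subst integral_density[symmetric]) (auto simp: divide_ennreal[symmetric] ennreal_indicator[symmetric])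
  also have "\<dots> = (1 / (2 * pi)) *\<^sub>R (\<integral>x. indicator {-pi..pi} x *\<^sub>R cis (of_int n * x) \<partial>lborel)"
    by (subst integral_scaleR_right[symmetric]) (simp add: divide_simps)
  also have "(\<integral>x. indicator {-pi..pi} x *\<^sub>R cis (of_int n * x) \<partial>lborel) = (if n = 0 then 2 * pi else 0)"
  proof (cases "n = 0")
    case False
    have "(\<integral>x. indicator {-pi..pi} x *\<^sub>R cis (of_int n * x) \<partial>lborel) =
       cis (of_int n * pi) / (\<i> * of_int n) - cis (of_int n * - pi) / (\<i> * of_int n)"
    proof (rule integral_FTC_Icc)
      show "((\<lambda>x. cis (of_int n * x) / (\<i> * of_int n)) has_vector_derivative cis (of_int n * x)) (at x within {-pi..pi})" for x
      proof -
        have "((\<lambda>z. exp (\<i> * (of_int n * z)) / (\<i> * of_int n)) has_field_derivative exp (\<i> * (of_int n * of_real x))) (at (of_real x))"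
          using False by (auto intro!: derivative_eq_intros) (simp add: complex_eq_iff)
        from has_vector_derivative_real_field[OF this] show ?thesis
          by (simp add: cis_conv_exp)
      qed
    qed (auto intro!: continuous_intros)
    also have "cis (of_int n * - pi) = cis (of_int n * pi)"
      by (simp add: complex_eq_iff sin_times_pi_eq_0)
    finally show ?thesis using False by simp
  qed (simp add: complex_eq_iff)
  finally show ?thesis by (auto simp: complex_eq_iff)
qed

lemma prob_space_uniform_angle: "prob_space uniform_angle"
proof
  have "emeasure uniform_angle UNIV = (\<integral>\<^sup>+x. ennreal (1 / (2 * pi)) * indicator {-pi..pi} x \<partial>lborel)"
    by (subst uniform_angle_def, subst emeasure_density)
      (auto intro!: nn_integral_cong simp: indicator_def)
  also have "\<dots> = 1" by (simp add: nn_integral_cmult flip: ennreal_mult)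
  finally show "emeasure uniform_angle (space uniform_angle) = 1" by simp
qed

lemma measurable_cis [measurable]: "cis \<in> borel \<rightarrow>\<^sub>M circle_borel"
proof -
  have "cis \<in> borel_measurable borel" by (intro borel_measurable_continuous_onI continuous_intros)
  then show ?thesis
    unfolding circle_borel_def by (rule measurable_restrict_space2[rotated]) (auto simp: circle_def)
qed

definition haar :: "complex measure" where
  "haar = distr uniform_angle circle_borel cis"

lemma sets_haar [simp, measurable_cong]: "sets haar = sets circle_borel"
  by (simp add: haar_def)

lemma finite_measure_haar: "finite_measure haar"
proof -
  interpret prob_space uniform_angle by (rule prob_space_uniform_angle)
  show ?thesis unfolding haar_def
    by (intro prob_space.finite_measure prob_space_distr) simp
qed

lemma integral_haar_powi: "(\<integral>z. z powi n \<partial>haar) = (if n = 0 then 1 else 0)"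
  unfolding haar_def using integral_uniform_angle_cis[of n]
  by (subst integral_distr) (auto simp: cis_power_int)

text \<open>For \<open>n = 0\<close> this is the Haar measure as a set function. The sign of the
  exponent makes the transform the indicator of \<open>{n}\<close>.\<close>

definition character_measure :: "int \<Rightarrow> complex set \<Rightarrow> complex" where
  "character_measure n = density_measure haar (\<lambda>z. z powi (-n))"

lemma character_measure_circle: "character_measure n \<in> circle_measures"
  unfolding character_measure_def
  by (intro density_measure_circle finite_measure_haar bounded_measurable_powi) simp

lemma fourier_character_measure: "fourier (character_measure n) m = (if m = n then 1 else 0)"
proof -
  have "(\<integral>z. z powi m * z powi (-n) \<partial>haar) = (\<integral>z. z powi (m - n) \<partial>haar)"
    by (intro Bochner_Integration.integral_cong)
      (auto simp: sets_eq_imp_space_eq[OF sets_haar] power_int_diff power_int_minus field_simps circle_nonzero)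
  then show ?thesis
    unfolding character_measure_def
    by (subst fourier_density_measure) (auto simp: finite_measure_haar bounded_measurable_powi integral_haar_powi)
qed

section \<open>Weak limits along ultrafilters\<close>

text \<open>A minimal proper filter below \<open>F\<close>, obtained from Zorn's lemma for the
  reversed order, decides every property.\<close>

lemma ultrafilter_exists:
  fixes F :: "'a filter"
  assumes "F \<noteq> bot"
  shows "\<exists>U\<le>F. U \<noteq> bot \<and> (\<forall>P. eventually P U \<or> eventually (\<lambda>x. \<not> P x) U)"
proof -
  let ?A = "{U. U \<le> F \<and> U \<noteq> bot}"
  have "\<exists>U\<in>?A. \<forall>V\<in>?A. U \<ge> V \<longrightarrow> V = U"
  proof (rule predicate_Zorn)
    show "partial_order_on ?A (relation_of (\<ge>) ?A)"
      by (auto simp: partial_order_on_def preorder_on_def refl_on_def trans_def antisym_def relation_of_def)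
    fix C assume C: "C \<in> Chains (relation_of (\<ge>) ?A)"
    show "\<exists>u\<in>?A. \<forall>a\<in>C. a \<ge> u"
    proof (cases "C = {}")
      case True then show ?thesis using assms by auto
    next
      case False
      have CA: "C \<subseteq> ?A" using C by (auto simp: Chains_def relation_of_def)
      have "eventually P (Inf C) \<longleftrightarrow> (\<exists>b\<in>C. eventually P b)" for P
      proof (rule eventually_Inf_base[OF False])
        fix G H assume "G \<in> C" "H \<in> C"
        then have "G \<le> H \<or> H \<le> G" using C by (auto simp: Chains_def relation_of_def)
        \<comment> \<open>Since a chain is directed, what holds eventually for its infimum already
          does for one of its members; so the infimum is proper.\<close>
        then show "\<exists>x\<in>C. x \<le> inf G H" using \<open>G \<in> C\<close> \<open>H \<in> C\<close> by (auto simp: inf_absorb1 inf_absorb2)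
      qed
      then have "Inf C \<noteq> bot" using CA by (auto simp: trivial_limit_def)
      moreover have "Inf C \<le> F" using False CA by (metis (no_types, lifting) Inf_lower2 ex_in_conv mem_Collect_eq subsetD)
      ultimately show ?thesis by (auto intro: Inf_lower)
    qed
  qed
  then obtain U where U: "U \<le> F" "U \<noteq> bot" "\<And>V. V \<le> F \<Longrightarrow> V \<noteq> bot \<Longrightarrow> V \<le> U \<Longrightarrow> V = U" by auto
  have "eventually P U \<or> eventually (\<lambda>x. \<not> P x) U" for P
  \<comment> \<open>Adjoining \<open>P\<close> either makes the filter improper, which means that
    the negation of \<open>P\<close> already holds eventually, or changes nothing by
    minimality.\<close>
  proof (cases "inf U (principal {x. P x}) = bot")
    case True
    then show ?thesis
      by (simp add: trivial_limit_def eventually_inf_principal)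
  next
    case False
    then have "inf U (principal {x. P x}) = U"
      by (intro U(3)) (auto intro: le_infI1 U(1))
    moreover have "eventually P (inf U (principal {x. P x}))" by (simp add: eventually_inf_principal)
    ultimately show ?thesis by simp
  qed
  then show ?thesis using U by blast
qed

lemma norm_tendsto_le:
  assumes "(f \<longlongrightarrow> l) U" "U \<noteq> bot" "\<And>k. norm (f k) \<le> B" shows "norm l \<le> B"
  using tendsto_upperbound[OF tendsto_norm[OF assms(1)] _ assms(2)] assms(3) by simp

text \<open>A subsequence with the required limits would depend on the measure. Along an ultrafilter
  all bounded sequences converge, so one choice serves every measure, and limits respect sums and
  products.\<close>

locale ultrafilter =
  fixes U :: "nat filter"
  assumes proper: "U \<noteq> bot" and ultra: "eventually P U \<or> eventually (\<lambda>x. \<not> P x) U"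
begin

text \<open>Compactness of the closure of the range yields a cluster point, and for an ultrafilter a
  cluster point is a limit.\<close>

lemma bounded_tendsto:
  fixes f :: "nat \<Rightarrow> 'a::heine_borel"
  assumes "bounded (range f)" shows "\<exists>l. (f \<longlongrightarrow> l) U"
proof -
  have "compact (closure (range f))" using assms by (simp add: compact_closure)
  moreover have "filtermap f U \<noteq> bot" using proper by (simp add: filtermap_bot_iff)
  moreover have "eventually (\<lambda>x. x \<in> closure (range f)) (filtermap f U)"
    by (simp add: eventually_filtermap closure_subset[THEN subsetD])
  ultimately obtain l where l: "inf (nhds l) (filtermap f U) \<noteq> bot"
    unfolding compact_filter by blast
  have "(f \<longlongrightarrow> l) U"
  proof (rule topological_tendstoI)
    fix S assume S: "open S" "l \<in> S"
    show "eventually (\<lambda>k. f k \<in> S) U"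
    proof (rule ccontr)
      assume "\<not> eventually (\<lambda>k. f k \<in> S) U"
      then have "eventually (\<lambda>x. x \<notin> S) (filtermap f U)" using ultra by (auto simp: eventually_filtermap)
      then have "eventually (\<lambda>x. False) (inf (nhds l) (filtermap f U))"
        unfolding eventually_inf using S by (metis eventually_nhds)
      then show False using l by (simp add: trivial_limit_def)
    qed
  qed
  then show ?thesis by blast
qed

lemma Lim_bounded:
  fixes f :: "nat \<Rightarrow> 'a::heine_borel"
  shows "bounded (range f) \<Longrightarrow> (f \<longlongrightarrow> Lim U f) U"
  using bounded_tendsto[of f] tendsto_Lim[OF proper] by metis

text \<open>The limits \<open>\<nu> E\<close> of the integrals over \<open>E\<close> form a measure
  dominated by twice \<open>N\<close>, and its Radon-Nikodym density is the weak limit. The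
  domination gives both countable additivity and absolute continuity.\<close>

lemma weak_limit_real:
  fixes u :: "nat \<Rightarrow> 'a \<Rightarrow> real"
  assumes N: "finite_measure N" and u: "\<And>k. u k \<in> borel_measurable N"
    and u02: "\<And>k x. x \<in> space N \<Longrightarrow> 0 \<le> u k x \<and> u k x \<le> 2"
  shows "\<exists>d. integrable N d \<and> (\<forall>E\<in>sets N. ((\<lambda>k. \<integral>x. indicator E x * u k x \<partial>N) \<longlongrightarrow> (\<integral>x. indicator E x * d x \<partial>N)) U)"
proof -
  interpret finite_measure N by fact
  have ui: "integrable N (\<lambda>x. indicator E x * u k x)" if "E \<in> sets N" for E k
    using that u u02 by (intro integrable_const_bound[where B=2]) (auto simp: indicator_def)
  define I where "I E k = (\<integral>x. indicator E x * u k x \<partial>N)" for E k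
  have I0: "0 \<le> I E k" if "E \<in> sets N" for E k
    unfolding I_def using u02 by (intro integral_nonneg_AE) (auto simp: indicator_def)
  have I2: "I E k \<le> 2 * measure N E" if E: "E \<in> sets N" for E k
  proof -
    have i: "integrable N (\<lambda>x. 2 * indicator E x :: real)"
      using E by (simp add: integrable_real_indicator less_top[symmetric])
    have "I E k \<le> (\<integral>x. 2 * indicator E x \<partial>N)"
      unfolding I_def by (rule integral_mono[OF ui[OF E] i]) (use u02 in \<open>auto simp: indicator_def\<close>)
    then show ?thesis using E sets.sets_into_space[OF E] by (simp add: Int_absorb2)
  qed
  define \<nu> where "\<nu> E = Lim U (I E)" for E
  have lim: "(I E \<longlongrightarrow> \<nu> E) U" if E: "E \<in> sets N" for E
    unfolding \<nu>_def
  proof (rule Lim_bounded, rule boundedI)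
    fix y assume "y \<in> range (I E)"
    then show "norm y \<le> 2 * measure N E" using I0[OF E] I2[OF E] by auto
  qed
  have n0: "0 \<le> \<nu> E" and n2: "\<nu> E \<le> 2 * measure N E" if "E \<in> sets N" for E
    using tendsto_lowerbound[OF lim[OF that] always_eventually proper]
      tendsto_upperbound[OF lim[OF that] always_eventually proper] I0[OF that] I2[OF that] by blast+
  have nU: "\<nu> (A \<union> B) = \<nu> A + \<nu> B" if "A \<in> sets N" "B \<in> sets N" "A \<inter> B = {}" for A B
  proof -
    have "I (A \<union> B) = (\<lambda>k. I A k + I B k)"
    proof
      fix k
      have "(\<integral>x. indicator (A \<union> B) x * u k x \<partial>N) = (\<integral>x. indicator A x * u k x + indicator B x * u k x \<partial>N)"
        using that by (intro Bochner_Integration.integral_cong) (auto simp: indicator_def)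
      then show "I (A \<union> B) k = I A k + I B k"
        unfolding I_def using ui that by simp
    qed
    then have "(I (A \<union> B) \<longlongrightarrow> \<nu> A + \<nu> B) U" using tendsto_add[OF lim lim] that by simp
    then show ?thesis using lim[of "A \<union> B"] that tendsto_unique[OF proper] by blast
  qed
  have nsums: "(\<lambda>i. \<nu> (A i)) sums \<nu> (\<Union>i. A i)" if A: "range A \<subseteq> sets N" "disjoint_family A" for A :: "nat \<Rightarrow> 'a set"
  proof -
    let ?R = "\<lambda>n. (\<Union>i. A i) - (\<Union>i<n. A i)"
    have fin: "\<nu> (\<Union>i<n. A i) = (\<Sum>i<n. \<nu> (A i))" for n
    proof (induction n)
      case 0
      show ?case using n0[of "{}"] n2[of "{}"] by simp
    next
      case (Suc n)
      have "\<nu> (A n \<union> (\<Union>i<n. A i)) = \<nu> (A n) + \<nu> (\<Union>i<n. A i)"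
      proof (rule nU)
        have "A i \<inter> A n = {}" if "i < n" for i
          using A(2) that unfolding disjoint_family_on_def by (metis UNIV_I less_irrefl)
        then show "A n \<inter> (\<Union>i<n. A i) = {}" by blast
      qed (use A in auto)
      then show ?case using Suc by (simp add: lessThan_Suc)
    qed
    have R: "?R n \<in> sets N" for n using A by auto
    \<comment> \<open>Finite additivity leaves a tail whose \<open>\<nu>\<close>-value is at most
      twice its \<open>N\<close>-measure, and the tails decrease to the empty set.\<close>
    have split: "\<nu> (\<Union>i. A i) = (\<Sum>i<n. \<nu> (A i)) + \<nu> (?R n)" for n
    proof -
      have "(\<Union>i<n. A i) \<union> ?R n = (\<Union>i. A i)" by auto
      then show ?thesis using nU[of "\<Union>i<n. A i" "?R n"] R A by (simp add: fin image_subset_iff)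
    qed
    have "(\<lambda>n. measure N (?R n)) \<longlonglongrightarrow> measure N (\<Inter>n. ?R n)"
      using R by (intro finite_Lim_measure_decseq) (auto simp: decseq_def)
    also have "(\<Inter>n. ?R n) = {}" by auto
    finally have m0: "(\<lambda>n. 2 * measure N (?R n)) \<longlonglongrightarrow> 0" by (auto intro: tendsto_eq_intros)
    have "(\<lambda>n. \<nu> (?R n)) \<longlonglongrightarrow> 0"
      by (rule tendsto_sandwich[OF _ _ tendsto_const m0]) (use n0[OF R] n2[OF R] in auto)
    then have "(\<lambda>n. \<nu> (\<Union>i. A i) - \<nu> (?R n)) \<longlonglongrightarrow> \<nu> (\<Union>i. A i) - 0" by (intro tendsto_intros)
    moreover have "\<nu> (\<Union>i. A i) - \<nu> (?R n) = (\<Sum>i<n. \<nu> (A i))" for n using split[of n] by simp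
    ultimately show ?thesis by (simp add: sums_def)
  qed
  define L where "L = measure_of (space N) (sets N) (\<lambda>E. ennreal (\<nu> E))"
  have sL: "sets L = sets N"
    unfolding L_def by (rule sets.sets_measure_of_eq)
  have eL: "emeasure L E = ennreal (\<nu> E)" if "E \<in> sets N" for E
  proof (rule emeasure_measure_of[OF L_def])
    show "countably_additive (sets L) (\<lambda>E. ennreal (\<nu> E))"
      unfolding countably_additive_def sL
    proof (intro allI impI)
      fix A :: "nat \<Rightarrow> 'a set" assume "range A \<subseteq> sets N" "disjoint_family A" "(\<Union>i. A i) \<in> sets N"
      then show "(\<Sum>i. ennreal (\<nu> (A i))) = ennreal (\<nu> (\<Union>i. A i))"
        using n0 by (intro suminf_ennreal_eq nsums) auto
    qed
  qed (use n0[of "{}"] n2[of "{}"] that sL sets.sets_into_space in \<open>auto simp: positive_def\<close>)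
  have "absolutely_continuous N L"
    unfolding absolutely_continuous_def
  proof
    fix E assume E: "E \<in> null_sets N"
    then have "\<nu> E = 0" using n0[of E] n2[of E] by (auto simp: measure_eq_0_null_sets)
    then show "E \<in> null_sets L" using E eL[of E] sL by (auto simp: null_sets_def)
  qed
  then obtain f where f: "f \<in> borel_measurable N" "density N f = L"
    using Radon_Nikodym sL by blast
  have nf: "(\<integral>\<^sup>+x. f x * indicator E x \<partial>N) = ennreal (\<nu> E)" if "E \<in> sets N" for E
    using emeasure_density[OF f(1) that] f(2) eL[OF that] by simp
  have "(\<integral>\<^sup>+x. f x \<partial>N) = (\<integral>\<^sup>+x. f x * indicator (space N) x \<partial>N)"
    by (intro nn_integral_cong) simp
  then have "(\<integral>\<^sup>+x. f x \<partial>N) \<noteq> \<infinity>" using nf[of "space N"] by simp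
  then have fin: "AE x in N. f x \<noteq> \<infinity>" by (rule nn_integral_PInf_AE[OF f(1)])
  define d where "d x = enn2real (f x)" for x
  have dm: "d \<in> borel_measurable N" using f(1) by (simp add: d_def[abs_def])
  have d0: "0 \<le> d x" for x by (simp add: d_def)
  have nd: "(\<integral>\<^sup>+x. ennreal (indicator E x * d x) \<partial>N) = ennreal (\<nu> E)" if "E \<in> sets N" for E
  proof -
    have "(\<integral>\<^sup>+x. ennreal (indicator E x * d x) \<partial>N) = (\<integral>\<^sup>+x. f x * indicator E x \<partial>N)"
      using fin by (intro nn_integral_cong_AE) (auto simp: d_def indicator_def less_top)
    then show ?thesis using nf[OF that] by simp
  qed
  have id: "(\<integral>x. indicator E x * d x \<partial>N) = \<nu> E" if "E \<in> sets N" for E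
    using nd[OF that] n0[OF that] dm that
    by (subst integral_eq_nn_integral) (auto simp: d0)
  have "integrable N (\<lambda>x. indicator (space N) x * d x)"
    using nd[of "space N"] dm by (intro integrableI_nonneg) (auto simp: d0)
  also have "?this \<longleftrightarrow> integrable N d"
    by (intro Bochner_Integration.integrable_cong) auto
  finally have "integrable N d" .
  then show ?thesis using lim id by (auto simp: I_def[abs_def])
qed

text \<open>Real and imaginary parts lie between -1 and 1. Adding 1 brings them into the range of
  \<open>weak_limit_real\<close>, whence the bound 2 there, and the limit is shifted back.\<close>

lemma weak_limit_indicator:
  fixes g :: "nat \<Rightarrow> 'a \<Rightarrow> complex"
  assumes N: "finite_measure N" and g: "\<And>k. g k \<in> borel_measurable N"
    and g1: "\<And>k x. x \<in> space N \<Longrightarrow> norm (g k x) \<le> 1"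
  shows "\<exists>c. integrable N c \<and> (\<forall>E\<in>sets N. ((\<lambda>k. \<integral>x. indicator E x * g k x \<partial>N) \<longlongrightarrow> (\<integral>x. indicator E x * c x \<partial>N)) U)"
proof -
  interpret finite_measure N by fact
  have *: "\<exists>d. integrable N d \<and> (\<forall>E\<in>sets N. ((\<lambda>k. \<integral>x. indicator E x * v k x \<partial>N) \<longlongrightarrow> (\<integral>x. indicator E x * d x \<partial>N)) U)"
    if v: "\<And>k. v k \<in> borel_measurable N" "\<And>k x. x \<in> space N \<Longrightarrow> \<bar>v k x\<bar> \<le> 1" for v :: "nat \<Rightarrow> 'a \<Rightarrow> real"
  proof -
    have v2: "0 \<le> 1 + v k x \<and> 1 + v k x \<le> 2" if "x \<in> space N" for k x
      using v(2)[OF that, of k] by linarith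
    obtain d where d: "integrable N d"
      "\<And>E. E \<in> sets N \<Longrightarrow> ((\<lambda>k. \<integral>x. indicator E x * (1 + v k x) \<partial>N) \<longlongrightarrow> (\<integral>x. indicator E x * d x \<partial>N)) U"
      using weak_limit_real[OF N, of "\<lambda>k x. 1 + v k x"] v(1) v2 by auto
    have "((\<lambda>k. \<integral>x. indicator E x * v k x \<partial>N) \<longlongrightarrow> (\<integral>x. indicator E x * (d x - 1) \<partial>N)) U" if E: "E \<in> sets N" for E
    proof -
      have i1: "integrable N (\<lambda>x. indicator E x :: real)" using E by (simp add: integrable_real_indicator less_top[symmetric])
      have i2: "integrable N (\<lambda>x. indicator E x * v k x)" for k
        using v E by (intro integrable_const_bound[where B=1]) (auto simp: indicator_def)
      have i3: "integrable N (\<lambda>x. indicator E x * d x)"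
        using integrable_real_mult_indicator[OF E d(1)] by (simp add: mult.commute)
      have "(\<integral>x. indicator E x * (1 + v k x) \<partial>N) - (\<integral>x. indicator E x \<partial>N) = (\<integral>x. indicator E x * v k x \<partial>N)" for k
        using Bochner_Integration.integral_add[OF i1 i2] by (simp add: distrib_left)
      moreover have "(\<integral>x. indicator E x * d x \<partial>N) - (\<integral>x. indicator E x \<partial>N) = (\<integral>x. indicator E x * (d x - 1) \<partial>N)"
        using Bochner_Integration.integral_diff[OF i3 i1] by (simp add: right_diff_distrib)
      ultimately show ?thesis
        using tendsto_diff[OF d(2)[OF E] tendsto_const[of "\<integral>x. indicator E x \<partial>N"]] by simp
    qed
    then show ?thesis using d(1) by (intro exI[of _ "\<lambda>x. d x - 1"]) auto
  qed
  have re: "\<bar>Re (g k x)\<bar> \<le> 1" "\<bar>Im (g k x)\<bar> \<le> 1" if "x \<in> space N" for k x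
    using abs_Re_le_cmod[of "g k x"] abs_Im_le_cmod[of "g k x"] g1[OF that, of k] by linarith+
  obtain a where a: "integrable N a"
     "\<And>E. E \<in> sets N \<Longrightarrow> ((\<lambda>k. \<integral>x. indicator E x * Re (g k x) \<partial>N) \<longlongrightarrow> (\<integral>x. indicator E x * a x \<partial>N)) U"
    using *[of "\<lambda>k x. Re (g k x)"] g re by auto
  obtain b where b: "integrable N b"
     "\<And>E. E \<in> sets N \<Longrightarrow> ((\<lambda>k. \<integral>x. indicator E x * Im (g k x) \<partial>N) \<longlongrightarrow> (\<integral>x. indicator E x * b x \<partial>N)) U"
    using *[of "\<lambda>k x. Im (g k x)"] g re by auto
  have split: "(\<integral>x. indicator E x * c x \<partial>N) =
      complex_of_real (\<integral>x. indicator E x * Re (c x) \<partial>N) + \<i> * complex_of_real (\<integral>x. indicator E x * Im (c x) \<partial>N)"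
    if "E \<in> sets N" "integrable N c" for E and c :: "'a \<Rightarrow> complex"
  proof -
    have "integrable N (\<lambda>x. indicator E x *\<^sub>R c x)" using that by (rule integrable_mult_indicator)
    also have "?this \<longleftrightarrow> integrable N (\<lambda>x. indicator E x * c x)"
      by (intro Bochner_Integration.integrable_cong) (auto simp: indicator_def)
    finally have i: "integrable N (\<lambda>x. indicator E x * c x)" .
    have r: "Re (indicator E x * c x) = indicator E x * Re (c x)" "Im (indicator E x * c x) = indicator E x * Im (c x)" for x
      by (auto simp: indicator_def)
    show ?thesis
      using integral_Re[OF i] integral_Im[OF i] unfolding r by (simp add: complex_eq_iff)
  qed
  have gi: "integrable N (g k)" for k using g g1 by (intro integrable_const_bound[where B=1]) auto
  have ci: "integrable N (\<lambda>x. Complex (a x) (b x))"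
    unfolding Complex_eq
    using a(1) b(1) by (intro Bochner_Integration.integrable_add integrable_mult_right integrable_of_real)
  have "((\<lambda>k. \<integral>x. indicator E x * g k x \<partial>N) \<longlongrightarrow> (\<integral>x. indicator E x * Complex (a x) (b x) \<partial>N)) U" if E: "E \<in> sets N" for E
    unfolding split[OF E gi] split[OF E ci] complex.sel
    using a(2)[OF E] b(2)[OF E] by (auto intro!: tendsto_intros)
  then show ?thesis using ci by blast
qed

text \<open>The limit clause interchanges a limit along \<open>U\<close> with one in
  \<open>i\<close>. This is possible because replacing \<open>f\<close> by \<open>F i\<close> costs
  at most their distance in the mean, uniformly in \<open>k\<close>, as \<open>g k\<close> is
  bounded by 1.\<close>

lemma weak_limit_bounded:
  fixes g :: "nat \<Rightarrow> 'a \<Rightarrow> complex"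
  assumes N: "finite_measure N" and g: "\<And>k. g k \<in> borel_measurable N"
    and g1: "\<And>k x. x \<in> space N \<Longrightarrow> norm (g k x) \<le> 1" and c: "integrable N c"
    and lim: "\<And>E. E \<in> sets N \<Longrightarrow> ((\<lambda>k. \<integral>x. indicator E x * g k x \<partial>N) \<longlongrightarrow> (\<integral>x. indicator E x * c x \<partial>N)) U"
    and h: "bounded_measurable N h"
  shows "((\<lambda>k. \<integral>x. h x * g k x \<partial>N) \<longlongrightarrow> (\<integral>x. h x * c x \<partial>N)) U"
proof -
  interpret finite_measure N by fact
  have gb: "bounded_measurable N (g k)" for k by (rule bounded_measurableI[OF g g1])
  have ig: "integrable N (\<lambda>x. f x * g k x)" if "bounded_measurable N f" for f k
    by (intro integrable_bounded_measurable[OF N refl] bounded_measurable_mult gb that)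
  have ic: "integrable N (\<lambda>x. f x * c x)" if f: "bounded_measurable N f" for f
  proof -
    obtain B where B: "\<And>x. x \<in> space N \<Longrightarrow> norm (f x) \<le> B"
      using f by (auto simp: bounded_measurable_def)
    show ?thesis
    proof (rule Bochner_Integration.integrable_bound[of N "\<lambda>x. B * norm (c x)"])
      show "AE x in N. norm (f x * c x) \<le> norm (B * norm (c x))"
      proof (rule AE_I2)
        fix x assume "x \<in> space N"
        then have "norm (f x) * norm (c x) \<le> B * norm (c x)" by (intro mult_right_mono B) auto
        then show "norm (f x * c x) \<le> norm (B * norm (c x))" by (simp add: norm_mult)
      qed
    qed (use c f in \<open>auto dest!: bounded_measurable_measurable\<close>)
  qed
  show ?thesis
    using h
  proof (induction rule: bounded_measurable_induct)
    case (indicator E)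
    then show ?case by (rule lim)
  next
    case (add f f')
    then show ?case
      using tendsto_add[OF add.IH] by (simp add: distrib_right ig ic)
  next
    case (scale b f)
    then show ?case
      using tendsto_mult_left[OF scale.IH, of b] by (simp add: mult.assoc)
  next
    case (lim F f B)
    have f: "bounded_measurable N f" by (rule bounded_measurable_lim[OF lim.hyps])
    have [measurable]: "f \<in> borel_measurable N" "F i \<in> borel_measurable N" "c \<in> borel_measurable N" for i
      using f lim.hyps(1) c by (auto intro: bounded_measurable_measurable)
    have fB: "norm (f x) \<le> B" if "x \<in> space N" for x
      using LIMSEQ_le_const2[OF tendsto_norm[OF lim.hyps(3)[OF that]]] lim.hyps(2)[OF that] by blast
    have 1: "(\<lambda>i. \<integral>x. norm (f x - F i x) \<partial>N) \<longlonglongrightarrow> (\<integral>x. 0 \<partial>N)"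
    proof (rule integral_dominated_convergence[where w="\<lambda>_. 2 * B"])
      show "AE x in N. (\<lambda>i. norm (f x - F i x)) \<longlonglongrightarrow> 0"
        using lim.hyps(3) by (auto intro!: AE_I2 tendsto_eq_intros)
      show "AE x in N. norm (norm (f x - F i x)) \<le> 2 * B" for i
      proof (rule AE_I2)
        fix x assume x: "x \<in> space N"
        show "norm (norm (f x - F i x)) \<le> 2 * B"
          using norm_triangle_ineq4[of "f x" "F i x"] fB[OF x] lim.hyps(2)[OF x, of i] by simp
      qed
    qed simp_all
    \<comment> \<open>At this stage \<open>c\<close> is known to be integrable but not bounded, so
      the dominating function is a multiple of \<open>norm (c x)\<close>.\<close>
    have 2: "(\<lambda>i. \<integral>x. F i x * c x \<partial>N) \<longlonglongrightarrow> (\<integral>x. f x * c x \<partial>N)"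
    proof (rule integral_dominated_convergence[where w="\<lambda>x. B * norm (c x)"])
      show "AE x in N. norm (F i x * c x) \<le> B * norm (c x)" for i
        using lim.hyps(2) by (auto intro!: AE_I2 mult_right_mono simp: norm_mult)
    qed (use c lim.hyps(3) in \<open>auto intro!: AE_I2 tendsto_intros\<close>)
    have 3: "norm ((\<integral>x. f x * g k x \<partial>N) - (\<integral>x. F i x * g k x \<partial>N)) \<le> (\<integral>x. norm (f x - F i x) \<partial>N)" for i k
    proof -
      have "(\<integral>x. f x * g k x \<partial>N) - (\<integral>x. F i x * g k x \<partial>N) = (\<integral>x. (f x - F i x) * g k x \<partial>N)"
        using ig[OF f] ig[OF lim.hyps(1)] by (simp add: left_diff_distrib)
      also have "norm \<dots> \<le> (\<integral>x. norm ((f x - F i x) * g k x) \<partial>N)" by (rule integral_norm_bound)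
      also have "\<dots> \<le> (\<integral>x. norm (f x - F i x) \<partial>N)"
      proof (rule integral_mono)
        show "integrable N (\<lambda>x. norm ((f x - F i x) * g k x))"
          using ig[OF f] ig[OF lim.hyps(1)] by (auto simp: left_diff_distrib intro!: integrable_norm)
        show "integrable N (\<lambda>x. norm (f x - F i x))"
          using integrable_bounded_measurable[OF N refl] f lim.hyps(1) by (auto intro!: integrable_norm)
        show "norm ((f x - F i x) * g k x) \<le> norm (f x - F i x)" if "x \<in> space N" for x
          using mult_left_mono[OF g1[OF that, of k], of "norm (f x - F i x)"] by (simp add: norm_mult)
      qed
      finally show ?thesis .
    qed
    show ?case
    proof (rule tendstoI)
      fix e :: real assume e: "e > 0"
      have "\<forall>\<^sub>F i in sequentially. (\<integral>x. norm (f x - F i x) \<partial>N) < e / 3"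
        using order_tendstoD(2)[OF 1, of "e / 3"] e by simp
      moreover have "\<forall>\<^sub>F i in sequentially. dist (\<integral>x. F i x * c x \<partial>N) (\<integral>x. f x * c x \<partial>N) < e / 3"
        using tendstoD[OF 2, of "e / 3"] e by simp
      ultimately have "\<forall>\<^sub>F i in sequentially. (\<integral>x. norm (f x - F i x) \<partial>N) < e / 3 \<and>
          dist (\<integral>x. F i x * c x \<partial>N) (\<integral>x. f x * c x \<partial>N) < e / 3" by (rule eventually_conj)
      then obtain i where i: "(\<integral>x. norm (f x - F i x) \<partial>N) < e / 3"
        "dist (\<integral>x. F i x * c x \<partial>N) (\<integral>x. f x * c x \<partial>N) < e / 3"
        using eventually_happens'[OF sequentially_bot] by blast
      have "\<forall>\<^sub>F k in U. dist (\<integral>x. F i x * g k x \<partial>N) (\<integral>x. F i x * c x \<partial>N) < e / 3"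
        using tendstoD[OF lim.IH, of "e / 3"] e by simp
      then show "\<forall>\<^sub>F k in U. dist (\<integral>x. f x * g k x \<partial>N) (\<integral>x. f x * c x \<partial>N) < e"
      proof eventually_elim
        case (elim k)
        have "dist (\<integral>x. f x * g k x \<partial>N) (\<integral>x. F i x * g k x \<partial>N) < e / 3"
          using 3[of k i] i(1) by (simp add: dist_norm)
        then show ?case
          using dist_triangle_third[OF _ elim i(2)] by simp
      qed
    qed
  qed
qed

text \<open>What is new is the bound on the limit. Without it
  \<open>1 - \<bar>\<chi>\<bar>\<^sup>2\<close> could leave the unit interval and its powers would
  not converge.\<close>

lemma weak_limit:
  fixes g :: "nat \<Rightarrow> 'a \<Rightarrow> complex"
  assumes N: "finite_measure N" and g: "\<And>k. g k \<in> borel_measurable N"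
    and g1: "\<And>k x. x \<in> space N \<Longrightarrow> norm (g k x) \<le> 1"
  shows "\<exists>c\<in>borel_measurable N. (\<forall>x. norm (c x) \<le> 1) \<and>
    (\<forall>h. bounded_measurable N h \<longrightarrow> ((\<lambda>k. \<integral>x. h x * g k x \<partial>N) \<longlongrightarrow> (\<integral>x. h x * c x \<partial>N)) U)"
proof -
  interpret finite_measure N by fact
  obtain c where c: "integrable N c"
    "\<And>E. E \<in> sets N \<Longrightarrow> ((\<lambda>k. \<integral>x. indicator E x * g k x \<partial>N) \<longlongrightarrow> (\<integral>x. indicator E x * c x \<partial>N)) U"
    using weak_limit_indicator[of N g, OF N g g1] by auto
  have lim: "((\<lambda>k. \<integral>x. h x * g k x \<partial>N) \<longlongrightarrow> (\<integral>x. h x * c x \<partial>N)) U"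
    if "bounded_measurable N h" for h
    by (rule weak_limit_bounded[OF N g g1 c(1) c(2) that])
  have cm [measurable]: "c \<in> borel_measurable N" using c(1) by simp
  define E where "E = {x \<in> space N. 1 < norm (c x)}"
  have E: "E \<in> sets N" unfolding E_def by measurable
  \<comment> \<open>Tested against this \<open>h\<close>, the limit gives the integral of
    \<open>norm (c x)\<close> over \<open>E\<close>, while each \<open>g k\<close> gives at most the
    measure of \<open>E\<close>. As \<open>norm (c x) > 1\<close> on \<open>E\<close>, this set is
    null.\<close>
  define h where "h x = indicator E x * cnj (sgn (c x))" for x
  have h1: "norm (h x) \<le> indicator E x" for x
    by (auto simp: h_def indicator_def norm_sgn)
  have sgn_eq: "sgn (c x) = c x / complex_of_real (norm (c x))" for x
    by (simp add: sgn_div_norm scaleR_conv_of_real divide_inverse mult.commute)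
  have "(\<lambda>x. sgn (c x)) \<in> borel_measurable N"
    unfolding sgn_eq by measurable
  then have "bounded_measurable N (\<lambda>x. sgn (c x))"
    by (rule bounded_measurableI[where B=1]) (simp add: norm_sgn)
  then have h: "bounded_measurable N h"
    unfolding h_def[abs_def]
    by (intro bounded_measurable_mult bounded_measurable_cnj bounded_measurable_indicator E)
  have hc: "h x * c x = complex_of_real (indicator E x * norm (c x))" for x
  proof -
    have "c x * cnj (c x) = complex_of_real (norm (c x)) ^ 2"
      using complex_norm_square[of "c x"] by simp
    then have "c x * cnj (sgn (c x)) = complex_of_real (norm (c x))"
      unfolding sgn_eq by (cases "c x = 0") (simp_all add: power2_eq_square)
    then show ?thesis by (simp add: h_def indicator_def mult.commute)
  qed
  have "norm (\<integral>x. h x * c x \<partial>N) \<le> measure N E"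
  proof (rule norm_tendsto_le[OF lim[OF h] proper])
    fix k
    have "norm (\<integral>x. h x * g k x \<partial>N) \<le> (\<integral>x. norm (h x * g k x) \<partial>N)" by (rule integral_norm_bound)
    also have "\<dots> \<le> (\<integral>x. indicator E x \<partial>N)"
    proof (rule integral_mono)
      show "integrable N (\<lambda>x. norm (h x * g k x))"
        by (intro integrable_norm integrable_bounded_measurable[OF N refl] bounded_measurable_mult h bounded_measurableI[OF g g1])
      show "integrable N (\<lambda>x. indicator E x :: real)" using E by (simp add: integrable_real_indicator less_top[symmetric])
      show "norm (h x * g k x) \<le> indicator E x" if "x \<in> space N" for x
        using mult_mono[OF h1[of x] g1[OF that, of k]] by (simp add: norm_mult)
    qed
    finally show "norm (\<integral>x. h x * g k x \<partial>N) \<le> measure N E" using E sets.sets_into_space[OF E] by (simp add: Int_absorb2)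
  qed
  then have le: "(\<integral>x. indicator E x * norm (c x) \<partial>N) \<le> measure N E"
    unfolding hc integral_complex_of_real by simp
  have i1: "integrable N (\<lambda>x. indicator E x * norm (c x))"
    using integrable_real_mult_indicator[OF E integrable_norm[OF c(1)]] by (simp add: mult.commute)
  have i2: "integrable N (\<lambda>x. indicator E x :: real)" using E by (simp add: integrable_real_indicator less_top[symmetric])
  have i3: "integrable N (\<lambda>x. indicator E x * norm (c x) - indicator E x)" using i1 i2 by simp
  have nn: "AE x in N. 0 \<le> indicator E x * norm (c x) - indicator E x"
    by (rule AE_I2) (auto simp: E_def indicator_def)
  have "(\<integral>x. indicator E x * norm (c x) - indicator E x \<partial>N) \<le> 0"
    using le i1 i2 E sets.sets_into_space[OF E] by (simp add: Int_absorb2)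
  then have "(\<integral>x. indicator E x * norm (c x) - indicator E x \<partial>N) = 0"
    using integral_nonneg_AE[OF nn] by linarith
  then have "AE x in N. indicator E x * norm (c x) - indicator E x = 0"
    using integral_nonneg_eq_0_iff_AE[OF i3 nn] by blast
  then have c1: "AE x in N. norm (c x) \<le> 1"
    by (rule AE_mp) (rule AE_I2, auto simp: E_def indicator_def split: if_splits)
  \<comment> \<open>Changing \<open>c\<close> on a null set turns the almost sure bound into a bound
    everywhere.\<close>
  define d where "d x = (if norm (c x) \<le> 1 then c x else 0)" for x
  have dm: "d \<in> borel_measurable N" unfolding d_def[abs_def] by measurable
  have "(\<integral>x. f x * c x \<partial>N) = (\<integral>x. f x * d x \<partial>N)" if f: "bounded_measurable N f" for f
    using c1 dm bounded_measurable_measurable[OF f] by (intro integral_cong_AE) (auto simp: d_def)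
  then show ?thesis
    using lim dm by (intro bexI[of _ d]) (auto simp: d_def)
qed

end

section \<open>Shift limits of Fourier-Stieltjes transforms\<close>

definition fs_coeff :: "complex measure \<Rightarrow> (complex \<Rightarrow> complex) \<Rightarrow> int \<Rightarrow> complex" where
  "fs_coeff N h n = (\<integral>z. z powi n * h z \<partial>N)"

text \<open>The positive measure \<open>N\<close> is kept fixed while the density \<open>h\<close>
  varies: a shift limit changes only \<open>h\<close>. Sums are included because the Jordan parts of
  a complex measure are different measures.\<close>

inductive fs_transform :: "(int \<Rightarrow> complex) \<Rightarrow> bool" where
  coeff: "finite_measure N \<Longrightarrow> sets N = sets circle_borel \<Longrightarrow> bounded_measurable circle_borel h \<Longrightarrow>
    fs_transform (fs_coeff N h)"
| add: "fs_transform F \<Longrightarrow> fs_transform G \<Longrightarrow> fs_transform (\<lambda>n. F n + G n)"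

text \<open>The four Jordan parts enter with the constant densities \<open>1\<close>,
  \<open>-1\<close>, \<open>\<i>\<close> and \<open>-\<i>\<close>.\<close>

lemma fs_transform_fourier:
  assumes "\<mu> \<in> circle_measures" shows "fs_transform (fourier \<mu>)"
proof -
  let ?J = "jordan_pos circle_borel"
  have re: "vector_measure circle_borel (\<lambda>E. Re (\<mu> E))" and im: "vector_measure circle_borel (\<lambda>E. Im (\<mu> E))"
    using vector_measure_bounded_linear[OF circle_measures_vector[OF assms]] bounded_linear_Re bounded_linear_Im by auto
  have c: "fs_transform (fs_coeff (?J \<sigma>) (\<lambda>_. c))" if "vector_measure circle_borel \<sigma>" for \<sigma> c
    by (intro fs_transform.coeff finite_measure_jordan_pos that) simp_all
  have eq: "fourier \<mu> = (\<lambda>n. (fs_coeff (?J (\<lambda>E. Re (\<mu> E))) (\<lambda>_. 1) n + fs_coeff (?J (\<lambda>E. - Re (\<mu> E))) (\<lambda>_. -1) n)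
     + (fs_coeff (?J (\<lambda>E. Im (\<mu> E))) (\<lambda>_. \<i>) n + fs_coeff (?J (\<lambda>E. - Im (\<mu> E))) (\<lambda>_. -\<i>) n))"
    by (simp add: fun_eq_iff fourier_def cmeasure_integral_def signed_integral_def fs_coeff_def algebra_simps)
  show ?thesis
    unfolding eq by (intro fs_transform.add c re im vector_measure_uminus)
qed

definition bounded_fun :: "(int \<Rightarrow> complex) \<Rightarrow> bool" where
  "bounded_fun F \<longleftrightarrow> (\<exists>B. \<forall>n. norm (F n) \<le> B)"

lemma bounded_funI: "(\<And>n. norm (F n) \<le> B) \<Longrightarrow> bounded_fun F"
  by (auto simp: bounded_fun_def)

lemma bounded_fun_add: "bounded_fun F \<Longrightarrow> bounded_fun G \<Longrightarrow> bounded_fun (\<lambda>n. F n + G n)"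
  unfolding bounded_fun_def by (meson norm_triangle_mono)

lemma bounded_fun_mult:
  assumes "bounded_fun F" "bounded_fun G" shows "bounded_fun (\<lambda>n. F n * G n)"
proof -
  obtain B C where BC: "\<And>n. norm (F n) \<le> B" "\<And>n. norm (G n) \<le> C"
    using assms by (auto simp: bounded_fun_def)
  have "norm (F n * G n) \<le> B * C" for n
    unfolding norm_mult using BC(1)[of n] by (intro mult_mono BC) (auto intro: order_trans[OF norm_ge_zero])
  then show ?thesis by (rule bounded_funI)
qed

lemma bounded_fun_const: "bounded_fun (\<lambda>n. c)"
  by (rule bounded_funI[where B="norm c"]) simp

lemma bounded_fun_fs_coeff:
  assumes N: "finite_measure N" "sets N = sets circle_borel" and h: "bounded_measurable circle_borel h"
  shows "bounded_fun (fs_coeff N h)"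
proof (rule bounded_funI)
  fix n
  have "norm (fs_coeff N h n) \<le> (\<integral>z. norm (z powi n * h z) \<partial>N)"
    unfolding fs_coeff_def by (rule integral_norm_bound)
  also have "\<dots> = (\<integral>z. norm (h z) \<partial>N)"
    using sets_eq_imp_space_eq[OF N(2)]
    by (intro Bochner_Integration.integral_cong) (auto simp: norm_mult norm_powi_circle)
  finally show "norm (fs_coeff N h n) \<le> (\<integral>z. norm (h z) \<partial>N)" .
qed

lemma bounded_fun_fs_transform: "fs_transform F \<Longrightarrow> bounded_fun F"
  by (induction rule: fs_transform.induct) (auto intro: bounded_fun_fs_coeff bounded_fun_add)

context ultrafilter
begin

definition shift_lim :: "(nat \<Rightarrow> int) \<Rightarrow> (int \<Rightarrow> complex) \<Rightarrow> int \<Rightarrow> complex" where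
  "shift_lim s F n = Lim U (\<lambda>k. F (n + s k))"

lemma shift_lim_tendsto:
  assumes "bounded_fun F" shows "((\<lambda>k. F (n + s k)) \<longlongrightarrow> shift_lim s F n) U"
proof -
  obtain B where "\<And>n. norm (F n) \<le> B" using assms by (auto simp: bounded_fun_def)
  then show ?thesis
    unfolding shift_lim_def by (intro Lim_bounded boundedI[where B=B]) auto
qed

lemma shift_lim_eqI:
  "((\<lambda>k. F (n + s k)) \<longlongrightarrow> l) U \<Longrightarrow> shift_lim s F n = l"
  unfolding shift_lim_def by (rule tendsto_Lim[OF proper])

lemma bounded_fun_shift_lim:
  assumes "bounded_fun F" shows "bounded_fun (shift_lim s F)"
proof -
  obtain B where B: "\<And>n. norm (F n) \<le> B" using assms by (auto simp: bounded_fun_def)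
  show ?thesis
    by (rule bounded_funI, rule norm_tendsto_le[OF shift_lim_tendsto[OF assms] proper]) (rule B)
qed

lemma shift_lim_add:
  assumes "bounded_fun F" "bounded_fun G"
  shows "shift_lim s (\<lambda>n. F n + G n) = (\<lambda>n. shift_lim s F n + shift_lim s G n)"
  by (rule ext, rule shift_lim_eqI, intro tendsto_add shift_lim_tendsto assms)

lemma shift_lim_mult:
  assumes "bounded_fun F" "bounded_fun G"
  shows "shift_lim s (\<lambda>n. F n * G n) = (\<lambda>n. shift_lim s F n * shift_lim s G n)"
  by (rule ext, rule shift_lim_eqI, intro tendsto_mult shift_lim_tendsto assms)

lemma shift_lim_const: "shift_lim s (\<lambda>n. c) = (\<lambda>n. c)"
  by (rule ext, rule shift_lim_eqI) simp

text \<open>The two limits are taken one after the other, with independent indices. The first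
  multiplies the density by \<open>\<chi>\<close>, the second by its conjugate, so together by
  \<open>\<bar>\<chi>\<bar>\<^sup>2\<close>.\<close>

definition symm_shift_lim :: "(nat \<Rightarrow> int) \<Rightarrow> (int \<Rightarrow> complex) \<Rightarrow> int \<Rightarrow> complex" where
  "symm_shift_lim s F = shift_lim (\<lambda>k. - s k) (shift_lim s F)"

text \<open>
  If \<open>F\<close> is the transform of \<open>\<mu>\<close> and \<open>\<chi>\<close> is the weak limit of \<open>z\<^bsup>s k\<^esup>\<close> in \<open>L\<^sup>1(|\<mu>|)\<close>, then the \<open>i\<close>-th moment
  is \<open>\<integral> \<bar>\<chi>\<bar>\<^bsup>2 i\<^esup> d\<mu>\<close>; the definition avoids \<open>\<chi>\<close>, which makes linearity and multiplicativity immediate.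
\<close>

definition moment :: "(nat \<Rightarrow> int) \<Rightarrow> (int \<Rightarrow> complex) \<Rightarrow> nat \<Rightarrow> complex" where
  "moment s F i = (symm_shift_lim s ^^ i) F 0"

lemma bounded_fun_iter: "bounded_fun F \<Longrightarrow> bounded_fun ((symm_shift_lim s ^^ i) F)"
  by (induction i) (auto simp: symm_shift_lim_def bounded_fun_shift_lim)

lemma iter_add:
  assumes "bounded_fun F" "bounded_fun G"
  shows "(symm_shift_lim s ^^ i) (\<lambda>n. F n + G n) = (\<lambda>n. (symm_shift_lim s ^^ i) F n + (symm_shift_lim s ^^ i) G n)"
  using assms
  by (induction i) (simp_all add: symm_shift_lim_def shift_lim_add bounded_fun_shift_lim bounded_fun_iter)

lemma iter_mult:
  assumes "bounded_fun F" "bounded_fun G"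
  shows "(symm_shift_lim s ^^ i) (\<lambda>n. F n * G n) = (\<lambda>n. (symm_shift_lim s ^^ i) F n * (symm_shift_lim s ^^ i) G n)"
  using assms
  by (induction i) (simp_all add: symm_shift_lim_def shift_lim_mult bounded_fun_shift_lim bounded_fun_iter)

lemma iter_const: "(symm_shift_lim s ^^ i) (\<lambda>n. c) = (\<lambda>n. c)"
  by (induction i) (simp_all add: symm_shift_lim_def shift_lim_const)

lemma moment_add: "bounded_fun F \<Longrightarrow> bounded_fun G \<Longrightarrow> moment s (\<lambda>n. F n + G n) i = moment s F i + moment s G i"
  by (simp add: moment_def iter_add)

text \<open>This is the multiplicativity of \<open>\<bar>\<chi>\<bar>\<^sup>2\<close> under
  convolution, in integrated form: at every stage a limit of products is the product of the
  limits.\<close>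

lemma moment_mult: "bounded_fun F \<Longrightarrow> bounded_fun G \<Longrightarrow> moment s (\<lambda>n. F n * G n) i = moment s F i * moment s G i"
  by (simp add: moment_def iter_mult)

lemma moment_scale: "bounded_fun F \<Longrightarrow> moment s (\<lambda>n. c * F n) i = c * moment s F i"
  using moment_mult[OF bounded_fun_const, of F s c i] by (simp add: moment_def iter_const)

text \<open>Here \<open>t\<close> is the squared modulus of the weak limit of the powers
  \<open>z powi s k\<close> with respect to \<open>N\<close>. It is chosen before \<open>h\<close>
  and \<open>i\<close>, so that all moments and densities share it.\<close>

lemma moment_fs_coeff:
  assumes N: "finite_measure N" "sets N = sets circle_borel"
  shows "\<exists>t\<in>borel_measurable circle_borel. (\<forall>z. 0 \<le> t z \<and> t z \<le> (1::real)) \<and>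
    (\<forall>h i. bounded_measurable circle_borel h \<longrightarrow>
       moment s (fs_coeff N h) i = (\<integral>z. h z * complex_of_real (t z) ^ i \<partial>N))"
proof -
  have bmN: "bounded_measurable N f \<longleftrightarrow> bounded_measurable circle_borel f" for f
    unfolding bounded_measurable_def
    using measurable_cong_sets[OF N(2) refl, of "borel :: complex measure"] sets_eq_imp_space_eq[OF N(2)] by simp
  have sp: "space N = circle" using sets_eq_imp_space_eq[OF N(2)] by simp
  have pN: "(\<lambda>z. z powi m) \<in> borel_measurable N" for m
    using measurable_cong_sets[OF N(2) refl, of "borel :: complex measure"] by simp
  obtain c where c: "c \<in> borel_measurable N" "\<And>x. norm (c x) \<le> 1"
    "\<And>h. bounded_measurable N h \<Longrightarrow> ((\<lambda>k. \<integral>x. h x * x powi s k \<partial>N) \<longlongrightarrow> (\<integral>x. h x * c x \<partial>N)) U"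
    using weak_limit[OF N(1), of "\<lambda>k z. z powi s k"] pN by (auto simp: sp norm_powi_circle)
  have bc: "bounded_measurable circle_borel c"
    using c unfolding bmN[symmetric] by (auto intro: bounded_measurableI)
  have plus: "shift_lim s (fs_coeff N h) = fs_coeff N (\<lambda>z. h z * c z)" if h: "bounded_measurable circle_borel h" for h
  proof (rule ext, rule shift_lim_eqI)
    fix n
    have b: "bounded_measurable N (\<lambda>z. z powi n * h z)"
      unfolding bmN by (intro bounded_measurable_mult bounded_measurable_powi h)
    have "fs_coeff N h (n + s k) = (\<integral>z. (z powi n * h z) * z powi s k \<partial>N)" for k
      unfolding fs_coeff_def
      by (intro Bochner_Integration.integral_cong) (auto simp: sp power_int_add circle_nonzero)
    then show "((\<lambda>k. fs_coeff N h (n + s k)) \<longlongrightarrow> fs_coeff N (\<lambda>z. h z * c z) n) U"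
      using c(3)[OF b] by (simp add: fs_coeff_def mult.assoc)
  qed
  \<comment> \<open>On the circle \<open>z powi (- s k)\<close> is the conjugate of
    \<open>z powi s k\<close>. Conjugating the integral reduces this case to the weak limit
    \<open>c\<close> already chosen.\<close>
  have minus: "shift_lim (\<lambda>k. - s k) (fs_coeff N h) = fs_coeff N (\<lambda>z. h z * cnj (c z))" if h: "bounded_measurable circle_borel h" for h
  proof (rule ext, rule shift_lim_eqI)
    fix n
    have b: "bounded_measurable N (\<lambda>z. cnj (z powi n * h z))"
      unfolding bmN by (intro bounded_measurable_cnj bounded_measurable_mult bounded_measurable_powi h)
    have "fs_coeff N h (n + - s k) = cnj (\<integral>z. cnj (z powi n * h z) * z powi s k \<partial>N)" for k
      unfolding fs_coeff_def Bochner_Integration.integral_cnj[symmetric]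
    proof (intro Bochner_Integration.integral_cong refl)
      fix z assume "z \<in> space N"
      then have z: "z \<in> circle" by (simp add: sp)
      have "z * cnj z = 1" using complex_norm_square[of z] z by (simp add: circle_def)
      then have "cnj z = inverse z" by (metis inverse_unique)
      then have cp: "cnj (z powi s k) = z powi (- s k)"
        by (simp add: power_int_minus power_int_inverse)
      have "z powi (n + - s k) = z powi n * z powi (- s k)"
        by (rule power_int_add) (simp add: circle_nonzero[OF z])
      then show "z powi (n + - s k) * h z = cnj (cnj (z powi n * h z) * z powi s k)"
        by (simp only: complex_cnj_mult complex_cnj_cnj cp mult_ac)
    qed
    moreover have "fs_coeff N (\<lambda>z. h z * cnj (c z)) n = cnj (\<integral>z. cnj (z powi n * h z) * c z \<partial>N)"
      unfolding fs_coeff_def Bochner_Integration.integral_cnj[symmetric] by (simp add: mult.assoc)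
    ultimately show "((\<lambda>k. fs_coeff N h (n + - s k)) \<longlongrightarrow> fs_coeff N (\<lambda>z. h z * cnj (c z)) n) U"
      using tendsto_cnj[OF c(3)[OF b]] by simp
  qed
  define t where "t z = (norm (c z))\<^sup>2" for z
  have tc: "complex_of_real (t z) = c z * cnj (c z)" for z
    unfolding t_def by (rule complex_norm_square)
  have bt: "bounded_measurable circle_borel (\<lambda>z. complex_of_real (t z))"
    unfolding tc by (intro bounded_measurable_mult bounded_measurable_cnj bc)
  have iter: "(symm_shift_lim s ^^ i) (fs_coeff N h) = fs_coeff N (\<lambda>z. h z * complex_of_real (t z) ^ i)"
    if h: "bounded_measurable circle_borel h" for h i
  proof (induction i)
    case (Suc i)
    have b: "bounded_measurable circle_borel (\<lambda>z. h z * complex_of_real (t z) ^ i)"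
      by (intro bounded_measurable_mult bounded_measurable_power h bt)
    show ?case
      unfolding funpow.simps o_apply Suc.IH
      unfolding symm_shift_lim_def plus[OF b] minus[OF bounded_measurable_mult[OF b bc]]
      by (simp add: tc mult_ac power_mult_distrib)
  qed simp
  have tm: "t \<in> borel_measurable circle_borel"
    unfolding t_def using bounded_measurable_measurable[OF bc] by measurable
  have "0 \<le> t z \<and> t z \<le> 1" for z
    using power_le_one[OF norm_ge_zero c(2)[of z], of 2] by (simp add: t_def)
  then show ?thesis
    using tm iter by (intro bexI[of _ t]) (auto simp: moment_def fs_coeff_def)
qed

section \<open>The character carried by the alive part\<close>

text \<open>
  For the transform of \<open>\<mu>\<close> this is \<open>\<integral> (1 - \<bar>\<chi>\<bar>\<^sup>2)\<^sup>j d\<mu>\<close>, which tends to the mass of \<open>\<mu>\<close> on \<open>{\<chi> = 0}\<close>.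
\<close>

definition dead_part :: "(nat \<Rightarrow> int) \<Rightarrow> (int \<Rightarrow> complex) \<Rightarrow> nat \<Rightarrow> complex" where
  "dead_part s F j = (\<Sum>i\<le>j. of_nat (j choose i) * (-1) ^ i * moment s F i)"

lemma dead_part_add:
  "bounded_fun F \<Longrightarrow> bounded_fun G \<Longrightarrow> dead_part s (\<lambda>n. F n + G n) j = dead_part s F j + dead_part s G j"
  by (simp add: dead_part_def moment_add distrib_left sum.distrib)

lemma dead_part_scale: "bounded_fun F \<Longrightarrow> dead_part s (\<lambda>n. c * F n) j = c * dead_part s F j"
  by (simp add: dead_part_def moment_scale sum_distrib_left mult_ac)

lemma alternating_binomial:
  fixes x :: complex
  shows "(\<Sum>i\<le>j. of_nat (j choose i) * (-1) ^ i * x ^ i) = (1 - x) ^ j"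
proof -
  have "(1 - x) ^ j = ((- x) + 1) ^ j" by simp
  also have "\<dots> = (\<Sum>i\<le>j. of_nat (j choose i) * (- x) ^ i * 1 ^ (j - i))" by (rule binomial_ring)
  also have "\<dots> = (\<Sum>i\<le>j. of_nat (j choose i) * (-1) ^ i * x ^ i)"
    by (intro sum.cong refl) (simp add: power_minus[of x] mult.assoc)
  finally show ?thesis by simp
qed

lemma one_minus_of_real: "1 - complex_of_real t = complex_of_real (1 - t)"
  by simp

lemma one_minus_power_tendsto:
  fixes t :: real
  assumes "0 \<le> t" "t \<le> 1"
  shows "(\<lambda>j. (1 - complex_of_real t) ^ j) \<longlonglongrightarrow> of_bool (t = 0)"
proof (cases "t = 0")
  case False
  then have "norm (1 - complex_of_real t) < 1"
    unfolding one_minus_of_real norm_of_real using assms by simp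
  then show ?thesis using False by (simp add: LIMSEQ_power_zero)
qed simp

lemma norm_one_minus_le:
  fixes t :: real
  assumes "0 \<le> t" "t \<le> 1"
  shows "norm ((1 - complex_of_real t) ^ j) \<le> 1"
  unfolding norm_power one_minus_of_real norm_of_real using assms by (intro power_le_one) simp_all

lemma integral_one_minus_power_tendsto:
  assumes N: "finite_measure N" "sets N = sets circle_borel" and h: "bounded_measurable circle_borel h"
    and t: "t \<in> borel_measurable circle_borel" "\<And>z. 0 \<le> t z \<and> t z \<le> (1::real)"
  shows "(\<lambda>j. \<integral>z. h z * (1 - complex_of_real (t z)) ^ j \<partial>N) \<longlonglongrightarrow> (\<integral>z. h z * of_bool (t z = 0) \<partial>N)"
proof -
  obtain B where B: "\<And>z. z \<in> circle \<Longrightarrow> norm (h z) \<le> B"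
    using h by (auto simp: bounded_measurable_def)
  have bt: "bounded_measurable circle_borel (\<lambda>z. (1 - complex_of_real (t z)) ^ j)" for j
    by (rule bounded_measurableI[where B=1]) (use t in \<open>auto intro!: norm_one_minus_le\<close>)
  show ?thesis
  proof (rule integral_bounded_lim[OF N, where B=B])
    show "bounded_measurable circle_borel (\<lambda>z. h z * (1 - complex_of_real (t z)) ^ j)" for j
      by (intro bounded_measurable_mult h bt)
    fix z assume "z \<in> space circle_borel"
    then have "norm (h z) \<le> B" by (simp add: B)
    then show "norm (h z * (1 - complex_of_real (t z)) ^ j) \<le> B" for j
      using mult_mono[OF _ norm_one_minus_le, of "norm (h z)" B "t z" j] t(2)[of z] norm_ge_zero[of "h z"]
      by (simp add: norm_mult)
    show "(\<lambda>j. h z * (1 - complex_of_real (t z)) ^ j) \<longlonglongrightarrow> h z * of_bool (t z = 0)"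
      using t(2)[of z] by (intro tendsto_mult tendsto_const one_minus_power_tendsto) auto
  qed
qed

text \<open>
  The limit reflects that \<open>t u = 0\<close> iff \<open>t = 0\<close> or \<open>u = 0\<close>: with respect to a product measure, the mass
  of this union is found by inclusion and exclusion.
\<close>

lemma dead_part_coeff_mult:
  assumes N: "finite_measure N" "sets N = sets circle_borel" and h: "bounded_measurable circle_borel h"
    and M: "finite_measure M" "sets M = sets circle_borel" and g: "bounded_measurable circle_borel g"
  defines "F \<equiv> fs_coeff N h" and "G \<equiv> fs_coeff M g"
  shows "\<exists>a b. dead_part s F \<longlonglongrightarrow> a \<and> dead_part s G \<longlonglongrightarrow> b \<and>
    dead_part s (\<lambda>n. F n * G n) \<longlonglongrightarrow> G 0 * a + F 0 * b - a * b"
proof -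
  obtain t where t: "t \<in> borel_measurable circle_borel" "\<And>z. 0 \<le> t z \<and> t z \<le> (1::real)"
    "\<And>h i. bounded_measurable circle_borel h \<Longrightarrow> moment s (fs_coeff N h) i = (\<integral>z. h z * complex_of_real (t z) ^ i \<partial>N)"
    using moment_fs_coeff[OF N, of s] by blast
  obtain u where u: "u \<in> borel_measurable circle_borel" "\<And>z. 0 \<le> u z \<and> u z \<le> (1::real)"
    "\<And>h i. bounded_measurable circle_borel h \<Longrightarrow> moment s (fs_coeff M h) i = (\<integral>z. h z * complex_of_real (u z) ^ i \<partial>M)"
    using moment_fs_coeff[OF M, of s] by blast
  have bN: "bounded_measurable circle_borel (\<lambda>z. complex_of_real (t z))"
    and bM: "bounded_measurable circle_borel (\<lambda>z. complex_of_real (u z))"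
    using t(1,2) u(1,2) by (auto intro!: bounded_measurableI[where B=1])
  \<comment> \<open>The parameter \<open>x\<close> is 1 for a single transform; for the product it
    will be the value of \<open>t\<close> at a fixed point.\<close>
  have dead: "(\<Sum>i\<le>j. of_nat (j choose i) * (-1) ^ i * (x ^ i * (\<integral>z. k z * complex_of_real (v z) ^ i \<partial>L)))
      = (\<integral>z. k z * (1 - x * complex_of_real (v z)) ^ j \<partial>L)"
    if L: "finite_measure L" "sets L = sets circle_borel" and k: "bounded_measurable circle_borel k"
      and v: "bounded_measurable circle_borel (\<lambda>z. complex_of_real (v z))" for L k v j and x :: complex
  proof -
    have i: "integrable L (\<lambda>z. k z * complex_of_real (v z) ^ i)" for i
      by (intro integrable_bounded_measurable[OF L] bounded_measurable_mult bounded_measurable_power k v)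
    have "(\<Sum>i\<le>j. of_nat (j choose i) * (-1) ^ i * (x ^ i * (\<integral>z. k z * complex_of_real (v z) ^ i \<partial>L)))
      = (\<Sum>i\<le>j. \<integral>z. (of_nat (j choose i) * (-1) ^ i * x ^ i) * (k z * complex_of_real (v z) ^ i) \<partial>L)"
      by (simp add: mult.assoc)
    also have "\<dots> = (\<integral>z. (\<Sum>i\<le>j. (of_nat (j choose i) * (-1) ^ i * x ^ i) * (k z * complex_of_real (v z) ^ i)) \<partial>L)"
      by (intro Bochner_Integration.integral_sum[symmetric] integrable_mult_right i)
    also have "\<dots> = (\<integral>z. k z * (1 - x * complex_of_real (v z)) ^ j \<partial>L)"
      unfolding alternating_binomial[symmetric] sum_distrib_left
      by (simp add: power_mult_distrib mult_ac)
    finally show ?thesis .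
  qed
  have dF: "dead_part s F j = (\<integral>z. h z * (1 - complex_of_real (t z)) ^ j \<partial>N)" for j
    using dead[OF N h bN, of j 1] by (simp add: dead_part_def F_def t(3)[OF h])
  have dG: "dead_part s G j = (\<integral>z. g z * (1 - complex_of_real (u z)) ^ j \<partial>M)" for j
    using dead[OF M g bM, of j 1] by (simp add: dead_part_def G_def u(3)[OF g])
  define a where "a = (\<integral>z. h z * of_bool (t z = 0) \<partial>N)"
  define b where "b = (\<integral>z. g z * of_bool (u z = 0) \<partial>M)"
  have a: "dead_part s F \<longlonglongrightarrow> a"
    unfolding dF[abs_def] a_def by (rule integral_one_minus_power_tendsto[OF N h t(1,2)])
  have b: "dead_part s G \<longlonglongrightarrow> b"
    unfolding dG[abs_def] b_def by (rule integral_one_minus_power_tendsto[OF M g u(1,2)])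
  have F0: "F 0 = (\<integral>z. h z \<partial>N)" and G0: "G 0 = (\<integral>z. g z \<partial>M)"
    by (simp_all add: F_def G_def fs_coeff_def)
  \<comment> \<open>The inner integral over the second measure at a fixed point of the first. Only a
    finite sum over \<open>i\<close> is ever exchanged with an integral, so the product measure
    stays implicit.\<close>
  define w where "w j z = (\<integral>y. g y * (1 - complex_of_real (t z) * complex_of_real (u y)) ^ j \<partial>M)" for j z
  have dFG: "dead_part s (\<lambda>n. F n * G n) j = (\<integral>z. h z * w j z \<partial>N)" for j
  proof -
    have bd: "bounded_fun F" "bounded_fun G"
      unfolding F_def G_def by (intro bounded_fun_fs_coeff N h M g)+
    have i: "integrable N (\<lambda>z. h z * complex_of_real (t z) ^ i)" for i
      by (intro integrable_bounded_measurable[OF N] bounded_measurable_mult bounded_measurable_power h bN)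
    have "dead_part s (\<lambda>n. F n * G n) j =
      (\<Sum>i\<le>j. (of_nat (j choose i) * (-1) ^ i * (\<integral>y. g y * complex_of_real (u y) ^ i \<partial>M)) * (\<integral>z. h z * complex_of_real (t z) ^ i \<partial>N))"
      unfolding dead_part_def moment_mult[OF bd]
      unfolding F_def G_def t(3)[OF h] u(3)[OF g] by (simp add: mult_ac)
    also have "\<dots> = (\<integral>z. (\<Sum>i\<le>j. (of_nat (j choose i) * (-1) ^ i * (\<integral>y. g y * complex_of_real (u y) ^ i \<partial>M)) * (h z * complex_of_real (t z) ^ i)) \<partial>N)"
      by (simp add: i)
    also have "\<dots> = (\<integral>z. h z * w j z \<partial>N)"
      unfolding w_def dead[OF M g bM, symmetric] sum_distrib_left by (simp add: mult_ac)
    finally show ?thesis .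
  qed
  obtain B where B: "\<And>z. z \<in> circle \<Longrightarrow> norm (g z) \<le> B"
    using g by (auto simp: bounded_measurable_def)
  obtain C where C: "\<And>z. z \<in> circle \<Longrightarrow> norm (h z) \<le> C"
    using h by (auto simp: bounded_measurable_def)
  have C0: "0 \<le> C" using order_trans[OF norm_ge_zero C[of 1]] by (simp add: circle_def)
  have tu: "0 \<le> t z * u y \<and> t z * u y \<le> 1" for z y
    using t(2)[of z] u(2)[of y] by (simp add: mult_le_one)
  define K where "K = (\<integral>y. norm (g y) \<partial>M)"
  have gi: "integrable M g" by (rule integrable_bounded_measurable[OF M g])
  have gbi: "integrable M (\<lambda>y. g y * (1 - complex_of_real (t z) * complex_of_real (u y)) ^ j)" for j z
  proof -
    have "bounded_measurable circle_borel (\<lambda>y. 1 + - complex_of_real (t z) * complex_of_real (u y))"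
      by (intro bounded_measurable_add bounded_measurable_mult bounded_measurable_const bM)
    then show ?thesis
      by (intro integrable_bounded_measurable[OF M] bounded_measurable_mult bounded_measurable_power g) simp
  qed
  have w_le: "norm (w j z) \<le> K" for j z
  proof -
    have "norm (w j z) \<le> (\<integral>y. norm (g y * (1 - complex_of_real (t z) * complex_of_real (u y)) ^ j) \<partial>M)"
      unfolding w_def by (rule integral_norm_bound)
    also have "\<dots> \<le> K"
      unfolding K_def
    proof (intro integral_mono integrable_norm gi gbi)
      fix y
      have "norm (g y) * norm ((1 - complex_of_real (t z * u y)) ^ j) \<le> norm (g y) * 1"
        using tu[of z y] by (intro mult_left_mono norm_one_minus_le) auto
      then show "norm (g y * (1 - complex_of_real (t z) * complex_of_real (u y)) ^ j) \<le> norm (g y)"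
        by (simp add: norm_mult)
    qed
    finally show ?thesis .
  qed
  \<comment> \<open>If \<open>t z = 0\<close> the integrand of \<open>w\<close> is \<open>g\<close>
    for all \<open>j\<close>, with integral \<open>G 0\<close>; otherwise
    \<open>t z * u y = 0\<close> just when \<open>u y = 0\<close>, which leaves
    \<open>b\<close>.\<close>
  have wl: "(\<lambda>j. w j z) \<longlonglongrightarrow> (if t z = 0 then G 0 else b)" for z
  proof -
    have "(\<lambda>j. \<integral>y. g y * (1 - complex_of_real (t z * u y)) ^ j \<partial>M) \<longlonglongrightarrow> (\<integral>y. g y * of_bool (t z * u y = 0) \<partial>M)"
      by (rule integral_one_minus_power_tendsto[OF M g]) (use u(1) tu in auto)
    then show ?thesis by (auto simp: w_def G0 b_def)
  qed
  have "(\<lambda>j. \<integral>z. h z * w j z \<partial>N) \<longlonglongrightarrow> (\<integral>z. h z * (if t z = 0 then G 0 else b) \<partial>N)"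
  proof (rule integral_bounded_lim[OF N, where B="C * K"])
    have "bounded_measurable circle_borel (w j)" for j
      unfolding w_def[abs_def] dead[OF M g bM, symmetric]
      by (intro bounded_measurable_sum bounded_measurable_mult bounded_measurable_power bounded_measurable_const bN)
    then show "bounded_measurable circle_borel (\<lambda>z. h z * w j z)" for j
      by (intro bounded_measurable_mult h)
    fix z assume "z \<in> space circle_borel"
    then show "norm (h z * w j z) \<le> C * K" for j
      unfolding norm_mult using C0 by (intro mult_mono C w_le) auto
    show "(\<lambda>j. h z * w j z) \<longlonglongrightarrow> h z * (if t z = 0 then G 0 else b)"
      by (intro tendsto_mult tendsto_const wl)
  qed
  also have "(\<integral>z. h z * (if t z = 0 then G 0 else b) \<partial>N) = (\<integral>z. b * h z + (G 0 - b) * (h z * of_bool (t z = 0)) \<partial>N)"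
    by (intro Bochner_Integration.integral_cong) (auto simp: algebra_simps)
  also have "\<dots> = b * F 0 + (G 0 - b) * a"
  proof -
    \<comment> \<open>The indicator of \<open>{t = 0}\<close> is the bounded pointwise limit of the
      powers of \<open>1 - t\<close>.\<close>
    have "bounded_measurable circle_borel (\<lambda>z. of_bool (t z = 0))"
    proof (rule bounded_measurable_lim[where F="\<lambda>j z. (1 - complex_of_real (t z)) ^ j" and B=1])
      show "bounded_measurable circle_borel (\<lambda>z. (1 - complex_of_real (t z)) ^ j)" for j
        by (rule bounded_measurableI[where B=1]) (use t(1,2) in \<open>auto intro!: norm_one_minus_le\<close>)
      show "norm ((1 - complex_of_real (t z)) ^ j) \<le> 1" for j z
        by (rule norm_one_minus_le) (use t(2) in auto)
      show "(\<lambda>j. (1 - complex_of_real (t z)) ^ j) \<longlonglongrightarrow> of_bool (t z = 0)" for z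
        by (rule one_minus_power_tendsto) (use t(2) in auto)
    qed
    then have "integrable N (\<lambda>z. h z * of_bool (t z = 0))"
      by (intro integrable_bounded_measurable[OF N] bounded_measurable_mult h)
    then show ?thesis
      unfolding F0 a_def using integrable_bounded_measurable[OF N h] by simp
  qed
  finally have "dead_part s (\<lambda>n. F n * G n) \<longlonglongrightarrow> G 0 * a + F 0 * b - a * b"
    unfolding dFG[abs_def] by (simp add: algebra_simps)
  then show ?thesis using a b by blast
qed

text \<open>The limit formula is bilinear in the pairs \<open>(F, a)\<close> and
  \<open>(G, b)\<close>, so it extends to sums in either factor. Convergence is part of the
  conclusion: uniqueness of limits then identifies the two values that the summands give for the
  common factor.\<close>

lemma dead_part_mult:
  assumes "fs_transform F" "fs_transform G"
  shows "\<exists>a b. dead_part s F \<longlonglongrightarrow> a \<and> dead_part s G \<longlonglongrightarrow> b \<and>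
    dead_part s (\<lambda>n. F n * G n) \<longlonglongrightarrow> G 0 * a + F 0 * b - a * b"
  using assms
proof (induction F)
  case (coeff N h)
  note N = coeff(1-3) and bF = bounded_fun_fs_coeff[OF coeff(1-3)]
  from coeff(4) show ?case
  proof (induction G)
    case (coeff M g)
    then show ?case by (intro dead_part_coeff_mult N)
  next
    case (add G G')
    let ?F = "fs_coeff N h"
    note bG = bounded_fun_fs_transform[OF add.hyps(1)] bounded_fun_fs_transform[OF add.hyps(2)]
    obtain a b a' b' where *: "dead_part s ?F \<longlonglongrightarrow> a" "dead_part s G \<longlonglongrightarrow> b"
      "dead_part s (\<lambda>n. ?F n * G n) \<longlonglongrightarrow> G 0 * a + ?F 0 * b - a * b"
      "dead_part s ?F \<longlonglongrightarrow> a'" "dead_part s G' \<longlonglongrightarrow> b'"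
      "dead_part s (\<lambda>n. ?F n * G' n) \<longlonglongrightarrow> G' 0 * a' + ?F 0 * b' - a' * b'"
      using add.IH by blast
    have [simp]: "a' = a" using *(1,4) LIMSEQ_unique by blast
    have "dead_part s (\<lambda>n. G n + G' n) = (\<lambda>j. dead_part s G j + dead_part s G' j)"
      by (simp add: fun_eq_iff dead_part_add bG)
    then have 1: "dead_part s (\<lambda>n. G n + G' n) \<longlonglongrightarrow> b + b'"
      using tendsto_add[OF *(2,5)] by simp
    have "dead_part s (\<lambda>n. ?F n * (G n + G' n)) = (\<lambda>j. dead_part s (\<lambda>n. ?F n * G n) j + dead_part s (\<lambda>n. ?F n * G' n) j)"
      by (simp add: fun_eq_iff distrib_left dead_part_add bounded_fun_mult bF bG)
    then have "dead_part s (\<lambda>n. ?F n * (G n + G' n)) \<longlonglongrightarrow> (G 0 + G' 0) * a + ?F 0 * (b + b') - a * (b + b')"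
      using tendsto_add[OF *(3,6)] by (simp add: algebra_simps)
    then show ?case using *(1) 1 by blast
  qed
next
  case (add F F')
  note bF = bounded_fun_fs_transform[OF add.hyps(1)] bounded_fun_fs_transform[OF add.hyps(2)]
    and bG = bounded_fun_fs_transform[OF add.prems]
  obtain a b a' b' where *: "dead_part s F \<longlonglongrightarrow> a" "dead_part s G \<longlonglongrightarrow> b"
    "dead_part s (\<lambda>n. F n * G n) \<longlonglongrightarrow> G 0 * a + F 0 * b - a * b"
    "dead_part s F' \<longlonglongrightarrow> a'" "dead_part s G \<longlonglongrightarrow> b'"
    "dead_part s (\<lambda>n. F' n * G n) \<longlonglongrightarrow> G 0 * a' + F' 0 * b' - a' * b'"
    using add.IH[OF add.prems] by blast
  have [simp]: "b' = b" using *(2,5) LIMSEQ_unique by blast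
  have "dead_part s (\<lambda>n. F n + F' n) = (\<lambda>j. dead_part s F j + dead_part s F' j)"
    by (simp add: fun_eq_iff dead_part_add bF)
  then have 1: "dead_part s (\<lambda>n. F n + F' n) \<longlonglongrightarrow> a + a'"
    using tendsto_add[OF *(1,4)] by simp
  have "dead_part s (\<lambda>n. (F n + F' n) * G n) = (\<lambda>j. dead_part s (\<lambda>n. F n * G n) j + dead_part s (\<lambda>n. F' n * G n) j)"
    by (simp add: fun_eq_iff distrib_right dead_part_add bounded_fun_mult bF bG)
  then have "dead_part s (\<lambda>n. (F n + F' n) * G n) \<longlonglongrightarrow> G 0 * (a + a') + (F 0 + F' 0) * b - (a + a') * b"
    using tendsto_add[OF *(3,6)] by (simp add: algebra_simps)
  then show ?case using *(2) 1 by blast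
qed

section \<open>The alive part is linear and multiplicative\<close>

definition alive_part :: "(nat \<Rightarrow> int) \<Rightarrow> (int \<Rightarrow> complex) \<Rightarrow> complex" where
  "alive_part s F = F 0 - lim (dead_part s F)"

lemma dead_part_convergent: "fs_transform F \<Longrightarrow> dead_part s F \<longlonglongrightarrow> lim (dead_part s F)"
  using dead_part_mult[of F F s] by (metis limI)

lemma alive_part_add:
  assumes "fs_transform F" "fs_transform G"
  shows "alive_part s (\<lambda>n. F n + G n) = alive_part s F + alive_part s G"
proof -
  have "dead_part s (\<lambda>n. F n + G n) = (\<lambda>j. dead_part s F j + dead_part s G j)"
    by (simp add: fun_eq_iff dead_part_add bounded_fun_fs_transform assms)
  then have "dead_part s (\<lambda>n. F n + G n) \<longlonglongrightarrow> lim (dead_part s F) + lim (dead_part s G)"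
    using tendsto_add[OF dead_part_convergent[OF assms(1), of s] dead_part_convergent[OF assms(2), of s]] by simp
  from limI[OF this] show ?thesis by (simp add: alive_part_def)
qed

lemma alive_part_scale:
  assumes "fs_transform F"
  shows "alive_part s (\<lambda>n. c * F n) = c * alive_part s F"
proof -
  have "dead_part s (\<lambda>n. c * F n) = (\<lambda>j. c * dead_part s F j)"
    by (simp add: fun_eq_iff dead_part_scale bounded_fun_fs_transform assms)
  then have "dead_part s (\<lambda>n. c * F n) \<longlonglongrightarrow> c * lim (dead_part s F)"
    using tendsto_mult_left[OF dead_part_convergent[OF assms, of s], of c] by simp
  from limI[OF this] show ?thesis by (simp add: alive_part_def algebra_simps)
qed

text \<open>With the dead masses \<open>a\<close> and \<open>b\<close>, subtracting
  \<open>G 0 * a + F 0 * b - a * b\<close> from \<open>F 0 * G 0\<close> leaves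
  \<open>(F 0 - a) * (G 0 - b)\<close>.\<close>

lemma alive_part_mult:
  assumes "fs_transform F" "fs_transform G"
  shows "alive_part s (\<lambda>n. F n * G n) = alive_part s F * alive_part s G"
proof -
  obtain a b where *: "dead_part s F \<longlonglongrightarrow> a" "dead_part s G \<longlonglongrightarrow> b"
    "dead_part s (\<lambda>n. F n * G n) \<longlonglongrightarrow> G 0 * a + F 0 * b - a * b"
    using dead_part_mult[OF assms] by blast
  show ?thesis unfolding alive_part_def *[THEN limI] by (simp add: algebra_simps)
qed

text \<open>The case where \<open>\<chi>\<close> is the constant \<open>r\<close>: the moments are
  geometric. It is applied with \<open>r = 1/2\<close> to a Riesz product and with
  \<open>r = 0\<close> to the Haar measure.\<close>

lemma dead_part_eigen:
  assumes F: "bounded_fun F"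
    and "\<And>n. ((\<lambda>k. F (n + s k)) \<longlongrightarrow> r * F n) U" "\<And>n. ((\<lambda>k. F (n - s k)) \<longlongrightarrow> r * F n) U"
  shows "dead_part s F j = (1 - r * r) ^ j * F 0"
proof -
  have "shift_lim s F = (\<lambda>n. r * F n)" by (rule ext, rule shift_lim_eqI, rule assms)
  moreover have "shift_lim (\<lambda>k. - s k) (\<lambda>n. r * F n) = (\<lambda>n. r * (r * F n))"
    by (rule ext, rule shift_lim_eqI, rule tendsto_mult_left) (use assms(3) in simp)
  ultimately have T: "symm_shift_lim s F = (\<lambda>n. r * r * F n)" by (simp add: symm_shift_lim_def mult.assoc)
  have scale: "symm_shift_lim s (\<lambda>n. c * F n) = (\<lambda>n. c * symm_shift_lim s F n)" for c
    using iter_mult[OF bounded_fun_const[of c] F, where i=1 and s=s] iter_const[where i=1 and s=s and c=c] by simp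
  have "(symm_shift_lim s ^^ i) F = (\<lambda>n. (r * r) ^ i * F n)" for i
  proof (induction i)
    case (Suc i)
    show ?case unfolding funpow.simps o_apply Suc scale T by (simp add: mult_ac)
  qed simp
  then have "dead_part s F j = (\<Sum>i\<le>j. of_nat (j choose i) * (-1) ^ i * (r * r) ^ i) * F 0"
    by (simp add: dead_part_def moment_def sum_distrib_right mult.assoc)
  then show ?thesis by (simp only: alternating_binomial)
qed

end

section \<open>Riesz products\<close>

text \<open>
  The product of \<open>w k\<close> over the positions \<open>k\<close> of the nonzero digits of \<open>n\<close> in balanced ternary; the
  lowest digit of \<open>n\<close> is \<open>(n + 1) mod 3 - 1\<close>.
\<close>

function riesz_coeff :: "(nat \<Rightarrow> real) \<Rightarrow> int \<Rightarrow> real" where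
  "riesz_coeff w n = (if n = 0 then 1 else
     (if (n + 1) mod 3 = 1 then 1 else w 0) * riesz_coeff (\<lambda>k. w (Suc k)) ((n + 1) div 3))"
  by auto
termination
  by (relation "Wellfounded.measure (\<lambda>(w, n). nat \<bar>n\<bar>)") auto

declare riesz_coeff.simps [simp del]

lemma riesz_coeff_zero [simp]: "riesz_coeff w 0 = 1"
  by (simp add: riesz_coeff.simps)

lemma riesz_coeff_ternary:
  "riesz_coeff w (3 * m) = riesz_coeff (\<lambda>k. w (Suc k)) m"
  "riesz_coeff w (3 * m + 1) = w 0 * riesz_coeff (\<lambda>k. w (Suc k)) m"
  "riesz_coeff w (3 * m - 1) = w 0 * riesz_coeff (\<lambda>k. w (Suc k)) m"
proof -
  have d: "(3 * m + 1) div 3 = m" "(3 * m + 1) mod 3 = 1" "(3 * m + 2) div 3 = m" "(3 * m + 2) mod 3 = 2" by presburger+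
  show "riesz_coeff w (3 * m) = riesz_coeff (\<lambda>k. w (Suc k)) m"
    using d by (simp add: riesz_coeff.simps[of w])
  have "3 * m + 1 \<noteq> 0" "3 * m - 1 \<noteq> 0" by presburger+
  then show "riesz_coeff w (3 * m + 1) = w 0 * riesz_coeff (\<lambda>k. w (Suc k)) m"
    "riesz_coeff w (3 * m - 1) = w 0 * riesz_coeff (\<lambda>k. w (Suc k)) m"
    using d by (simp_all add: riesz_coeff.simps[of w] algebra_simps)
qed

lemma ternary_cases:
  fixes n :: int
  obtains m where "n = 3 * m" | m where "n = 3 * m + 1" | m where "n = 3 * m - 1"
proof -
  have "n = 3 * (n div 3) \<or> n = 3 * (n div 3) + 1 \<or> n = 3 * (n div 3 + 1) - 1" by presburger
  then show ?thesis using that by blast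
qed

text \<open>Both factors run over the same digit positions. For convolutions this means that the
  weights multiply, so they survive only on the common positions of two index sets.\<close>

lemma riesz_coeff_mult: "riesz_coeff w n * riesz_coeff v n = riesz_coeff (\<lambda>k. w k * v k) n"
proof (induction w n arbitrary: v rule: riesz_coeff.induct)
  case (1 w n)
  then show ?case
    by (cases "n = 0") (simp_all add: riesz_coeff.simps[of _ n] mult_ac)
qed

text \<open>A nonzero integer has a nonzero digit, which contributes a factor at most 1/2; the
  remaining factors are at most 1.\<close>

lemma riesz_coeff_bounds:
  assumes "\<And>k. 0 \<le> w k \<and> w k \<le> 1 / 2"
  shows "0 \<le> riesz_coeff w n \<and> riesz_coeff w n \<le> 1 \<and> (n \<noteq> 0 \<longrightarrow> riesz_coeff w n \<le> 1 / 2)"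
  using assms
proof (induction w n rule: riesz_coeff.induct)
  case (1 w n)
  let ?r = "riesz_coeff (\<lambda>k. w (Suc k)) ((n + 1) div 3)"
  show ?case
  proof (cases "n = 0")
    case False
    have IH: "0 \<le> ?r" "?r \<le> 1" "(n + 1) div 3 \<noteq> 0 \<Longrightarrow> ?r \<le> 1 / 2"
      using 1(1)[OF False 1(2)] by auto
    show ?thesis
    proof (cases "(n + 1) mod 3 = 1")
      case True
      \<comment> \<open>With lowest digit 0, the nonzero digit must sit in the quotient, and the
        bound 1/2 is inherited.\<close>
      then have "(n + 1) div 3 \<noteq> 0" using False by presburger
      then show ?thesis using IH True False by (simp add: riesz_coeff.simps[of w n])
    next
      case F: False
      have "w 0 * ?r \<le> 1 / 2 * 1" using IH 1(2)[of 0] by (intro mult_mono) auto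
      then show ?thesis using IH F False 1(2)[of 0] by (simp add: riesz_coeff.simps[of w n])
    qed
  qed simp
qed

text \<open>This is \<open>(3 ^ k - 1) / 2\<close>, the largest integer with \<open>k\<close> digits
  in balanced ternary.\<close>

fun ternary_radius :: "nat \<Rightarrow> int" where
  "ternary_radius 0 = 0"
| "ternary_radius (Suc k) = 3 * ternary_radius k + 1"

lemma ternary_radius_nonneg: "0 \<le> ternary_radius k"
  by (induction k) auto

lemma ternary_radius_ge: "int k \<le> ternary_radius k"
  by (induction k) auto

text \<open>Such an \<open>n\<close> has only the digits below position \<open>k\<close>; adding or
  subtracting \<open>3 ^ k\<close> places a nonzero digit at \<open>k\<close> and leaves the others
  alone. For fixed \<open>n\<close> this applies to all large \<open>k\<close>.\<close>

lemma riesz_coeff_shift: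
  assumes "\<bar>n\<bar> \<le> ternary_radius k"
  shows "riesz_coeff w (n + 3 ^ k) = w k * riesz_coeff w n"
    and "riesz_coeff w (n - 3 ^ k) = w k * riesz_coeff w n"
proof -
  have "riesz_coeff w (n + 3 ^ k) = w k * riesz_coeff w n \<and> riesz_coeff w (n - 3 ^ k) = w k * riesz_coeff w n"
    using assms
  proof (induction k arbitrary: n w)
    case 0
    then show ?case
      using riesz_coeff_ternary(2,3)[of w 0] by simp
  next
    case (Suc k)
    have s: "3 * m + 3 * 3 ^ k = 3 * (m + 3 ^ k)" "3 * m + 1 + 3 * 3 ^ k = 3 * (m + 3 ^ k) + 1"
      "3 * m - 1 + 3 * 3 ^ k = 3 * (m + 3 ^ k) - 1" "3 * m - 3 * 3 ^ k = 3 * (m - 3 ^ k)"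
      "3 * m + 1 - 3 * 3 ^ k = 3 * (m - 3 ^ k) + 1" "3 * m - 1 - 3 * 3 ^ k = 3 * (m - 3 ^ k) - 1" for m :: int
      by simp_all
    show ?case
    proof (cases n rule: ternary_cases)
      case (1 m)
      then have "\<bar>m\<bar> \<le> ternary_radius k" using Suc.prems by simp
      from Suc.IH[OF this, of "\<lambda>k. w (Suc k)"] show ?thesis
        unfolding 1 power_Suc s riesz_coeff_ternary by simp
    next
      case (2 m)
      then have "\<bar>m\<bar> \<le> ternary_radius k" using Suc.prems by simp
      from Suc.IH[OF this, of "\<lambda>k. w (Suc k)"] show ?thesis
        unfolding 2 power_Suc s riesz_coeff_ternary by simp
    next
      case (3 m)
      then have "\<bar>m\<bar> \<le> ternary_radius k" using Suc.prems by simp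
      from Suc.IH[OF this, of "\<lambda>k. w (Suc k)"] show ?thesis
        unfolding 3 power_Suc s riesz_coeff_ternary by simp
    qed
  qed
  then show "riesz_coeff w (n + 3 ^ k) = w k * riesz_coeff w n"
    "riesz_coeff w (n - 3 ^ k) = w k * riesz_coeff w n" by auto
qed

text \<open>Negation flips the sign of every digit and keeps the positions of the nonzero
  ones.\<close>

lemma riesz_coeff_minus: "riesz_coeff w (- n) = riesz_coeff w n"
proof (induction "nat \<bar>n\<bar>" arbitrary: n w rule: less_induct)
  case less
  show ?case
  proof (cases "n = 0")
    case False
    show ?thesis
    proof (cases n rule: ternary_cases)
      case (1 m)
      then have "- n = 3 * (- m)" "nat \<bar>m\<bar> < nat \<bar>n\<bar>" using False by auto
      with less[OF this(2)] show ?thesis unfolding 1 by (simp only: riesz_coeff_ternary)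
    next
      case (2 m)
      then have "- n = 3 * (- m) - 1" "nat \<bar>m\<bar> < nat \<bar>n\<bar>" using False by auto
      with less[OF this(2)] show ?thesis unfolding 2 by (simp only: riesz_coeff_ternary)
    next
      case (3 m)
      then have "- n = 3 * (- m) + 1" "nat \<bar>m\<bar> < nat \<bar>n\<bar>" using False by auto
      with less[OF this(2)] show ?thesis unfolding 3 by (simp only: riesz_coeff_ternary)
    qed
  qed simp
qed

text \<open>A nonzero coefficient requires that all nonzero digits of \<open>n\<close> lie at
  positions below \<open>N\<close>.\<close>

lemma riesz_coeff_support:
  assumes "\<And>k. k \<ge> N \<Longrightarrow> w k = 0" "riesz_coeff w n \<noteq> 0"
  shows "\<bar>n\<bar> \<le> ternary_radius N"
  using assms
proof (induction N arbitrary: w n)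
  case 0
  have "riesz_coeff v n = 0" if "\<And>k. v k = 0" "n \<noteq> 0" for v
    using that
  proof (induction v n rule: riesz_coeff.induct)
    case (1 v n)
    show ?case
    proof (cases "(n + 1) mod 3 = 1")
      case True
      then have "(n + 1) div 3 \<noteq> 0" using 1(3) by presburger
      then have "riesz_coeff (\<lambda>k. v (Suc k)) ((n + 1) div 3) = 0"
        using 1 by blast
      then show ?thesis using 1(3) True by (subst riesz_coeff.simps) simp
    next
      case False
      then show ?thesis using 1(2,3) by (subst riesz_coeff.simps) simp
    qed
  qed
  then show ?case using 0 by fastforce
next
  case (Suc N)
  have z: "w (Suc k) = 0" if "k \<ge> N" for k using Suc.prems(1) that by simp
  show ?case
  proof (cases n rule: ternary_cases)
    case (1 m)
    have "riesz_coeff (\<lambda>k. w (Suc k)) m \<noteq> 0"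
      using Suc.prems(2) unfolding 1 riesz_coeff_ternary by simp
    from Suc.IH[of "\<lambda>k. w (Suc k)", OF z this] show ?thesis using 1 by simp
  next
    case (2 m)
    have "riesz_coeff (\<lambda>k. w (Suc k)) m \<noteq> 0"
      using Suc.prems(2) unfolding 2 riesz_coeff_ternary by simp
    from Suc.IH[of "\<lambda>k. w (Suc k)", OF z this] show ?thesis using 2 by simp
  next
    case (3 m)
    have "riesz_coeff (\<lambda>k. w (Suc k)) m \<noteq> 0"
      using Suc.prems(2) unfolding 3 riesz_coeff_ternary by simp
    from Suc.IH[of "\<lambda>k. w (Suc k)", OF z this] show ?thesis using 3 by simp
  qed
qed

text \<open>Integers are grouped by their lowest balanced ternary digit.\<close>

lemma sum_ternary:
  fixes f :: "int \<Rightarrow> complex"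
  assumes "0 \<le> K"
  shows "(\<Sum>n=-(3*K+1)..3*K+1. f n) = (\<Sum>m=-K..K. f (3*m) + f (3*m+1) + f (3*m-1))"
proof -
  have id: "3 * ((n + 1) div 3) + ((n + 1) mod 3 - 1) = n" for n :: int by presburger
  have "(\<Sum>n=-(3*K+1)..3*K+1. f n) = (\<Sum>(m, r)\<in>{-K..K} \<times> {0, 1, -1}. f (3 * m + r))"
  proof (rule sum.reindex_bij_witness[of _ "\<lambda>(m, r). 3 * m + r" "\<lambda>n. ((n + 1) div 3, (n + 1) mod 3 - 1)"])
    fix n assume "n \<in> {-(3*K+1)..3*K+1}"
    moreover have "(n + 1) mod 3 = 0 \<or> (n + 1) mod 3 = 1 \<or> (n + 1) mod 3 = 2" by presburger
    ultimately show "((n + 1) div 3, (n + 1) mod 3 - 1) \<in> {-K..K} \<times> {0, 1, -1}" by auto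
  qed (use assms in \<open>auto simp: id\<close>)
  also have "\<dots> = (\<Sum>m=-K..K. \<Sum>r\<in>{0, 1, -1}. f (3 * m + r))"
    by (rule sum.cartesian_product[symmetric])
  finally show ?thesis by (simp add: add.assoc)
qed

section \<open>Partial products and their weak limit\<close>

definition riesz_poly :: "(nat \<Rightarrow> real) \<Rightarrow> nat \<Rightarrow> complex \<Rightarrow> complex" where
  "riesz_poly w N z = (\<Prod>k<N. 1 + of_real (w k) * (z powi (3 ^ k) + z powi (- (3 ^ k))))"

text \<open>Induction from the lowest factor: the product of the remaining ones is a shorter product
  evaluated at \<open>z ^ 3\<close>, which matches the recursion of \<open>riesz_coeff\<close> on
  the lowest digit.\<close>

lemma riesz_poly_expand:
  assumes "z \<noteq> 0"
  shows "riesz_poly w N z = (\<Sum>n=-ternary_radius N..ternary_radius N. of_real (riesz_coeff w n) * z powi n)"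
  using assms
proof (induction N arbitrary: w z)
  case 0
  then show ?case by (simp add: riesz_poly_def)
next
  case (Suc N)
  let ?v = "\<lambda>k. w (Suc k)" and ?K = "ternary_radius N"
  have cube: "(z ^ 3) powi m = z powi (3 * m)" for m
    by (metis power_int_mult power_int_numeral)
  have "riesz_poly w (Suc N) z = (1 + of_real (w 0) * (z powi 1 + z powi (-1))) *
     (\<Prod>k<N. 1 + of_real (?v k) * (z powi (3 ^ Suc k) + z powi (- (3 ^ Suc k))))"
    unfolding riesz_poly_def by (subst prod.lessThan_Suc_shift) simp
  also have "(\<Prod>k<N. 1 + of_real (?v k) * (z powi (3 ^ Suc k) + z powi (- (3 ^ Suc k)))) = riesz_poly ?v N (z ^ 3)"
    unfolding riesz_poly_def cube by simp
  also have "\<dots> = (\<Sum>m=-?K..?K. of_real (riesz_coeff ?v m) * z powi (3 * m))"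
    using Suc.prems by (subst Suc.IH) (simp_all add: cube)
  also have "(1 + of_real (w 0) * (z powi 1 + z powi (-1))) * \<dots> =
     (\<Sum>m=-?K..?K. of_real (riesz_coeff w (3*m)) * z powi (3*m)
        + of_real (riesz_coeff w (3*m+1)) * z powi (3*m+1)
        + of_real (riesz_coeff w (3*m-1)) * z powi (3*m-1))"
    unfolding sum_distrib_left riesz_coeff_ternary
    using Suc.prems
    by (intro sum.cong refl)
      (simp add: power_int_add power_int_diff power_int_minus field_simps)
  also have "\<dots> = (\<Sum>n=-(3*?K+1)..3*?K+1. of_real (riesz_coeff w n) * z powi n)"
    by (rule sum_ternary[symmetric]) (rule ternary_radius_nonneg)
  finally show ?case by simp
qed

definition riesz_density :: "(nat \<Rightarrow> real) \<Rightarrow> nat \<Rightarrow> real \<Rightarrow> real" where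
  "riesz_density w N x = (\<Prod>k<N. 1 + 2 * w k * cos (3 ^ k * x))"

lemma riesz_density_eq: "complex_of_real (riesz_density w N x) = riesz_poly w N (cis x)"
  unfolding riesz_density_def riesz_poly_def of_real_prod
  by (intro prod.cong refl) (simp add: cis_power_int complex_eq_iff)

text \<open>The bound 1/2 on the weights is what keeps each factor nonnegative.\<close>

lemma riesz_density_nonneg:
  assumes "\<And>k. 0 \<le> w k \<and> w k \<le> 1 / 2"
  shows "0 \<le> riesz_density w N x"
  unfolding riesz_density_def
proof (intro prod_nonneg)
  fix k
  have "\<bar>2 * w k * cos (3 ^ k * x)\<bar> \<le> 1 * 1"
    unfolding abs_mult[of "2 * w k"] using assms[of k] by (intro mult_mono) auto
  then show "0 \<le> 1 + 2 * w k * cos (3 ^ k * x)" by linarith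
qed

lemma riesz_density_measurable [measurable]: "riesz_density w N \<in> borel_measurable borel"
  unfolding riesz_density_def by measurable

text \<open>Orthogonality selects the term \<open>m = -n\<close>, and the coefficients are even. The
  case distinction reflects that only \<open>N\<close> factors have been multiplied.\<close>

lemma integral_riesz_density:
  "(\<integral>x. riesz_density w N x *\<^sub>R cis (of_int n * x) \<partial>uniform_angle) =
     (if \<bar>n\<bar> \<le> ternary_radius N then of_real (riesz_coeff w n) else 0)"
proof -
  interpret prob_space uniform_angle by (rule prob_space_uniform_angle)
  have [measurable]: "(\<lambda>x. cis (of_int m * x)) \<in> borel_measurable borel" for m
    by (intro borel_measurable_continuous_onI continuous_intros)
  have i: "integrable uniform_angle (\<lambda>x. cis (of_int m * x))" for m
    by (rule integrable_const_bound[where B=1]) auto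
  have "(\<integral>x. riesz_density w N x *\<^sub>R cis (of_int n * x) \<partial>uniform_angle) =
    (\<integral>x. (\<Sum>m=-ternary_radius N..ternary_radius N. of_real (riesz_coeff w m) * cis (of_int (m + n) * x)) \<partial>uniform_angle)"
    unfolding scaleR_conv_of_real riesz_density_eq riesz_poly_expand[OF cis_neq_zero] sum_distrib_right
    by (intro Bochner_Integration.integral_cong sum.cong refl) (simp add: cis_power_int cis_mult algebra_simps)
  also have "\<dots> = (\<Sum>m=-ternary_radius N..ternary_radius N. of_real (riesz_coeff w m) * (if m + n = 0 then 1 else 0))"
    by (subst Bochner_Integration.integral_sum) (simp_all add: i integral_uniform_angle_cis del: of_int_add)
  also have "\<dots> = (\<Sum>m=-ternary_radius N..ternary_radius N. if m = - n then of_real (riesz_coeff w n) else 0)"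
    by (intro sum.cong refl) (auto simp: riesz_coeff_minus add_eq_0_iff2)
  also have "\<dots> = (if \<bar>n\<bar> \<le> ternary_radius N then of_real (riesz_coeff w n) else 0)"
    by (auto simp: abs_le_iff)
  finally show ?thesis .
qed

text \<open>The partial products are densities of probability measures on a fixed interval, so a
  subsequence converges weakly. At integers the characteristic functions are eventually constant,
  and the limit inherits their values. The line serves as a model of the angles so that Helly's and
  Levy's theorems apply.\<close>

lemma riesz_measure_exists:
  assumes w: "\<And>k. 0 \<le> w k \<and> w k \<le> 1 / 2"
  shows "\<exists>R. prob_space R \<and> sets R = sets circle_borel \<and> (\<forall>n. (\<integral>z. z powi n \<partial>R) = of_real (riesz_coeff w n))"
proof -
  define M where "M N = density uniform_angle (\<lambda>x. ennreal (riesz_density w N x))" for N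
  have [measurable]: "(\<lambda>x. cis (of_int m * x)) \<in> borel_measurable borel" for m
    by (intro borel_measurable_continuous_onI continuous_intros)
  have rm [measurable]: "riesz_density w N \<in> borel_measurable uniform_angle" for N
    by simp
  interpret U: prob_space uniform_angle by (rule prob_space_uniform_angle)
  have ri: "integrable uniform_angle (riesz_density w N)" for N
  proof (rule U.integrable_const_bound[where B="2 ^ N"])
    show "AE x in uniform_angle. norm (riesz_density w N x) \<le> 2 ^ N"
    proof (rule AE_I2)
      fix x
      have "norm (riesz_density w N x) \<le> (\<Prod>k<N. 2)"
        unfolding riesz_density_def prod_norm[symmetric]
      proof (intro prod_mono conjI norm_ge_zero)
        fix k
        have "\<bar>2 * w k * cos (3 ^ k * x)\<bar> \<le> 1 * 1"
          unfolding abs_mult[of "2 * w k"] using w[of k] by (intro mult_mono) auto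
        then show "norm (1 + 2 * w k * cos (3 ^ k * x)) \<le> 2" by simp
      qed
      then show "norm (riesz_density w N x) \<le> 2 ^ N" by simp
    qed
  qed simp
  have M_int: "(\<integral>x. cis (of_int n * x) \<partial>M N) = (if \<bar>n\<bar> \<le> ternary_radius N then of_real (riesz_coeff w n) else 0)" for n N
    unfolding M_def
    by (subst integral_density) (auto simp: riesz_density_nonneg[OF w] integral_riesz_density)
  have prob: "prob_space (M N)" for N
  proof
    have "complex_of_real (\<integral>x. riesz_density w N x \<partial>uniform_angle) = 1"
      using integral_riesz_density[of w N 0] ternary_radius_nonneg[of N]
      by (simp add: scaleR_conv_of_real)
    then have "(\<integral>x. riesz_density w N x \<partial>uniform_angle) = 1" by simp
    moreover have "emeasure (M N) (space (M N)) = ennreal (\<integral>x. riesz_density w N x \<partial>uniform_angle)"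
      unfolding M_def using ri riesz_density_nonneg[OF w]
      by (subst emeasure_density) (auto simp: nn_integral_eq_integral)
    ultimately show "emeasure (M N) (space (M N)) = 1" by simp
  qed
  have rd: "real_distribution (M N)" for N
    by (intro real_distribution.intro prob real_distribution_axioms.intro) (simp add: M_def)
  \<comment> \<open>All the measures live on \<open>{-pi..pi}\<close>; 4 exceeds \<open>pi\<close>,
    and the half-open shape is the one in the definition of \<open>tight\<close>.\<close>
  have "measure (M N) {-4<..4} = 1" for N
  proof -
    interpret real_distribution "M N" by (rule rd)
    have "AE x in uniform_angle. x \<in> {-4<..4}"
      unfolding uniform_angle_def using pi_less_4
      by (subst AE_density) (auto intro!: AE_I2 simp: indicator_def)
    then have "AE x in M N. x \<in> {-4<..4}"
      unfolding M_def by (subst AE_density) (auto elim: AE_mp)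
    then show ?thesis by (subst prob_eq_1) auto
  qed
  then have "tight M"
    unfolding tight_def using rd by (intro conjI allI impI exI[of _ "-4"] exI[of _ "4"]) auto
  then obtain r M' where r: "strict_mono (r :: nat \<Rightarrow> nat)" "real_distribution M'" "weak_conv_m (M \<circ> r) M'"
    using tight_imp_convergent_subsubsequence[of M "\<lambda>n. n"] by (auto simp: strict_mono_def o_def)
  interpret M': real_distribution M' by fact
  have char_eq: "char L (of_int n) = (\<integral>x. cis (of_int n * x) \<partial>L)" for L n
    by (simp add: char_def cis_conv_exp)
  have "char M' (of_int n) = of_real (riesz_coeff w n)" for n
  proof -
    have lim: "(\<lambda>k. char ((M \<circ> r) k) (of_int n)) \<longlonglongrightarrow> char M' (of_int n)"
      by (rule levy_continuity1) (use rd r in \<open>simp_all add: o_def\<close>)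
    \<comment> \<open>Once the radius exceeds \<open>\<bar>n\<bar>\<close>, further factors no
      longer change the coefficient at \<open>n\<close>.\<close>
    have "\<forall>\<^sub>F k in sequentially. char ((M \<circ> r) k) (of_int n) = of_real (riesz_coeff w n)"
    proof (rule eventually_sequentiallyI)
      fix k assume "nat \<bar>n\<bar> \<le> k"
      then have "\<bar>n\<bar> \<le> ternary_radius (r k)"
        using ternary_radius_ge[of "r k"] seq_suble[OF r(1), of k] by linarith
      then show "char ((M \<circ> r) k) (of_int n) = of_real (riesz_coeff w n)"
        by (simp add: char_eq M_int)
    qed
    from LIMSEQ_unique[OF lim tendsto_eventually[OF this]] show ?thesis .
  qed
  then have c: "(\<integral>x. cis (of_int n * x) \<partial>M') = of_real (riesz_coeff w n)" for n
    unfolding char_eq .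
  have cm: "cis \<in> M' \<rightarrow>\<^sub>M circle_borel" by simp
  show ?thesis
  proof (intro exI[of _ "distr M' circle_borel cis"] conjI allI)
    show "prob_space (distr M' circle_borel cis)" by (rule M'.prob_space_distr[OF cm])
    show "(\<integral>z. z powi n \<partial>distr M' circle_borel cis) = of_real (riesz_coeff w n)" for n
      by (subst integral_distr[OF cm]) (simp_all add: cis_power_int c)
  qed simp
qed

section \<open>Disjoint open sets in the Gelfand space\<close>

text \<open>The graph of \<open>n \<mapsto> \<lfloor>n x\<rfloor>\<close>, coded by naturals. The
  component \<open>n\<close> makes the set infinite and, when two such sets meet, forces the floors
  to agree at the same \<open>n\<close>.\<close>

definition floor_codes :: "real \<Rightarrow> nat set" where
  "floor_codes x = range (\<lambda>n::nat. to_nat (n, \<lfloor>real n * x\<rfloor>))"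

lemma infinite_floor_codes: "infinite (floor_codes x)"
  unfolding floor_codes_def by (rule range_inj_infinite) (auto simp: inj_on_def)

text \<open>Equal floors at \<open>n\<close> force \<open>n * \<bar>x - y\<bar> < 1\<close>, which
  bounds \<open>n\<close>.\<close>

lemma finite_floor_codes_Int:
  assumes "x \<noteq> y" shows "finite (floor_codes x \<inter> floor_codes y)"
proof -
  obtain N where N: "1 < real N * \<bar>x - y\<bar>"
    using reals_Archimedean3[of "\<bar>x - y\<bar>"] assms by auto
  have "floor_codes x \<inter> floor_codes y \<subseteq> (\<lambda>n. to_nat (n, \<lfloor>real n * x\<rfloor>)) ` {..<N}"
  proof
    fix c assume "c \<in> floor_codes x \<inter> floor_codes y"
    then obtain n where n: "c = to_nat (n, \<lfloor>real n * x\<rfloor>)" "\<lfloor>real n * x\<rfloor> = \<lfloor>real n * y\<rfloor>"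
      by (auto simp: floor_codes_def)
    then have "\<bar>real n * x - real n * y\<bar> < 1" by linarith
    then have "real n * \<bar>x - y\<bar> < 1" by (simp add: abs_mult flip: right_diff_distrib)
    have "n < N"
    proof (rule ccontr)
      assume "\<not> n < N"
      then have "real N * \<bar>x - y\<bar> \<le> real n * \<bar>x - y\<bar>" by (intro mult_right_mono) auto
      then show False using N \<open>real n * \<bar>x - y\<bar> < 1\<close> by linarith
    qed
    then show "c \<in> (\<lambda>n. to_nat (n, \<lfloor>real n * x\<rfloor>)) ` {..<N}"
      unfolding n(1) by (intro imageI) simp
  qed
  then show ?thesis by (rule finite_subset) simp
qed

section \<open>Riesz products on an index set and their convolutions\<close>

definition half_weights :: "nat set \<Rightarrow> nat \<Rightarrow> real" where
  "half_weights A k = (if k \<in> A then 1 / 2 else 0)"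

lemma half_weights_bounds: "0 \<le> half_weights A k \<and> half_weights A k \<le> 1 / 2"
  by (simp add: half_weights_def)

lemma riesz_fourier_exists:
  "\<exists>\<rho>\<in>circle_measures. \<forall>n. fourier \<rho> n = of_real (riesz_coeff (half_weights A) n)"
proof -
  obtain R where R: "prob_space R" "sets R = sets circle_borel"
    "\<And>n. (\<integral>z. z powi n \<partial>R) = of_real (riesz_coeff (half_weights A) n)"
    using riesz_measure_exists[of "half_weights A", OF half_weights_bounds] by blast
  have f: "finite_measure R" using R(1) by (rule prob_space.finite_measure)
  show ?thesis
    using density_measure_circle[OF f R(2) bounded_measurable_const[of _ 1]]
      fourier_density_measure[OF f R(2) bounded_measurable_const[of _ 1]] R(3) by auto
qed

text \<open>Uniquely determined by its transform, by \<open>fourier_inject\<close>.\<close>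

definition riesz_measure :: "nat set \<Rightarrow> complex set \<Rightarrow> complex" where
  "riesz_measure A = (SOME \<rho>. \<rho> \<in> circle_measures \<and> (\<forall>n. fourier \<rho> n = of_real (riesz_coeff (half_weights A) n)))"

lemma riesz_measure_circle: "riesz_measure A \<in> circle_measures"
  and fourier_riesz_measure: "fourier (riesz_measure A) n = of_real (riesz_coeff (half_weights A) n)"
  using someI_ex[OF riesz_fourier_exists[of A, unfolded Bex_def]] by (auto simp: riesz_measure_def)

lemma circle_measures_zero: "(\<lambda>E. 0) \<in> circle_measures"
  using circle_measures_scale[OF character_measure_circle, of 0] by simp

lemma circle_measures_sum:
  "(\<And>i. i \<in> I \<Longrightarrow> \<mu> i \<in> circle_measures) \<Longrightarrow> (\<lambda>E. \<Sum>i\<in>I. \<mu> i E) \<in> circle_measures"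
  by (induction I rule: infinite_finite_induct) (auto intro: circle_measures_zero circle_measures_add)

lemma fourier_sum:
  "(\<And>i. i \<in> I \<Longrightarrow> \<mu> i \<in> circle_measures) \<Longrightarrow> fourier (\<lambda>E. \<Sum>i\<in>I. \<mu> i E) n = (\<Sum>i\<in>I. fourier (\<mu> i) n)"
proof (induction I rule: infinite_finite_induct)
  case (insert i I)
  then show ?case by (simp add: fourier_add circle_measures_sum)
qed (use fourier_scale[OF character_measure_circle, of 0] in simp_all)

text \<open>On the transform side, multiplying by the indicator of \<open>{n}\<close> keeps the
  single value at \<open>n\<close>.\<close>

lemma character_measure_convolution:
  assumes "\<mu> \<in> circle_measures"
  shows "circle_convolution \<mu> (character_measure n) = (\<lambda>E. fourier \<mu> n * character_measure n E)"
  by (rule fourier_inject)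
    (auto simp: fourier_convolution fourier_scale fourier_character_measure assms character_measure_circle
      circle_convolution_measure circle_measures_scale)

text \<open>The product of the transforms has the weights of \<open>A\<close> times those of
  \<open>B\<close>, which vanish beyond the finite set \<open>A \<inter> B\<close>; so its support
  is bounded and the convolution is a finite sum.\<close>

lemma riesz_measure_convolution:
  assumes "finite (A \<inter> B)"
  shows "\<exists>K. circle_convolution (riesz_measure A) (riesz_measure B) =
    (\<lambda>E. \<Sum>n=-K..K. fourier (riesz_measure A) n * fourier (riesz_measure B) n * character_measure n E)"
proof -
  obtain N where N: "\<And>k. k \<in> A \<inter> B \<Longrightarrow> k < N"
    using assms by (meson finite_nat_iff_bounded lessThan_iff subsetD)
  let ?K = "ternary_radius N" and ?c = "\<lambda>n. fourier (riesz_measure A) n * fourier (riesz_measure B) n"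
  have zero: "?c n = 0" if "\<not> \<bar>n\<bar> \<le> ?K" for n
  proof -
    have "riesz_coeff (\<lambda>k. half_weights A k * half_weights B k) n = 0"
    proof (rule ccontr)
      assume *: "riesz_coeff (\<lambda>k. half_weights A k * half_weights B k) n \<noteq> 0"
      have "half_weights A k * half_weights B k = 0" if "k \<ge> N" for k
        using N[of k] that by (auto simp: half_weights_def)
      from riesz_coeff_support[of N "\<lambda>k. half_weights A k * half_weights B k", OF this *] show False using that by blast
    qed
    then show ?thesis
      by (simp add: fourier_riesz_measure riesz_coeff_mult flip: of_real_mult)
  qed
  have m: "(\<lambda>E. ?c n * character_measure n E) \<in> circle_measures" for n
    by (intro circle_measures_scale character_measure_circle)
  have "circle_convolution (riesz_measure A) (riesz_measure B) =
    (\<lambda>E. \<Sum>n=-?K..?K. ?c n * character_measure n E)"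
  proof (rule fourier_inject)
    fix k
    have "fourier (\<lambda>E. \<Sum>n=-?K..?K. ?c n * character_measure n E) k =
      (\<Sum>n=-?K..?K. fourier (\<lambda>E. ?c n * character_measure n E) k)"
      by (rule fourier_sum[OF m])
    also have "\<dots> = (\<Sum>n=-?K..?K. if n = k then ?c k else 0)"
      by (intro sum.cong refl) (auto simp: fourier_scale character_measure_circle fourier_character_measure)
    also have "\<dots> = ?c k"
      using zero[of k] by (auto simp: abs_le_iff)
    finally show "fourier (circle_convolution (riesz_measure A) (riesz_measure B)) k =
       fourier (\<lambda>E. \<Sum>n=-?K..?K. ?c n * character_measure n E) k"
      by (simp add: fourier_convolution riesz_measure_circle)
  qed (intro circle_convolution_measure riesz_measure_circle, intro circle_measures_sum m)
  then show ?thesis by blast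
qed

section \<open>Characters on trigonometric polynomials\<close>

lemma gelfand_characters_sum:
  assumes \<phi>: "\<phi> \<in> gelfand_characters" and "\<And>i. i \<in> I \<Longrightarrow> \<mu> i \<in> circle_measures"
  shows "\<phi> (\<lambda>E. \<Sum>i\<in>I. \<mu> i E) = (\<Sum>i\<in>I. \<phi> (\<mu> i))"
proof -
  have add: "\<phi> (\<lambda>E. \<mu> E + \<nu> E) = \<phi> \<mu> + \<phi> \<nu>" if "\<mu> \<in> circle_measures" "\<nu> \<in> circle_measures" for \<mu> \<nu>
    using \<phi> that by (simp add: gelfand_characters_def)
  \<comment> \<open>The value at the zero measure, needed for the empty sum, comes from homogeneity
    with the scalar 0.\<close>
  have "\<phi> (\<lambda>E. 0 * character_measure 0 E) = 0 * \<phi> (character_measure 0)"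
    using \<phi> character_measure_circle unfolding gelfand_characters_def by blast
  then have zero: "\<phi> (\<lambda>E. 0) = 0" by simp
  show ?thesis
    using assms(2)
  proof (induction I rule: infinite_finite_induct)
    case (insert i I)
    then have "\<phi> (\<lambda>E. \<mu> i E + (\<Sum>i\<in>I. \<mu> i E)) = \<phi> (\<mu> i) + \<phi> (\<lambda>E. \<Sum>i\<in>I. \<mu> i E)"
      by (intro add circle_measures_sum) auto
    then show ?case using insert by simp
  qed (simp_all add: zero)
qed

text \<open>Convolution acts on \<open>character_measure n\<close> as multiplication by
  \<open>fourier \<mu> n\<close>; apply \<open>\<phi>\<close> and cancel its nonzero value.\<close>

lemma gelfand_evaluation:
  assumes \<phi>: "\<phi> \<in> gelfand_characters" and nz: "\<phi> (character_measure n) \<noteq> 0" and \<mu>: "\<mu> \<in> circle_measures"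
  shows "\<phi> \<mu> = fourier \<mu> n"
proof -
  have "\<phi> \<mu> * \<phi> (character_measure n) = \<phi> (circle_convolution \<mu> (character_measure n))"
    using \<phi> \<mu> character_measure_circle by (simp add: gelfand_characters_def)
  also have "\<dots> = fourier \<mu> n * \<phi> (character_measure n)"
    unfolding character_measure_convolution[OF \<mu>]
    using \<phi> character_measure_circle unfolding gelfand_characters_def by blast
  finally show ?thesis using nz by simp
qed

section \<open>The open sets: openness, disjointness and existence of points\<close>

definition riesz_open :: "nat set \<Rightarrow> ((complex set \<Rightarrow> complex) \<Rightarrow> complex) set" where
  "riesz_open A = {\<phi> \<in> gelfand_characters. 1 / 2 < norm (\<phi> (riesz_measure A)) \<and> norm (\<phi> (character_measure 0)) < 1 / 2}"

lemma topspace_gelfand_space: "topspace gelfand_space = gelfand_characters"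
  by (auto simp: gelfand_space_def gelfand_characters_def PiE_def extensional_def)

lemma openin_riesz_open: "openin gelfand_space (riesz_open A)"
proof -
  have cont: "continuous_map gelfand_space euclidean (\<lambda>\<phi>. \<phi> \<mu>)" if "\<mu> \<in> circle_measures" for \<mu>
    unfolding gelfand_space_def
    using that by (intro continuous_map_from_subtopology continuous_map_product_projection)
  have "openin gelfand_space {\<phi> \<in> topspace gelfand_space. \<phi> (riesz_measure A) \<in> {z. 1 / 2 < norm z}}"
    by (rule openin_continuous_map_preimage[OF cont[OF riesz_measure_circle]])
      (unfold open_openin[symmetric] mem_Collect_eq, intro open_Collect_less continuous_intros)
  moreover have "openin gelfand_space {\<phi> \<in> topspace gelfand_space. \<phi> (character_measure 0) \<in> {z. norm z < 1 / 2}}"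
    by (rule openin_continuous_map_preimage[OF cont[OF character_measure_circle]])
      (unfold open_openin[symmetric] mem_Collect_eq, intro open_Collect_less continuous_intros)
  ultimately have "openin gelfand_space ({\<phi> \<in> topspace gelfand_space. \<phi> (riesz_measure A) \<in> {z. 1 / 2 < norm z}} \<inter>
     {\<phi> \<in> topspace gelfand_space. \<phi> (character_measure 0) \<in> {z. norm z < 1 / 2}})"
    by (rule openin_Int)
  also have "\<dots> = riesz_open A" by (auto simp: riesz_open_def topspace_gelfand_space)
  finally show ?thesis .
qed

lemma riesz_open_disjoint:
  assumes "finite (A \<inter> B)" shows "riesz_open A \<inter> riesz_open B = {}"
proof (rule ccontr)
  assume "riesz_open A \<inter> riesz_open B \<noteq> {}"
  then obtain \<phi> where \<phi>: "\<phi> \<in> gelfand_characters" "1 / 2 < norm (\<phi> (riesz_measure A))"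
    "1 / 2 < norm (\<phi> (riesz_measure B))" "norm (\<phi> (character_measure 0)) < 1 / 2"
    by (auto simp: riesz_open_def)
  show False
  proof (cases "\<exists>n. \<phi> (character_measure n) \<noteq> 0")
    case True
    then obtain n where n: "\<phi> (character_measure n) \<noteq> 0" by blast
    note ev = gelfand_evaluation[OF \<phi>(1) n]
    \<comment> \<open>Evaluation at 0 gives the Haar measure the value 1, against the second
      condition; every other evaluation fails the first one.\<close>
    have "n \<noteq> 0" using \<phi>(4) ev[OF character_measure_circle, of 0] by (auto simp: fourier_character_measure)
    then show False
      using \<phi>(2) riesz_coeff_bounds[of "half_weights A" n, OF half_weights_bounds] \<open>n \<noteq> 0\<close>
      by (simp add: ev[OF riesz_measure_circle] fourier_riesz_measure)
  next
    case False
    obtain K where K: "circle_convolution (riesz_measure A) (riesz_measure B) =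
        (\<lambda>E. \<Sum>n=-K..K. fourier (riesz_measure A) n * fourier (riesz_measure B) n * character_measure n E)"
      using riesz_measure_convolution[OF assms] by blast
    have s: "\<phi> (\<lambda>E. c * character_measure n E) = c * \<phi> (character_measure n)" for c n
      using \<phi>(1) character_measure_circle unfolding gelfand_characters_def by blast
    have "\<phi> (riesz_measure A) * \<phi> (riesz_measure B) = \<phi> (circle_convolution (riesz_measure A) (riesz_measure B))"
      using \<phi>(1) riesz_measure_circle by (simp add: gelfand_characters_def)
    \<comment> \<open>The convolution is a combination of character measures, on all of which
      \<open>\<phi>\<close> vanishes. This forces one of the two values on the left to be 0,
      although both have modulus above 1/2.\<close>
    also have "\<dots> = 0"
      unfolding K using False
      by (subst gelfand_characters_sum[OF \<phi>(1)]) (auto simp: s intro: circle_measures_scale character_measure_circle)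
    finally show False using \<phi>(2,3) by auto
  qed
qed

text \<open>The witness is the alive part of the transform along an ultrafilter that contains
  \<open>A\<close> and all cofinite sets.\<close>

lemma riesz_open_nonempty:
  assumes "infinite A" shows "riesz_open A \<noteq> {}"
proof -
  \<comment> \<open>This filter is proper because \<open>A\<close> is infinite.\<close>
  have "inf sequentially (principal A) \<noteq> bot"
    using assms by (auto simp: trivial_limit_def eventually_inf_principal eventually_sequentially infinite_nat_iff_unbounded_le)
  then obtain U where U: "U \<le> inf sequentially (principal A)" "U \<noteq> bot"
      "\<And>P. eventually P U \<or> eventually (\<lambda>x. \<not> P x) U"
    using ultrafilter_exists by blast
  interpret ultrafilter U by unfold_locales (use U in auto)
  have evU: "eventually P U" if "eventually P sequentially" for P
    using U(1) that by (meson filter_leD le_inf_iff)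
  have evA: "eventually (\<lambda>k. k \<in> A) U"
    using U(1) by (meson eventually_principal filter_leD le_inf_iff)
  let ?s = "\<lambda>k::nat. 3 ^ k :: int"
  define \<phi> where "\<phi> = restrict (\<lambda>\<mu>. alive_part ?s (fourier \<mu>)) circle_measures"
  have large: "eventually (\<lambda>k. \<bar>n\<bar> \<le> ternary_radius k) U" for n
  proof (rule evU, rule eventually_sequentiallyI)
    fix k assume "nat \<bar>n\<bar> \<le> k"
    then show "\<bar>n\<bar> \<le> ternary_radius k" using ternary_radius_ge[of k] by linarith
  qed
  have \<phi>R: "\<phi> (riesz_measure A) = 1"
  proof -
    let ?F = "fourier (riesz_measure A)"
    \<comment> \<open>For large \<open>k\<close> in \<open>A\<close>, a shift by
      \<open>3 ^ k\<close> in either direction multiplies the coefficient by the weight 1/2. The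
      dead part is \<open>(3 / 4) ^ j\<close>, so no mass is dead.\<close>
    have "dead_part ?s ?F j = (1 - 1 / 2 * (1 / 2)) ^ j * ?F 0" for j
    proof (rule dead_part_eigen)
      show "bounded_fun ?F" by (intro bounded_fun_fs_transform fs_transform_fourier riesz_measure_circle)
      show "((\<lambda>k. ?F (n + ?s k)) \<longlongrightarrow> 1 / 2 * ?F n) U" for n
        by (rule tendsto_eventually, use large[of n] evA in eventually_elim)
          (simp add: fourier_riesz_measure riesz_coeff_shift half_weights_def)
      show "((\<lambda>k. ?F (n - ?s k)) \<longlongrightarrow> 1 / 2 * ?F n) U" for n
        by (rule tendsto_eventually, use large[of n] evA in eventually_elim)
          (simp add: fourier_riesz_measure riesz_coeff_shift half_weights_def)
    qed
    then have "dead_part ?s ?F = (\<lambda>j. (3 / 4) ^ j)" by (simp add: fun_eq_iff fourier_riesz_measure)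
    moreover have "(\<lambda>j. (3 / 4 :: complex) ^ j) \<longlonglongrightarrow> 0" by (rule LIMSEQ_power_zero) simp
    ultimately have "lim (dead_part ?s ?F) = 0" by (simp add: limI)
    then show ?thesis by (simp add: \<phi>_def alive_part_def riesz_measure_circle fourier_riesz_measure)
  qed
  have \<phi>0: "\<phi> (character_measure 0) = 0"
  proof -
    let ?F = "fourier (character_measure 0)"
    have pos: "eventually (\<lambda>k. \<bar>n\<bar> < 3 ^ k) U" for n :: int
    proof (rule evU, rule eventually_sequentiallyI)
      fix k assume k: "nat \<bar>n\<bar> \<le> k"
      have "k < 3 ^ k" by (induction k) auto
      then have "int k < 3 ^ k" by (metis of_nat_less_iff of_nat_numeral of_nat_power)
      then show "\<bar>n\<bar> < 3 ^ k" using k by linarith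
    qed
    \<comment> \<open>Both shifted arguments are nonzero once \<open>3 ^ k\<close> exceeds
      \<open>\<bar>n\<bar>\<close>, so the limits are 0 and the whole mass is dead.\<close>
    have "dead_part ?s ?F j = (1 - 0 * 0) ^ j * ?F 0" for j
    proof (rule dead_part_eigen)
      show "bounded_fun ?F" by (intro bounded_fun_fs_transform fs_transform_fourier character_measure_circle)
      show "((\<lambda>k. ?F (n + ?s k)) \<longlongrightarrow> 0 * ?F n) U" for n
        by (rule tendsto_eventually, use pos[of n] in eventually_elim) (auto simp: fourier_character_measure)
      show "((\<lambda>k. ?F (n - ?s k)) \<longlongrightarrow> 0 * ?F n) U" for n
        by (rule tendsto_eventually, use pos[of n] in eventually_elim) (auto simp: fourier_character_measure)
    qed
    then have "dead_part ?s ?F = (\<lambda>j. 1)" by (simp add: fun_eq_iff fourier_character_measure)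
    then have "lim (dead_part ?s ?F) = 1" by simp
    then show ?thesis by (simp add: \<phi>_def alive_part_def character_measure_circle fourier_character_measure)
  qed
  have "\<phi> \<in> gelfand_characters"
    unfolding gelfand_characters_def
  proof (intro CollectI conjI ballI allI)
    show "\<phi> \<in> extensional circle_measures" by (simp add: \<phi>_def)
    show "\<exists>\<mu>\<in>circle_measures. \<phi> \<mu> \<noteq> 0" using \<phi>R riesz_measure_circle[of A] by (intro bexI[of _ "riesz_measure A"]) auto
  next
    fix \<mu> \<nu> assume m: "\<mu> \<in> circle_measures" "\<nu> \<in> circle_measures"
    have "fourier (\<lambda>E. \<mu> E + \<nu> E) = (\<lambda>n. fourier \<mu> n + fourier \<nu> n)" by (simp add: fun_eq_iff fourier_add m)
    then show "\<phi> (\<lambda>E. \<mu> E + \<nu> E) = \<phi> \<mu> + \<phi> \<nu>"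
      by (simp add: \<phi>_def m circle_measures_add alive_part_add fs_transform_fourier)
    have "fourier (circle_convolution \<mu> \<nu>) = (\<lambda>n. fourier \<mu> n * fourier \<nu> n)" by (simp add: fun_eq_iff fourier_convolution m)
    then show "\<phi> (circle_convolution \<mu> \<nu>) = \<phi> \<mu> * \<phi> \<nu>"
      by (simp add: \<phi>_def m circle_convolution_measure alive_part_mult fs_transform_fourier)
  next
    fix c \<mu> assume m: "\<mu> \<in> circle_measures"
    have "fourier (\<lambda>E. c * \<mu> E) = (\<lambda>n. c * fourier \<mu> n)" by (simp add: fun_eq_iff fourier_scale m)
    then show "\<phi> (\<lambda>E. c * \<mu> E) = c * \<phi> \<mu>"
      by (simp add: \<phi>_def m circle_measures_scale alive_part_scale fs_transform_fourier)
  qed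
  then have "\<phi> \<in> riesz_open A" using \<phi>R \<phi>0 by (simp add: riesz_open_def)
  then show ?thesis by blast
qed

text \<open>A dense set meets every member of the family, and choosing a point in each intersection
  is injective by disjointness.\<close>

lemma not_separable_space_if_uncountable_disjoint:
  assumes unc: "uncountable \<U>" and disj: "disjoint \<U>" and op: "\<And>U. U \<in> \<U> \<Longrightarrow> openin X U \<and> U \<noteq> {}"
  shows "\<not> separable_space X"
proof
  assume "separable_space X"
  then obtain C where C: "countable C" "C \<subseteq> topspace X" "X closure_of C = topspace X"
    by (auto simp: separable_space_def)
  have "\<exists>c. c \<in> C \<inter> U" if "U \<in> \<U>" for U
    using C(3) op[OF that] unfolding dense_intersects_open by blast
  then obtain g where g: "\<And>U. U \<in> \<U> \<Longrightarrow> g U \<in> C \<inter> U" by metis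
  have "inj_on g \<U>"
  proof (rule inj_onI, rule ccontr)
    fix U V assume UV: "U \<in> \<U>" "V \<in> \<U>" "g U = g V" "U \<noteq> V"
    then have "U \<inter> V = {}" using disj by (auto simp: pairwise_def disjnt_def)
    then show False using g[OF UV(1)] g[OF UV(2)] UV(3) by auto
  qed
  moreover have "countable (g ` \<U>)" using g by (intro countable_subset[OF _ C(1)]) auto
  ultimately have "countable \<U>" by (rule countable_image_inj_on[rotated])
  with unc show False by contradiction
qed

theorem theorem20:
  shows "(\<exists>\<U>. uncountable \<U> \<and> disjoint \<U> \<and> (\<forall>U\<in>\<U>. openin gelfand_space U \<and> U \<noteq> {})) \<and>
         \<not> separable_space gelfand_space"
proof -
  let ?V = "\<lambda>x. riesz_open (floor_codes x)"
  have ne: "?V x \<noteq> {}" for x by (intro riesz_open_nonempty infinite_floor_codes)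
  have disj: "?V x \<inter> ?V y = {}" if "x \<noteq> y" for x y
    by (intro riesz_open_disjoint finite_floor_codes_Int that)
  \<comment> \<open>Disjoint nonempty sets cannot coincide, so the family is as large as the index
    set of reals.\<close>
  have inj: "inj ?V"
  proof (rule injI, rule ccontr)
    fix x y assume "?V x = ?V y" "x \<noteq> y"
    then show False using disj[of x y] ne[of y] by simp
  qed
  have unc: "uncountable (range ?V)"
  proof
    assume "countable (range ?V)"
    then have "countable (UNIV :: real set)" by (rule countable_image_inj_on[OF _ inj])
    then show False using uncountable_UNIV_real by simp
  qed
  have dis: "disjoint (range ?V)"
  proof (rule pairwiseI)
    fix U W assume "U \<in> range ?V" "W \<in> range ?V" "U \<noteq> W"
    then obtain x y where "U = ?V x" "W = ?V y" "x \<noteq> y" by blast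
    then show "disjnt U W" using disj[of x y] by (simp add: disjnt_def)
  qed
  have op: "openin gelfand_space U \<and> U \<noteq> {}" if "U \<in> range ?V" for U
    using that openin_riesz_open ne by auto
  show ?thesis
    by (intro conjI exI[of _ "range ?V"] ballI unc dis op not_separable_space_if_uncountable_disjoint[OF unc dis op])
qed

end
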